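(* Let $\mathbb{G}$ be a stratified Lie group of homogeneous dimension $Q$. Let $s\in(0,1)$, $p\in(1,\infty)$, $Q>ps$ and $p<q<p_s^*:=\frac{Qp}{Q-ps}$. Then for every $u\in W_0^{s,p}(\mathbb{G})$, $u\ne0$, $$\int_{\mathbb{G}}\frac{|u(x)|^p}{\|u\|_{L^p(\mathbb{G})}^p}\log\left(\frac{|u(x)|^p}{\|u\|_{L^p(\mathbb{G})}^p}\right)dx\le\frac{Q}{s}\log\left(C_{GN,\mathbb{G}}^{\frac{ps}{Q(q-p)}}\,\frac{\left(\int_{\mathbb{G}}\int_{\mathbb{G}}\frac{|u(x)-u(y)|^p}{|y^{-1}x|^{Q+ps}}dxdy\right)^{\frac1p}}{\|u\|_{L^p(\mathbb{G})}}\right),$$ where $C_{GN,\mathbb{G}}$ is the best (smallest) constant $C$ in the fractional subelliptic Gagliardo–Nirenberg inequality $$\int_{\mathbb{G}}|u|^qdx\le C\left(\int_{\mathbb{G}}\int_{\mathbb{G}}\frac{|u(x)-u(y)|^p}{|y^{-1}x|^{Q+ps}}dxdy\right)^{\frac{Q(q-p)}{sp^2}}\left(\int_{\mathbb{G}}|u|^pdx\right)^{\frac{spq-Q(q-p)}{sp^2}},\quad u\in W_0^{s,p}(\mathbb{G}),$$ given by $$C_{GN,\mathbb{G}}=\frac{pqs}{pqs-Q(q-p)}\left(\frac{Q(q-p)}{pqs-Q(q-p)}\right)^{\frac{Q(p-q)}{sp^2}}\left(\frac{pqs-Q(q-p)}{(q-p)s}\,d\right)^{\frac{p-q}{p}},$$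 with $d=I(\phi)=\inf_{u\in\mathcal{N}}I(u)$, $\phi$ being a least energy solution of $(-\Delta_{p,\mathbb{G}})^su+|u|^{p-2}u=|u|^{q-2}u$, $u\in W_0^{s,p}(\mathbb{G})$.
   Context: Stratified Lie group: a Lie group $\mathbb{G}=(\mathbb{R}^N,\circ)$ with a decomposition $\mathbb{R}^N=\mathbb{R}^{N_1}\times\cdots\times\mathbb{R}^{N_k}$ such that (i) for each $\lambda>0$ the dilation $D_\lambda(x)=(\lambda x^{(1)},\lambda^2x^{(2)},\dots,\lambda^kx^{(k)})$, $x^{(i)}\in\mathbb{R}^{N_i}$, is an automorphism of $\mathbb{G}$; (ii) if $X_1,\dots,X_{N_1}$ are the left-invariant vector fields with $X_j(0)=\partial/\partial x_j|_0$, then the Lie algebra they generate has rank $N$ at every point. Its homogeneous dimension is $Q=\sum_{i=1}^k iN_i$. Haar measure $dx$ is Lebesgue measure on $\mathbb{R}^N$. $|\cdot|:\mathbb{G}\to[0,\infty)$ is a fixed homogeneous quasi-norm: continuous, $|x|=0$ iff $x=0$, $|x^{-1}|=|x|$, $|D_\lambda x|=\lambda|x|$ for $\lambda>0$. Write $y^{-1}x=y^{-1}\circ x$. $W^{s,p}(\mathbb{G})=\{u\in L^p(\mathbb{G}):[u]_{s,p}<\infty\}$, with $[u]_{s,p}^p=\iint_{\mathbb{G}\times\mathbb{G}}\frac{|u(x)-u(y)|^p}{|y^{-1}x|^{Q+ps}}dxdy$ and norm $\|u\|_{W^{s,p}}^p=\|u\|_{L^p}^p+[u]_{s,p}^p$;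 $W_0^{s,p}(\mathbb{G})$ is the closure of $C_c^\infty(\mathbb{G})$ in this norm (it equals $W^{s,p}(\mathbb{G})$). The equation is understood weakly: $u\in W_0^{s,p}(\mathbb{G})$ is a weak solution if for all $\psi\in W_0^{s,p}(\mathbb{G})$ $$\iint_{\mathbb{G}\times\mathbb{G}}\frac{|u(x)-u(y)|^{p-2}(u(x)-u(y))(\psi(x)-\psi(y))}{|y^{-1}x|^{Q+ps}}dxdy+\int_{\mathbb{G}}(|u|^{p-2}u\psi-|u|^{q-2}u\psi)dx=0.$$ Energy: $I(u)=\frac1p[u]_{s,p}^p+\frac1p\int_{\mathbb{G}}|u|^pdx-\frac1q\int_{\mathbb{G}}|u|^qdx$ on $W_0^{s,p}(\mathbb{G})$; the left-hand side of the weak formulation is $\langle I'(u),\psi\rangle$. Set $\mathcal{L}(u)=\langle I'(u),u\rangle=[u]_{s,p}^p+\int_{\mathbb{G}}(|u|^p-|u|^q)dx$ and $\mathcal{N}=\{u\in W_0^{s,p}(\mathbb{G})\setminus\{0\}:\mathcal{L}(u)=0\}$. Let $\Gamma$ be the set of nonzero weak solutions. A least energy solution is a $u\in\Gamma$ with $I(u)\le I(v)$ for all $v\in\Gamma$. Convention: $0\log0=0$; the left-hand integral of the logarithmic inequality may equal $-\infty$. *)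

theory Defs
  imports "HOL-Analysis.Analysis" "HOL-Algebra.Group"
begin

text \<open>On a finite-dimensional domain the following is the usual notion of a function of
  class \<open>C\<^sup>m\<close>: iterated directional derivatives up to order \<open>m\<close> exist and are continuous.\<close>

primrec Ck :: "nat \<Rightarrow> ('a::euclidean_space \<Rightarrow> 'b::real_normed_vector) \<Rightarrow> bool" where
  "Ck 0 f \<longleftrightarrow> continuous_on UNIV f"
| "Ck (Suc m) f \<longleftrightarrow>
     f differentiable_on UNIV \<and> (\<forall>v. Ck m (\<lambda>x. frechet_derivative f (at x) v))"

definition smooth :: "('a::euclidean_space \<Rightarrow> 'b::real_normed_vector) \<Rightarrow> bool" where
  "smooth f \<longleftrightarrow> (\<forall>m. Ck m f)"

definition test_functions :: "('a::euclidean_space \<Rightarrow> real) set" where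
  "test_functions = {u. smooth u \<and> compact (closure {x. u x \<noteq> 0})}"


section \<open>Stratified Lie groups\<close>

text \<open>A vector field on \<open>\<real>\<^sup>N\<close> is identified with its coefficient function
  \<open>\<real>\<^sup>N \<Rightarrow> \<real>\<^sup>N\<close>.\<close>

definition lie_bracket :: "('a::real_normed_vector \<Rightarrow> 'a) \<Rightarrow> ('a \<Rightarrow> 'a) \<Rightarrow> 'a \<Rightarrow> 'a" where
  "lie_bracket X Y = (\<lambda>x. frechet_derivative Y (at x) (X x) - frechet_derivative X (at x) (Y x))"

inductive_set generated_lie_algebra ::
    "('a::real_normed_vector \<Rightarrow> 'a) set \<Rightarrow> ('a \<Rightarrow> 'a) set" for S where
  generator: "X \<in> S \<Longrightarrow> X \<in> generated_lie_algebra S"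
| add: "X \<in> generated_lie_algebra S \<Longrightarrow> Y \<in> generated_lie_algebra S \<Longrightarrow>
    (\<lambda>x. X x + Y x) \<in> generated_lie_algebra S"
| scale: "X \<in> generated_lie_algebra S \<Longrightarrow> (\<lambda>x. (c::real) *\<^sub>R X x) \<in> generated_lie_algebra S"
| bracket: "X \<in> generated_lie_algebra S \<Longrightarrow> Y \<in> generated_lie_algebra S \<Longrightarrow>
    lie_bracket X Y \<in> generated_lie_algebra S"

definition left_invariant_field :: "(real^'n) monoid \<Rightarrow> (real^'n \<Rightarrow> real^'n) \<Rightarrow> bool" where
  "left_invariant_field G X \<longleftrightarrow>
     (\<forall>x y. X (x \<otimes>\<^bsub>G\<^esub> y) = frechet_derivative (\<lambda>z. x \<otimes>\<^bsub>G\<^esub> z) (at y) (X y))"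

text \<open>The decomposition \<open>\<real>\<^sup>N = \<real>\<^sup>N\<^sup>1 \<times> \<dots> \<times> \<real>\<^sup>N\<^sup>k\<close> is encoded by the map \<open>deg\<close> sending a
  coordinate index to the number of the factor it belongs to, so that
  \<open>N\<^sub>i = card {j. deg j = i}\<close>.\<close>

definition dilation :: "('n \<Rightarrow> nat) \<Rightarrow> real \<Rightarrow> real^'n \<Rightarrow> real^'n" where
  "dilation deg l x = (\<chi> j. l ^ deg j * x $ j)"

definition homogeneous_dim :: "nat \<Rightarrow> ('n::finite \<Rightarrow> nat) \<Rightarrow> nat" where
  "homogeneous_dim k deg = (\<Sum>i=1..k. i * card {j. deg j = i})"

definition horizontal_fields ::
    "(real^'n) monoid \<Rightarrow> ('n \<Rightarrow> nat) \<Rightarrow> (real^'n \<Rightarrow> real^'n) set" where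
  "horizontal_fields G deg =
     {X. left_invariant_field G X \<and> (\<exists>j. deg j = 1 \<and> X 0 = axis j 1)}"

text \<open>Since dilations are automorphisms, the unit of the group is automatically the
  origin.\<close>

locale stratified_lie_group = group G
  for G :: "(real^'n) monoid" (structure) and k :: nat and deg :: "'n \<Rightarrow> nat" +
  assumes carrier_UNIV: "carrier G = UNIV"
    and smooth_mult: "smooth (\<lambda>(x, y). x \<otimes> y)"
    and smooth_inverse: "smooth (\<lambda>x. inv x)"
    and strata: "range deg = {1..k}"
    and dilation_automorphism: "0 < l \<Longrightarrow> dilation deg l \<in> iso G G"
    and full_rank:
      "dim ((\<lambda>Z. Z x) ` generated_lie_algebra (horizontal_fields G deg)) = CARD('n)"

definition homogeneous_quasi_norm ::
    "(real^'n) monoid \<Rightarrow> ('n \<Rightarrow> nat) \<Rightarrow> (real^'n \<Rightarrow> real) \<Rightarrow> bool" where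
  "homogeneous_quasi_norm G deg \<nu> \<longleftrightarrow>
     continuous_on UNIV \<nu> \<and> (\<forall>x. 0 \<le> \<nu> x) \<and> (\<forall>x. \<nu> x = 0 \<longleftrightarrow> x = 0) \<and>
     (\<forall>x. \<nu> (inv\<^bsub>G\<^esub> x) = \<nu> x) \<and> (\<forall>l>0. \<forall>x. \<nu> (dilation deg l x) = l * \<nu> x)"


section \<open>Fractional Sobolev spaces\<close>

text \<open>Elements of \<open>L\<^sup>p\<close> are represented by real-valued Borel functions (every Lebesgue class
  contains one); no identification of almost everywhere equal functions is made, so that
  \<open>u \<noteq> 0\<close> in \<open>L\<^sup>p\<close> becomes \<open>nonzero u\<close>. In the quantities below \<open>Q\<close> is meant to be the
  homogeneous dimension.\<close>

definition nonzero :: "(real^'n \<Rightarrow> real) \<Rightarrow> bool" where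
  "nonzero u \<longleftrightarrow> \<not> (AE x in lborel. u x = 0)"

definition lp_norm :: "real \<Rightarrow> (real^'n \<Rightarrow> real) \<Rightarrow> real" where
  "lp_norm p u = (\<integral>x. \<bar>u x\<bar> powr p \<partial>lborel) powr (1 / p)"

text \<open>The \<open>p\<close>-th power of the Gagliardo seminorm \<open>[u]\<^sub>s\<^sub>,\<^sub>p\<close>, possibly infinite.\<close>

definition gagliardo_pow ::
    "(real^'n) monoid \<Rightarrow> (real^'n \<Rightarrow> real) \<Rightarrow> real \<Rightarrow> real \<Rightarrow> real \<Rightarrow> (real^'n \<Rightarrow> real) \<Rightarrow> ennreal" where
  "gagliardo_pow G \<nu> Q s p u =
     (\<integral>\<^sup>+(x, y). ennreal (\<bar>u x - u y\<bar> powr p / \<nu> (inv\<^bsub>G\<^esub> y \<otimes>\<^bsub>G\<^esub> x) powr (Q + p * s))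
        \<partial>(lborel \<Otimes>\<^sub>M lborel))"

text \<open>The \<open>p\<close>-th power of the norm of \<open>W\<^sup>s\<^sup>,\<^sup>p\<close>, possibly infinite.\<close>

definition sobolev_norm_pow ::
    "(real^'n) monoid \<Rightarrow> (real^'n \<Rightarrow> real) \<Rightarrow> real \<Rightarrow> real \<Rightarrow> real \<Rightarrow> (real^'n \<Rightarrow> real) \<Rightarrow> ennreal" where
  "sobolev_norm_pow G \<nu> Q s p u =
     (\<integral>\<^sup>+x. ennreal (\<bar>u x\<bar> powr p) \<partial>lborel) + gagliardo_pow G \<nu> Q s p u"

definition sobolev_space ::
    "(real^'n) monoid \<Rightarrow> (real^'n \<Rightarrow> real) \<Rightarrow> real \<Rightarrow> real \<Rightarrow> real \<Rightarrow> (real^'n \<Rightarrow> real) set" where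
  "sobolev_space G \<nu> Q s p = {u \<in> borel_measurable borel.
     (\<integral>\<^sup>+x. ennreal (\<bar>u x\<bar> powr p) \<partial>lborel) < \<infinity> \<and> gagliardo_pow G \<nu> Q s p u < \<infinity>}"

text \<open>The closure of the test functions; the norm is compared with \<open>\<epsilon>\<close> after raising both to
  the power \<open>p\<close>, where the norm takes values in \<open>[0,\<infinity>]\<close>.\<close>

definition sobolev_space0 ::
    "(real^'n) monoid \<Rightarrow> (real^'n \<Rightarrow> real) \<Rightarrow> real \<Rightarrow> real \<Rightarrow> real \<Rightarrow> (real^'n \<Rightarrow> real) set" where
  "sobolev_space0 G \<nu> Q s p = {u \<in> sobolev_space G \<nu> Q s p.
     \<forall>\<epsilon>>0. \<exists>\<phi>\<in>test_functions.
       sobolev_norm_pow G \<nu> Q s p (\<lambda>x. u x - \<phi> x) < ennreal (\<epsilon> powr p)}"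


section \<open>The equation and its variational structure\<close>

text \<open>For \<open>u\<close> and \<open>\<psi>\<close> in \<open>sobolev_space0\<close>, and \<open>p < q < Qp/(Q - ps)\<close>, all Bochner integrals
  below converge absolutely by the Hoelder and Sobolev inequalities.\<close>

definition energy_deriv ::
    "(real^'n) monoid \<Rightarrow> (real^'n \<Rightarrow> real) \<Rightarrow> real \<Rightarrow> real \<Rightarrow> real \<Rightarrow> real
     \<Rightarrow> (real^'n \<Rightarrow> real) \<Rightarrow> (real^'n \<Rightarrow> real) \<Rightarrow> real" where
  "energy_deriv G \<nu> Q s p q u \<psi> =
     (\<integral>(x, y). \<bar>u x - u y\<bar> powr (p - 2) * (u x - u y) * (\<psi> x - \<psi> y)
               / \<nu> (inv\<^bsub>G\<^esub> y \<otimes>\<^bsub>G\<^esub> x) powr (Q + p * s) \<partial>(lborel \<Otimes>\<^sub>M lborel))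
     + (\<integral>x. \<bar>u x\<bar> powr (p - 2) * u x * \<psi> x - \<bar>u x\<bar> powr (q - 2) * u x * \<psi> x \<partial>lborel)"

definition weak_solution ::
    "(real^'n) monoid \<Rightarrow> (real^'n \<Rightarrow> real) \<Rightarrow> real \<Rightarrow> real \<Rightarrow> real \<Rightarrow> real
     \<Rightarrow> (real^'n \<Rightarrow> real) \<Rightarrow> bool" where
  "weak_solution G \<nu> Q s p q u \<longleftrightarrow> u \<in> sobolev_space0 G \<nu> Q s p \<and>
     (\<forall>\<psi>\<in>sobolev_space0 G \<nu> Q s p. energy_deriv G \<nu> Q s p q u \<psi> = 0)"

definition energy ::
    "(real^'n) monoid \<Rightarrow> (real^'n \<Rightarrow> real) \<Rightarrow> real \<Rightarrow> real \<Rightarrow> real \<Rightarrow> real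
     \<Rightarrow> (real^'n \<Rightarrow> real) \<Rightarrow> real" where
  "energy G \<nu> Q s p q u = 1 / p * enn2real (gagliardo_pow G \<nu> Q s p u)
     + 1 / p * (\<integral>x. \<bar>u x\<bar> powr p \<partial>lborel) - 1 / q * (\<integral>x. \<bar>u x\<bar> powr q \<partial>lborel)"

definition nehari_functional ::
    "(real^'n) monoid \<Rightarrow> (real^'n \<Rightarrow> real) \<Rightarrow> real \<Rightarrow> real \<Rightarrow> real \<Rightarrow> real
     \<Rightarrow> (real^'n \<Rightarrow> real) \<Rightarrow> real" where
  "nehari_functional G \<nu> Q s p q u = enn2real (gagliardo_pow G \<nu> Q s p u)
     + (\<integral>x. \<bar>u x\<bar> powr p - \<bar>u x\<bar> powr q \<partial>lborel)"

definition nehari_set ::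
    "(real^'n) monoid \<Rightarrow> (real^'n \<Rightarrow> real) \<Rightarrow> real \<Rightarrow> real \<Rightarrow> real \<Rightarrow> real
     \<Rightarrow> (real^'n \<Rightarrow> real) set" where
  "nehari_set G \<nu> Q s p q =
     {u \<in> sobolev_space0 G \<nu> Q s p. nonzero u \<and> nehari_functional G \<nu> Q s p q u = 0}"

definition nonzero_solutions ::
    "(real^'n) monoid \<Rightarrow> (real^'n \<Rightarrow> real) \<Rightarrow> real \<Rightarrow> real \<Rightarrow> real \<Rightarrow> real
     \<Rightarrow> (real^'n \<Rightarrow> real) set" where
  "nonzero_solutions G \<nu> Q s p q = {u. weak_solution G \<nu> Q s p q u \<and> nonzero u}"

definition least_energy_solution ::
    "(real^'n) monoid \<Rightarrow> (real^'n \<Rightarrow> real) \<Rightarrow> real \<Rightarrow> real \<Rightarrow> real \<Rightarrow> real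
     \<Rightarrow> (real^'n \<Rightarrow> real) \<Rightarrow> bool" where
  "least_energy_solution G \<nu> Q s p q u \<longleftrightarrow> u \<in> nonzero_solutions G \<nu> Q s p q \<and>
     (\<forall>v\<in>nonzero_solutions G \<nu> Q s p q. energy G \<nu> Q s p q u \<le> energy G \<nu> Q s p q v)"


section \<open>The inequalities\<close>

text \<open>The left-hand side is a nonnegative integral with values in \<open>[0,\<infinity>]\<close>, so the inequality
  includes its finiteness.\<close>

definition gagliardo_nirenberg ::
    "(real^'n) monoid \<Rightarrow> (real^'n \<Rightarrow> real) \<Rightarrow> real \<Rightarrow> real \<Rightarrow> real \<Rightarrow> real \<Rightarrow> real \<Rightarrow> bool" where
  "gagliardo_nirenberg G \<nu> Q s p q C \<longleftrightarrow> (\<forall>u\<in>sobolev_space0 G \<nu> Q s p.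
     (\<integral>\<^sup>+x. ennreal (\<bar>u x\<bar> powr q) \<partial>lborel)
     \<le> ennreal (C * enn2real (gagliardo_pow G \<nu> Q s p u) powr (Q * (q - p) / (s * p\<^sup>2))
                  * (\<integral>x. \<bar>u x\<bar> powr p \<partial>lborel) powr ((s * p * q - Q * (q - p)) / (s * p\<^sup>2))))"

definition best_gn_constant ::
    "(real^'n) monoid \<Rightarrow> (real^'n \<Rightarrow> real) \<Rightarrow> real \<Rightarrow> real \<Rightarrow> real \<Rightarrow> real \<Rightarrow> real \<Rightarrow> bool" where
  "best_gn_constant G \<nu> Q s p q C \<longleftrightarrow> gagliardo_nirenberg G \<nu> Q s p q C \<and>
     (\<forall>C'. gagliardo_nirenberg G \<nu> Q s p q C' \<longrightarrow> C \<le> C')"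

text \<open>Positive part minus negative part, so that \<open>-\<infinity>\<close> is an admissible value. As
  \<open>\<infinity> - \<infinity> = \<infinity>\<close> in \<^typ>\<open>ereal\<close>, a finite upper bound entails that the positive part is
  integrable.\<close>

definition extended_integral :: "(real^'n \<Rightarrow> real) \<Rightarrow> ereal" where
  "extended_integral f =
     enn2ereal (\<integral>\<^sup>+x. ennreal (f x) \<partial>lborel) - enn2ereal (\<integral>\<^sup>+x. ennreal (- f x) \<partial>lborel)"

text \<open>The convention \<open>0 log 0 = 0\<close> needs no special treatment, as \<open>0 * ln 0 = 0\<close>.\<close>

definition lp_entropy :: "real \<Rightarrow> (real^'n \<Rightarrow> real) \<Rightarrow> ereal" where
  "lp_entropy p u = extended_integral (\<lambda>x.
     \<bar>u x\<bar> powr p / lp_norm p u powr p * ln (\<bar>u x\<bar> powr p / lp_norm p u powr p))"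

end

theory Submission
  imports Defs
begin

text \<open>Let \<open>S\<close> be the infimum of the \<open>p\<close>-th power \<open>F\<close> of the Sobolev norm over functions in \<open>W\<^sub>0\<close> with
  \<open>\<integral>\<bar>u\<bar>\<^sup>q = 1\<close>. If \<open>g x\<close> is the integral over \<open>y\<close> of the Gagliardo integrand, averaging over a ball gives
  \<open>\<bar>u x\<bar>\<^sup>p \<le> C (r\<^bsup>ps\<^esup> g x + r\<^bsup>-Q\<^esup> \<integral>\<^bsub>B(x,r)\<^esub> \<bar>u\<bar>\<^sup>p)\<close>. Optimising in \<open>r\<close> and iterating yields the subcritical
  embeddings; restricting to \<open>r \<le> 1\<close> shows that a minimising sequence cannot vanish. After
  translation it therefore converges almost everywhere to a nonzero limit, and the Brezis-Lieb lemma
  together with the strict concavity of \<open>t \<mapsto> t\<^bsup>p/q\<^esup>\<close> excludes a loss of mass, so \<open>S\<close> is attained. A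
  multiple of the minimiser is a weak solution of least energy \<open>(1/p - 1/q) S\<^bsup>q/(q-p)\<^esup>\<close>. Optimising the
  Sobolev inequality over dilations turns \<open>S\<close> into the best Gagliardo-Nirenberg constant, and Jensen's
  inequality for the density \<open>\<bar>u\<bar>\<^sup>p / \<parallel>u\<parallel>\<^sub>p\<^sup>p\<close> turns the latter into the logarithmic inequality.\<close>

section \<open>Elementary inequalities for powers\<close>

lemma abs_add_powr_le:
  fixes a b p :: real
  assumes "0 \<le> p"
  shows "\<bar>a + b\<bar> powr p \<le> 2 powr p * (\<bar>a\<bar> powr p + \<bar>b\<bar> powr p)"
proof -
  have "\<bar>a + b\<bar> powr p \<le> (2 * max \<bar>a\<bar> \<bar>b\<bar>) powr p"
    by (rule powr_mono2) (use assms in auto)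
  also have "\<dots> = 2 powr p * max \<bar>a\<bar> \<bar>b\<bar> powr p"
    by (simp add: powr_mult)
  also have "\<dots> \<le> 2 powr p * (\<bar>a\<bar> powr p + \<bar>b\<bar> powr p)"
    by (rule mult_left_mono) (auto simp: max_def)
  finally show ?thesis .
qed

lemma abs_diff_powr_le:
  fixes a b p :: real
  assumes "0 \<le> p"
  shows "\<bar>a - b\<bar> powr p \<le> 2 powr p * (\<bar>a\<bar> powr p + \<bar>b\<bar> powr p)"
  using abs_add_powr_le[OF assms, of a "- b"] by simp

lemma abs_add_powr_le_eps:
  fixes p \<epsilon> :: real
  assumes "0 < p" "0 < \<epsilon>"
  obtains C where "0 \<le> C" "\<And>a b. \<bar>a + b\<bar> powr p \<le> (1 + \<epsilon>) * \<bar>a\<bar> powr p + C * \<bar>b\<bar> powr p"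
proof -
  define \<delta> where "\<delta> = (1 + \<epsilon>) powr (1 / p) - 1"
  have \<delta>: "0 < \<delta>" "(1 + \<delta>) powr p = 1 + \<epsilon>"
    using assms by (auto simp: \<delta>_def powr_powr)
  have "\<bar>a + b\<bar> powr p \<le> (1 + \<epsilon>) * \<bar>a\<bar> powr p + (1 + 1 / \<delta>) powr p * \<bar>b\<bar> powr p" for a b
  proof (cases "\<bar>b\<bar> \<le> \<delta> * \<bar>a\<bar>")
    case True
    then have "\<bar>a + b\<bar> powr p \<le> ((1 + \<delta>) * \<bar>a\<bar>) powr p"
      using assms by (intro powr_mono2) (auto simp: algebra_simps)
    also have "\<dots> = (1 + \<epsilon>) * \<bar>a\<bar> powr p"
      using \<delta> by (simp add: powr_mult)
    finally show ?thesis by (simp add: add_increasing2)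
  next
    case False
    have "\<delta> * \<bar>a + b\<bar> \<le> \<delta> * (\<bar>a\<bar> + \<bar>b\<bar>)"
      using \<delta>(1) by (intro mult_left_mono) auto
    with False have "\<bar>a + b\<bar> \<le> (1 + 1 / \<delta>) * \<bar>b\<bar>"
      using \<delta>(1) by (simp add: field_simps)
    then have "\<bar>a + b\<bar> powr p \<le> ((1 + 1 / \<delta>) * \<bar>b\<bar>) powr p"
      using assms by (intro powr_mono2) auto
    also have "\<dots> = (1 + 1 / \<delta>) powr p * \<bar>b\<bar> powr p"
      using \<delta> by (simp add: powr_mult)
    finally show ?thesis using assms by (simp add: add_increasing)
  qed
  then show thesis by (intro that[of "(1 + 1 / \<delta>) powr p"]) auto
qed

lemma brezis_lieb_pointwise:
  fixes p \<epsilon> :: real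
  assumes "0 < p" "0 < \<epsilon>"
  obtains C where "0 \<le> C"
    "\<And>a b. \<bar>\<bar>a + b\<bar> powr p - \<bar>a\<bar> powr p - \<bar>b\<bar> powr p\<bar> \<le> \<epsilon> * \<bar>a\<bar> powr p + C * \<bar>b\<bar> powr p"
proof -
  obtain C where C: "0 \<le> C"
    "\<And>a b. \<bar>a + b\<bar> powr p \<le> (1 + \<epsilon>) * \<bar>a\<bar> powr p + C * \<bar>b\<bar> powr p"
    using abs_add_powr_le_eps[OF assms] by blast
  have "\<bar>\<bar>a + b\<bar> powr p - \<bar>a\<bar> powr p - \<bar>b\<bar> powr p\<bar> \<le> \<epsilon> * \<bar>a\<bar> powr p + (C + 1) * \<bar>b\<bar> powr p" for a b
  proof -
    let ?x = "\<bar>a + b\<bar> powr p" and ?a = "\<bar>a\<bar> powr p" and ?b = "\<bar>b\<bar> powr p"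
    have up: "?x \<le> (1 + \<epsilon>) * ?a + C * ?b" by (rule C)
    have lo: "?a \<le> (1 + \<epsilon>) * ?x + C * ?b" using C(2)[of "a + b" "- b"] by simp
    have nn: "0 \<le> ?x" "0 \<le> ?a" "0 \<le> ?b" by auto
    have "?a \<le> ?x + \<epsilon> * ?a + C * ?b"
    proof (cases "?a \<le> ?x")
      case True
      then show ?thesis using nn C(1) assms(2) by (simp add: add_increasing2)
    next
      case False
      then have "\<epsilon> * ?x \<le> \<epsilon> * ?a" using assms(2) by (intro mult_left_mono) auto
      with lo show ?thesis by (simp add: algebra_simps)
    qed
    with up nn show ?thesis unfolding abs_le_iff distrib_right by linarith
  qed
  with C(1) show thesis by (intro that[of "C + 1"]) auto
qed

lemma has_real_derivative_abs_powr:
  fixes p x :: real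
  assumes "1 < p"
  shows "((\<lambda>x. \<bar>x\<bar> powr p) has_real_derivative p * (\<bar>x\<bar> powr (p - 2) * x)) (at x)"
proof -
  consider "0 < x" | "x < 0" | "x = 0" by linarith
  then show ?thesis
  proof cases
    case 1
    have "((\<lambda>x. x powr p) has_real_derivative p * x powr (p - 1)) (at x)"
      using 1 by (rule has_real_derivative_powr)
    moreover have "x powr (p - 1) = \<bar>x\<bar> powr (p - 2) * x"
      using 1 powr_add[of x "p - 2" 1] by simp
    ultimately have "((\<lambda>x. x powr p) has_real_derivative p * (\<bar>x\<bar> powr (p - 2) * x)) (at x)" by simp
    then show ?thesis
      by (rule has_field_derivative_transform_within_open[of _ _ _ "{0<..}"]) (use 1 in auto)
  next
    case 2
    have "((\<lambda>x. (- x) powr p) has_real_derivative - (p * (- x) powr (p - 1))) (at x)"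
      using 2 by (auto intro!: derivative_eq_intros)
    moreover have "(- x) powr (p - 1) = \<bar>x\<bar> powr (p - 2) * (- x)"
      using 2 powr_add[of "- x" "p - 2" 1] by simp
    ultimately have "((\<lambda>x. (- x) powr p) has_real_derivative p * (\<bar>x\<bar> powr (p - 2) * x)) (at x)"
      by simp
    then show ?thesis
      by (rule has_field_derivative_transform_within_open[of _ _ _ "{..<0}"]) (use 2 in auto)
  next
    case 3
    have "((\<lambda>h. \<bar>h\<bar> powr (p - 1)) \<longlongrightarrow> 0) (at (0::real))"
      using assms by (auto intro!: tendsto_eq_intros)
    then have "((\<lambda>h. \<bar>h\<bar> powr p / h) \<longlongrightarrow> 0) (at (0::real))"
    proof (rule Lim_null_comparison[rotated])
      show "\<forall>\<^sub>F h in at (0::real). norm (\<bar>h\<bar> powr p / h) \<le> \<bar>h\<bar> powr (p - 1)"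
        by (auto simp: eventually_at_filter powr_diff intro!: always_eventually)
    qed
    then show ?thesis using 3 by (simp add: has_field_derivative_iff)
  qed
qed

lemma abs_powr_diff_le:
  fixes a b t p :: real
  assumes "1 < p" "\<bar>t\<bar> \<le> 1"
  shows "\<bar>\<bar>a + t * b\<bar> powr p - \<bar>a\<bar> powr p\<bar> \<le> \<bar>t\<bar> * (p * (\<bar>a\<bar> + \<bar>b\<bar>) powr p)"
proof -
  let ?M = "\<bar>a\<bar> + \<bar>b\<bar>"
  have tb: "\<bar>t * b\<bar> \<le> \<bar>b\<bar>" using assms(2) by (simp add: abs_mult mult_left_le_one_le)
  have "norm (\<bar>a + t * b\<bar> powr p - \<bar>a\<bar> powr p) \<le> (p * ?M powr (p - 1)) * norm (a + t * b - a)"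
  proof (rule field_differentiable_bound[where S = "{- ?M..?M}"])
    show "((\<lambda>x. \<bar>x\<bar> powr p) has_field_derivative p * (\<bar>z\<bar> powr (p - 2) * z)) (at z within {- ?M..?M})" for z
      by (rule has_field_derivative_at_within, rule has_real_derivative_abs_powr, rule assms)
    show "norm (p * (\<bar>z\<bar> powr (p - 2) * z)) \<le> p * ?M powr (p - 1)" if "z \<in> {- ?M..?M}" for z
    proof -
      have "\<bar>z\<bar> powr (p - 2) * \<bar>z\<bar> = \<bar>z\<bar> powr (p - 1)"
        using powr_add[of "\<bar>z\<bar>" "p - 2" 1] by (cases "z = 0") auto
      moreover have "\<bar>z\<bar> powr (p - 1) \<le> ?M powr (p - 1)"
        using that assms by (intro powr_mono2) auto
      ultimately show ?thesis using assms by (simp add: abs_mult)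
    qed
  qed (use tb in auto)
  also have "\<dots> = \<bar>t\<bar> * (p * (?M powr (p - 1) * \<bar>b\<bar>))"
    by (simp add: abs_mult)
  also have "?M powr (p - 1) * \<bar>b\<bar> \<le> ?M powr (p - 1) * ?M"
    by (intro mult_left_mono) auto
  also have "?M powr (p - 1) * ?M = ?M powr p"
    using powr_add[of ?M "p - 1" 1] by (cases "?M = 0") auto
  finally show ?thesis using assms by (simp add: mult_left_mono)
qed

lemma powr_midpoint_less:
  fixes x y p :: real
  assumes "1 < p" "0 \<le> x" "x < y"
  shows "((x + y) / 2) powr p < (x powr p + y powr p) / 2"
proof -
  let ?m = "(x + y) / 2" and ?f' = "\<lambda>x::real. p * (\<bar>x\<bar> powr (p - 2) * x)"
  have d: "((\<lambda>x. \<bar>x\<bar> powr p) has_real_derivative ?f' z) (at z)" for z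
    by (rule has_real_derivative_abs_powr[OF assms(1)])
  obtain z1 where z1: "x < z1" "z1 < ?m" "\<bar>?m\<bar> powr p - \<bar>x\<bar> powr p = (?m - x) * ?f' z1"
    using MVT2[OF _ d, of x ?m] assms by force
  obtain z2 where z2: "?m < z2" "z2 < y" "\<bar>y\<bar> powr p - \<bar>?m\<bar> powr p = (y - ?m) * ?f' z2"
    using MVT2[OF _ d, of ?m y] assms by force
  have f': "?f' z = p * z powr (p - 1)" if "0 < z" for z
    using that powr_add[of z "p - 2" 1] by simp
  have "z1 powr (p - 1) < z2 powr (p - 1)"
    using z1 z2 assms by (intro powr_less_mono2) auto
  then have "?f' z1 < ?f' z2" using f' z1 z2 assms by auto
  moreover have "?m - x = y - ?m" "0 < y - ?m" using assms by (auto simp: field_simps)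
  ultimately have "(?m - x) * ?f' z1 < (y - ?m) * ?f' z2"
    by (metis mult_strict_left_mono)
  then show ?thesis using z1 z2 assms by (simp add: field_simps)
qed

lemma abs_midpoint_powr_less:
  fixes a b p :: real
  assumes "1 < p" "a \<noteq> b"
  shows "\<bar>(a + b) / 2\<bar> powr p < (\<bar>a\<bar> powr p + \<bar>b\<bar> powr p) / 2"
proof (cases "\<bar>a\<bar> = \<bar>b\<bar>")
  case True
  with assms have "a = - b" "b \<noteq> 0" by linarith+
  then show ?thesis by simp
next
  case False
  have *: "\<bar>(a + b) / 2\<bar> powr p \<le> ((\<bar>a\<bar> + \<bar>b\<bar>) / 2) powr p"
    using assms by (intro powr_mono2) auto
  from False consider "\<bar>a\<bar> < \<bar>b\<bar>" | "\<bar>b\<bar> < \<bar>a\<bar>" by linarith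
  then have "((\<bar>a\<bar> + \<bar>b\<bar>) / 2) powr p < (\<bar>a\<bar> powr p + \<bar>b\<bar> powr p) / 2"
    by cases (use powr_midpoint_less[of p "\<bar>a\<bar>" "\<bar>b\<bar>"] powr_midpoint_less[of p "\<bar>b\<bar>" "\<bar>a\<bar>"] assms
        in \<open>auto simp: add.commute\<close>)
  with * show ?thesis by linarith
qed

lemma uniform_convexity_pointwise:
  fixes p \<epsilon> :: real
  assumes p: "1 < p" and \<epsilon>: "0 < \<epsilon>"
  obtains C where "0 \<le> C"
    "\<And>a b. \<bar>a - b\<bar> powr p + C * \<bar>(a + b) / 2\<bar> powr p \<le> (\<epsilon> + C / 2) * (\<bar>a\<bar> powr p + \<bar>b\<bar> powr p)"
proof -
  define h where "h = (\<lambda>(a::real, b::real). (\<bar>a\<bar> powr p + \<bar>b\<bar> powr p) / 2 - \<bar>(a + b) / 2\<bar> powr p)"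
  define D where "D = (\<lambda>(a::real, b::real). \<bar>a - b\<bar> powr p)"
  define K where "K = (({-1..1} \<times> {-1..1}) \<inter> {z::real \<times> real. 1 \<le> max \<bar>fst z\<bar> \<bar>snd z\<bar>}) \<inter> {z. \<epsilon> \<le> D z}"
  have ch: "continuous_on UNIV h" unfolding h_def case_prod_unfold using p by (intro continuous_intros continuous_on_powr') auto
  have cD: "continuous_on UNIV D" unfolding D_def case_prod_unfold using p by (intro continuous_intros continuous_on_powr') auto
  have "closed {z::real \<times> real. 1 \<le> max \<bar>fst z\<bar> \<bar>snd z\<bar>}" "closed {z. \<epsilon> \<le> D z}"
    by (intro closed_Collect_le continuous_intros cD)+
  then have "compact K"
    unfolding K_def by (intro compact_Int_closed compact_Times compact_Icc)
  have h_pos: "0 < h z" if "z \<in> K" for z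
  proof -
    obtain a b where z: "z = (a, b)" by (cases z)
    with that \<epsilon> p have "a \<noteq> b" by (auto simp: K_def D_def)
    from abs_midpoint_powr_less[OF p this] show ?thesis by (simp add: z h_def)
  qed
  have h_nn: "0 \<le> h z" for z
  proof -
    obtain a b where z: "z = (a, b)" by (cases z)
    show ?thesis
      using abs_midpoint_powr_less[OF p, of a b] by (cases "a = b") (auto simp: z h_def abs_mult)
  qed
  obtain h0 where h0: "0 < h0" "\<And>z. z \<in> K \<Longrightarrow> h0 \<le> h z"
  proof (cases "K = {}")
    case True
    then show thesis by (intro that[of 1]) auto
  next
    case False
    then obtain z0 where "z0 \<in> K" "\<And>z. z \<in> K \<Longrightarrow> h z0 \<le> h z"
      using continuous_attains_inf[OF \<open>compact K\<close> _ continuous_on_subset[OF ch]] by auto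
    then show thesis using h_pos by (intro that[of "h z0"]) auto
  qed
  define C where "C = 2 powr p / h0"
  have C: "0 \<le> C" using h0 by (simp add: C_def)
  have unit: "D (a, b) \<le> \<epsilon> * (\<bar>a\<bar> powr p + \<bar>b\<bar> powr p) + C * h (a, b)" if m: "max \<bar>a\<bar> \<bar>b\<bar> = 1" for a b
  proof (cases "(a, b) \<in> K")
    case True
    have "D (a, b) \<le> 2 powr p" unfolding D_def using m p by (auto intro!: powr_mono2)
    also have "\<dots> \<le> C * h (a, b)"
      using h0(1) h0(2)[OF True] by (simp add: C_def field_simps)
    finally show ?thesis using \<epsilon> by (simp add: add_increasing)
  next
    case False
    then have "D (a, b) \<le> \<epsilon>" using m by (auto simp: K_def max_def split: if_splits)
    also have "1 \<le> \<bar>a\<bar> powr p + \<bar>b\<bar> powr p" using m by (auto simp: max_def split: if_splits)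
    then have "\<epsilon> \<le> \<epsilon> * (\<bar>a\<bar> powr p + \<bar>b\<bar> powr p)" using \<epsilon> by simp
    finally show ?thesis using C h_nn[of "(a, b)"] by (simp add: add_increasing2)
  qed
  have "\<bar>a - b\<bar> powr p + C * \<bar>(a + b) / 2\<bar> powr p \<le> (\<epsilon> + C / 2) * (\<bar>a\<bar> powr p + \<bar>b\<bar> powr p)" for a b
  proof (cases "max \<bar>a\<bar> \<bar>b\<bar> = 0")
    case True
    then have "a = 0" "b = 0" by (auto simp: max_def split: if_splits)
    then show ?thesis by simp
  next
    case False
    define m where "m = max \<bar>a\<bar> \<bar>b\<bar>"
    have m: "0 < m" using False by (simp add: m_def max_def split: if_splits)
    have "max \<bar>a / m\<bar> \<bar>b / m\<bar> = 1" using m by (auto simp: m_def max_def divide_simps)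
    from unit[OF this]
    have "\<bar>(a - b) / m\<bar> powr p + C * \<bar>(a + b) / 2 / m\<bar> powr p \<le> (\<epsilon> + C / 2) * (\<bar>a / m\<bar> powr p + \<bar>b / m\<bar> powr p)"
      by (simp add: D_def h_def algebra_simps add_divide_distrib diff_divide_distrib)
    moreover have "\<bar>x / m\<bar> powr p = \<bar>x\<bar> powr p / m powr p" for x
      using m by (simp add: abs_divide powr_divide)
    ultimately have "(\<bar>a - b\<bar> powr p + C * \<bar>(a + b) / 2\<bar> powr p) / m powr p \<le> (\<epsilon> + C / 2) * (\<bar>a\<bar> powr p + \<bar>b\<bar> powr p) / m powr p"
      by (simp only: add_divide_distrib[symmetric] times_divide_eq_right)
    then show ?thesis using m by (simp add: divide_le_cancel)
  qed
  with C show thesis by (intro that[of C]) auto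
qed

lemma powr_le_sum_powr:
  fixes p q m t :: real
  assumes "0 \<le> t" "p \<le> q" "q \<le> m"
  shows "t powr q \<le> t powr p + t powr m"
proof (cases "t \<le> 1")
  case True
  then have "t powr q \<le> t powr p" using assms by (cases "t = 0") (auto intro!: powr_mono')
  then show ?thesis by (simp add: add_increasing2)
next
  case False
  then have "t powr q \<le> t powr m" using assms by (intro powr_mono) auto
  then show ?thesis by (simp add: add_increasing)
qed

lemma powr_interpolate_eps:
  fixes p q m r \<epsilon> :: real
  assumes "0 < p" "p < q" "q < m" "0 < r" "0 < \<epsilon>"
  obtains C where "0 \<le> C" "\<And>t. 0 \<le> t \<Longrightarrow> t powr q \<le> \<epsilon> * (t powr p + t powr m) + C * t powr r"
proof -
  define a where "a = \<epsilon> powr (1 / (q - p))"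
  define b where "b = \<epsilon> powr (- 1 / (m - q))"
  have a: "0 < a" "a powr (q - p) = \<epsilon>" using assms by (auto simp: a_def powr_powr)
  have b: "0 < b" "b powr (q - m) = \<epsilon>"
  proof -
    have "- 1 / (m - q) * (q - m) = 1" using assms by (simp add: field_simps)
    then show "b powr (q - m) = \<epsilon>" using assms by (simp only: b_def powr_powr) simp
  qed (use assms in \<open>simp add: b_def\<close>)
  have "t powr q \<le> \<epsilon> * (t powr p + t powr m) + b powr q / a powr r * t powr r" if t: "0 \<le> t" for t
  proof -
    consider "t = 0" | "0 < t" "t \<le> a" | "b \<le> t" "0 < t" | "a < t" "t < b" using t by linarith
    then show ?thesis
    proof cases
      case 2
      have "t powr q = t powr (q - p) * t powr p" using 2 by (simp flip: powr_add)
      also have "\<dots> \<le> \<epsilon> * t powr p" using 2 a assms powr_mono2[of "q - p" t a] by (intro mult_right_mono) auto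
      also have "\<dots> \<le> \<epsilon> * (t powr p + t powr m)" using assms by (intro mult_left_mono) auto
      finally show ?thesis using a b by (simp add: add_increasing2)
    next
      case 3
      have "t powr q = t powr (q - m) * t powr m" using 3 by (simp flip: powr_add)
      also have "\<dots> \<le> \<epsilon> * t powr m" using 3 b assms powr_mono2'[of "q - m" b t] by (intro mult_right_mono) auto
      also have "\<dots> \<le> \<epsilon> * (t powr p + t powr m)" using assms by (intro mult_left_mono) auto
      finally show ?thesis using a b by (simp add: add_increasing2)
    next
      case 4
      have "t powr q \<le> b powr q" using 4 a assms by (intro powr_mono2) auto
      moreover have "a powr r \<le> t powr r" using 4 a assms by (intro powr_mono2) auto
      then have "b powr q \<le> b powr q / a powr r * t powr r"
        using a b by (simp add: field_simps)
      ultimately show ?thesis using assms by (simp add: add_increasing)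
    qed simp
  qed
  then show thesis by (intro that[of "b powr q / a powr r"]) auto
qed

lemma optimise_radius:
  fixes a C g \<alpha> \<beta> :: real
  assumes "0 \<le> a" "0 < C" "0 \<le> g" "0 < \<alpha>" "0 < \<beta>"
    and le: "\<And>r. 0 < r \<Longrightarrow> a \<le> C * (r powr \<alpha> * g + r powr (- \<beta>))"
  shows "a powr (1 + \<alpha> / \<beta>) \<le> (2 * C) powr (1 + \<alpha> / \<beta>) * g"
proof (cases "a = 0")
  case False
  then have a: "0 < a" using assms by simp
  define r where "r = (a / (2 * C)) powr (- 1 / \<beta>)"
  have r: "0 < r" using a assms by (simp add: r_def)
  have "r powr (- \<beta>) = a / (2 * C)" using a assms by (simp add: r_def powr_powr)
  with le[OF r] have "a / 2 \<le> C * (r powr \<alpha> * g)" using assms by (simp add: algebra_simps)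
  also have "r powr \<alpha> = (a / (2 * C)) powr (- (\<alpha> / \<beta>))" by (simp add: r_def powr_powr)
  finally have "a / (2 * C) \<le> (a / (2 * C)) powr (- (\<alpha> / \<beta>)) * g" using assms by (simp add: field_simps)
  then have "a / (2 * C) * (a / (2 * C)) powr (\<alpha> / \<beta>) \<le> g"
    using a assms by (simp add: powr_minus field_simps)
  then have "(a / (2 * C)) powr (1 + \<alpha> / \<beta>) \<le> g"
    using a assms by (simp add: powr_add)
  then show ?thesis using a assms by (simp add: powr_divide field_simps)
qed (use assms in auto)

lemma optimise_radius_le_1:
  fixes a C g \<alpha> \<beta> \<eta> :: real
  assumes "0 \<le> a" "0 < C" "0 \<le> g" "0 < \<alpha>" "0 < \<beta>" "0 < \<eta>"
    and le: "\<And>r. 0 < r \<Longrightarrow> r \<le> 1 \<Longrightarrow> a \<le> C * (r powr \<alpha> * g + r powr (- \<beta>) * \<eta>)"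
  shows "a powr (1 + \<alpha> / \<beta>) \<le> (2 * C * \<eta>) powr (\<alpha> / \<beta>) * (a + 2 * C * g)"
proof -
  have nn: "0 \<le> a + 2 * C * g" using assms by simp
  consider "a = 0" | "0 < a" "a \<le> 2 * C * \<eta>" | "0 < a" "2 * C * \<eta> < a" using assms by linarith
  then show ?thesis
  proof cases
    case 2
    have "a powr (1 + \<alpha> / \<beta>) = a powr (\<alpha> / \<beta>) * a" using 2 by (simp add: powr_add)
    also have "\<dots> \<le> (2 * C * \<eta>) powr (\<alpha> / \<beta>) * (a + 2 * C * g)"
      using 2 assms by (intro mult_mono powr_mono2) auto
    finally show ?thesis .
  next
    case 3
    define r where "r = (a / (2 * C * \<eta>)) powr (- 1 / \<beta>)"
    have r: "0 < r" using 3 assms by (simp add: r_def)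
    have "r \<le> (a / (2 * C * \<eta>)) powr 0" unfolding r_def using 3 assms by (intro powr_mono) (auto simp: field_simps)
    then have r1: "r \<le> 1" using 3 assms by (simp split: if_splits)
    have "r powr (- \<beta>) = a / (2 * C * \<eta>)" using 3 assms by (simp add: r_def powr_powr)
    with le[OF r r1] have "a / 2 \<le> C * (r powr \<alpha> * g)" using assms by (simp add: algebra_simps)
    also have "r powr \<alpha> = (a / (2 * C * \<eta>)) powr (- (\<alpha> / \<beta>))" by (simp add: r_def powr_powr)
    also have "\<dots> = (2 * C * \<eta>) powr (\<alpha> / \<beta>) / a powr (\<alpha> / \<beta>)"
      using 3 assms by (simp add: powr_minus powr_divide field_simps)
    finally have "a * a powr (\<alpha> / \<beta>) \<le> (2 * C * \<eta>) powr (\<alpha> / \<beta>) * (2 * C * g)"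
      using 3 by (simp add: field_simps)
    also have "\<dots> \<le> (2 * C * \<eta>) powr (\<alpha> / \<beta>) * (a + 2 * C * g)"
      using 3 by (intro mult_left_mono) auto
    finally show ?thesis using 3 by (simp add: powr_add)
  qed (use assms in auto)
qed

section \<open>Integrals of powers\<close>

lemma integrable_iff_nn_integral_finite:
  fixes f :: "'a \<Rightarrow> real"
  assumes "f \<in> borel_measurable M" "\<And>x. 0 \<le> f x"
  shows "integrable M f \<longleftrightarrow> (\<integral>\<^sup>+x. ennreal (f x) \<partial>M) < \<infinity>"
  using assms by (auto simp: integrable_iff_bounded)

lemma nn_integral_powr_add_le:
  fixes f g :: "'a \<Rightarrow> real"
  assumes [measurable]: "f \<in> borel_measurable M" "g \<in> borel_measurable M" and "0 \<le> p"
  shows "(\<integral>\<^sup>+x. ennreal (\<bar>f x + g x\<bar> powr p) \<partial>M)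
    \<le> ennreal (2 powr p) * ((\<integral>\<^sup>+x. ennreal (\<bar>f x\<bar> powr p) \<partial>M) + (\<integral>\<^sup>+x. ennreal (\<bar>g x\<bar> powr p) \<partial>M))"
proof -
  have "(\<integral>\<^sup>+x. ennreal (\<bar>f x + g x\<bar> powr p) \<partial>M)
    \<le> (\<integral>\<^sup>+x. ennreal (2 powr p) * (ennreal (\<bar>f x\<bar> powr p) + ennreal (\<bar>g x\<bar> powr p)) \<partial>M)"
    using abs_add_powr_le[OF \<open>0 \<le> p\<close>]
    by (intro nn_integral_mono) (simp flip: ennreal_plus ennreal_mult)
  then show ?thesis by (simp add: nn_integral_cmult nn_integral_add)
qed

lemma integrable_powr_add:
  fixes f g :: "'a \<Rightarrow> real"
  assumes [measurable]: "f \<in> borel_measurable M" "g \<in> borel_measurable M" and "0 \<le> p"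
    and f: "integrable M (\<lambda>x. \<bar>f x\<bar> powr p)" and g: "integrable M (\<lambda>x. \<bar>g x\<bar> powr p)"
  shows "integrable M (\<lambda>x. \<bar>f x + g x\<bar> powr p)"
proof (rule Bochner_Integration.integrable_bound)
  show "integrable M (\<lambda>x. 2 powr p * (\<bar>f x\<bar> powr p + \<bar>g x\<bar> powr p))"
    using f g by simp
qed (use abs_add_powr_le[OF \<open>0 \<le> p\<close>] in auto)

lemma integrable_powr_cmult:
  fixes f :: "'a \<Rightarrow> real"
  assumes "integrable M (\<lambda>x. \<bar>f x\<bar> powr p)"
  shows "integrable M (\<lambda>x. \<bar>c * f x\<bar> powr p)"
  using assms by (simp add: abs_mult powr_mult)

lemma integrable_powr_diff:
  fixes f g :: "'a \<Rightarrow> real"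
  assumes "f \<in> borel_measurable M" "g \<in> borel_measurable M" "0 \<le> p"
    "integrable M (\<lambda>x. \<bar>f x\<bar> powr p)" "integrable M (\<lambda>x. \<bar>g x\<bar> powr p)"
  shows "integrable M (\<lambda>x. \<bar>f x - g x\<bar> powr p)"
  using integrable_powr_add[of f M "\<lambda>x. - g x" p] assms by simp

lemma brezis_lieb:
  fixes f :: "nat \<Rightarrow> 'a \<Rightarrow> real" and g :: "'a \<Rightarrow> real"
  assumes p: "0 < p" and f[measurable]: "\<And>n. f n \<in> borel_measurable M"
    and g[measurable]: "g \<in> borel_measurable M"
    and lim: "AE x in M. (\<lambda>n. f n x) \<longlonglongrightarrow> g x"
    and int: "\<And>n. integrable M (\<lambda>x. \<bar>f n x\<bar> powr p)"
    and bound: "\<And>n. (\<integral>x. \<bar>f n x\<bar> powr p \<partial>M) \<le> B"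
  shows brezis_lieb_integrable: "integrable M (\<lambda>x. \<bar>g x\<bar> powr p)"
    and brezis_lieb_le: "(\<integral>x. \<bar>g x\<bar> powr p \<partial>M) \<le> B"
    and brezis_lieb_tendsto: "(\<lambda>n. (\<integral>x. \<bar>f n x\<bar> powr p \<partial>M) - (\<integral>x. \<bar>f n x - g x\<bar> powr p \<partial>M))
      \<longlonglongrightarrow> (\<integral>x. \<bar>g x\<bar> powr p \<partial>M)"
proof -
  have B: "0 \<le> B" using bound[of 0] by (rule order_trans[rotated]) simp
  have "(\<integral>\<^sup>+x. ennreal (\<bar>g x\<bar> powr p) \<partial>M) = (\<integral>\<^sup>+x. liminf (\<lambda>n. ennreal (\<bar>f n x\<bar> powr p)) \<partial>M)"
  proof (rule nn_integral_cong_AE, use lim in eventually_elim)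
    case (elim x)
    have "(\<lambda>n. \<bar>f n x\<bar> powr p) \<longlonglongrightarrow> \<bar>g x\<bar> powr p"
      using elim p by (intro tendsto_powr' tendsto_intros) auto
    then have "(\<lambda>n. ennreal (\<bar>f n x\<bar> powr p)) \<longlonglongrightarrow> ennreal (\<bar>g x\<bar> powr p)"
      by (rule tendsto_ennrealI)
    then show ?case by (intro lim_imp_Liminf[symmetric]) simp
  qed
  also have "\<dots> \<le> liminf (\<lambda>n. \<integral>\<^sup>+x. ennreal (\<bar>f n x\<bar> powr p) \<partial>M)"
    by (rule nn_integral_liminf) simp
  also have "\<dots> \<le> liminf (\<lambda>n. ennreal B)"
    using bound by (intro Liminf_mono always_eventually allI)
      (simp add: nn_integral_eq_integral[OF int] ennreal_leI)
  finally have le: "(\<integral>\<^sup>+x. ennreal (\<bar>g x\<bar> powr p) \<partial>M) \<le> ennreal B" by (simp add: Liminf_const)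
  then show gi: "integrable M (\<lambda>x. \<bar>g x\<bar> powr p)"
    by (subst integrable_iff_nn_integral_finite) (auto simp: le_less_trans)
  with le show "(\<integral>x. \<bar>g x\<bar> powr p \<partial>M) \<le> B"
    using B by (simp add: nn_integral_eq_integral)
  have di: "integrable M (\<lambda>x. \<bar>f n x - g x\<bar> powr p)" for n
    using p by (intro integrable_powr_diff int gi) auto
  let ?h = "\<lambda>n x. \<bar>f n x\<bar> powr p - \<bar>f n x - g x\<bar> powr p - \<bar>g x\<bar> powr p"
  have hi: "integrable M (?h n)" for n using int di gi by auto
  define D where "D = 2 powr p * (B + B)"
  have dB: "(\<integral>x. \<bar>f n x - g x\<bar> powr p \<partial>M) \<le> D" for n
  proof -
    have "(\<integral>x. \<bar>f n x - g x\<bar> powr p \<partial>M) \<le> (\<integral>x. 2 powr p * (\<bar>f n x\<bar> powr p + \<bar>g x\<bar> powr p) \<partial>M)"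
      using p abs_diff_powr_le by (intro integral_mono di) (auto intro!: int gi)
    also have "\<dots> = 2 powr p * ((\<integral>x. \<bar>f n x\<bar> powr p \<partial>M) + (\<integral>x. \<bar>g x\<bar> powr p \<partial>M))"
      using int gi by simp
    also have "\<dots> \<le> D"
      unfolding D_def using bound \<open>(\<integral>x. \<bar>g x\<bar> powr p \<partial>M) \<le> B\<close> by (intro mult_left_mono add_mono) auto
    finally show ?thesis .
  qed
  have D: "0 \<le> D" using B by (simp add: D_def)
  have "(\<lambda>n. \<integral>x. ?h n x \<partial>M) \<longlonglongrightarrow> 0"
  proof (rule LIMSEQ_I)
    fix e :: real assume e: "0 < e"
    define \<epsilon> where "\<epsilon> = e / (2 * (D + 1))"
    have \<epsilon>: "0 < \<epsilon>" "\<epsilon> * D < e / 2"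
      using e D by (auto simp: \<epsilon>_def divide_simps)
    obtain C where C: "0 \<le> C"
      "\<And>a b. \<bar>\<bar>a + b\<bar> powr p - \<bar>a\<bar> powr p - \<bar>b\<bar> powr p\<bar> \<le> \<epsilon> * \<bar>a\<bar> powr p + C * \<bar>b\<bar> powr p"
      using brezis_lieb_pointwise[OF p \<epsilon>(1)] by blast
    let ?w = "\<lambda>n x. max 0 (\<bar>?h n x\<bar> - \<epsilon> * \<bar>f n x - g x\<bar> powr p)"
    have wle: "?w n x \<le> C * \<bar>g x\<bar> powr p" for n x
      using C(2)[of "f n x - g x" "g x"] C(1) by simp
    have "(\<lambda>n. \<integral>x. ?w n x \<partial>M) \<longlonglongrightarrow> (\<integral>x. 0 \<partial>M)"
    proof (rule integral_dominated_convergence)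
      show "integrable M (\<lambda>x. C * \<bar>g x\<bar> powr p)" using gi by simp
      show "AE x in M. (\<lambda>n. ?w n x) \<longlonglongrightarrow> 0"
        using lim
      proof eventually_elim
        case (elim x)
        have d: "(\<lambda>n. \<bar>f n x - g x\<bar> powr p) \<longlonglongrightarrow> 0"
          using p elim by (intro tendsto_eq_intros tendsto_powr'[where a=0 and b=p, THEN tendsto_eq_rhs])
            (auto intro!: tendsto_eq_intros)
        have e: "(\<lambda>n. \<bar>f n x\<bar> powr p) \<longlonglongrightarrow> \<bar>g x\<bar> powr p"
          using elim p by (intro tendsto_powr' tendsto_intros) auto
        have "(\<lambda>n. ?w n x) \<longlonglongrightarrow> max 0 (\<bar>\<bar>g x\<bar> powr p - 0 - \<bar>g x\<bar> powr p\<bar> - \<epsilon> * 0)"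
          by (intro tendsto_max tendsto_diff tendsto_rabs tendsto_mult tendsto_const d e)
        then show ?case by simp
      qed
      show "AE x in M. norm (?w n x) \<le> C * \<bar>g x\<bar> powr p" for n
        using wle by (intro always_eventually allI) auto
    qed auto
    then have "(\<lambda>n. \<integral>x. ?w n x \<partial>M) \<longlonglongrightarrow> 0" by simp
    from LIMSEQ_D[OF this half_gt_zero[OF e]]
    obtain N where N: "\<And>n. N \<le> n \<Longrightarrow> norm ((\<integral>x. ?w n x \<partial>M) - 0) < e / 2" by blast
    have "norm ((\<integral>x. ?h n x \<partial>M) - 0) < e" if "N \<le> n" for n
    proof -
      have wi: "integrable M (?w n)" using hi di by auto
      have "norm (\<integral>x. ?h n x \<partial>M) \<le> (\<integral>x. norm (?h n x) \<partial>M)" by (rule integral_norm_bound)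
      also have "\<dots> \<le> (\<integral>x. ?w n x + \<epsilon> * \<bar>f n x - g x\<bar> powr p \<partial>M)"
        using hi di wi by (intro integral_mono) (auto simp: max_def)
      also have "\<dots> = (\<integral>x. ?w n x \<partial>M) + \<epsilon> * (\<integral>x. \<bar>f n x - g x\<bar> powr p \<partial>M)"
        using wi di by simp
      also have "\<dots> \<le> (\<integral>x. ?w n x \<partial>M) + \<epsilon> * D"
        using dB \<epsilon> by (intro add_left_mono mult_left_mono) auto
      also have "\<dots> < e" using N[OF that] \<epsilon>(2) by simp
      finally show ?thesis by simp
    qed
    then show "\<exists>N. \<forall>n\<ge>N. norm ((\<integral>x. ?h n x \<partial>M) - 0) < e" by blast
  qed
  then have "(\<lambda>n. (\<integral>x. ?h n x \<partial>M) + (\<integral>x. \<bar>g x\<bar> powr p \<partial>M)) \<longlonglongrightarrow> 0 + (\<integral>x. \<bar>g x\<bar> powr p \<partial>M)"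
    by (intro tendsto_intros)
  moreover have "(\<integral>x. ?h n x \<partial>M) = (\<integral>x. \<bar>f n x\<bar> powr p \<partial>M) - (\<integral>x. \<bar>f n x - g x\<bar> powr p \<partial>M)
      - (\<integral>x. \<bar>g x\<bar> powr p \<partial>M)" for n
    using int di gi by simp
  ultimately show "(\<lambda>n. (\<integral>x. \<bar>f n x\<bar> powr p \<partial>M) - (\<integral>x. \<bar>f n x - g x\<bar> powr p \<partial>M))
      \<longlonglongrightarrow> (\<integral>x. \<bar>g x\<bar> powr p \<partial>M)" by simp
qed

lemma abs_powr_mult_le:
  fixes a b p :: real
  assumes "1 < p"
  shows "\<bar>\<bar>a\<bar> powr (p - 2) * a * b\<bar> \<le> (\<bar>a\<bar> + \<bar>b\<bar>) powr p"
proof -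
  have "\<bar>a\<bar> powr (p - 2) * \<bar>a\<bar> = \<bar>a\<bar> powr (p - 1)"
    using powr_add[of "\<bar>a\<bar>" "p - 2" 1] by (cases "a = 0") auto
  then have "\<bar>\<bar>a\<bar> powr (p - 2) * a * b\<bar> = \<bar>a\<bar> powr (p - 1) * \<bar>b\<bar>"
    by (simp add: abs_mult)
  also have "\<dots> \<le> (\<bar>a\<bar> + \<bar>b\<bar>) powr (p - 1) * (\<bar>a\<bar> + \<bar>b\<bar>)"
    using assms by (intro mult_mono powr_mono2) auto
  also have "\<dots> = (\<bar>a\<bar> + \<bar>b\<bar>) powr p"
    using powr_add[of "\<bar>a\<bar> + \<bar>b\<bar>" "p - 1" 1] by (cases "\<bar>a\<bar> + \<bar>b\<bar> = 0") auto
  finally show ?thesis .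
qed

lemma integrable_powr_pairing:
  fixes f g :: "'a \<Rightarrow> real"
  assumes p: "1 < p" and [measurable]: "f \<in> borel_measurable M" "g \<in> borel_measurable M"
    and f: "integrable M (\<lambda>x. \<bar>f x\<bar> powr p)" and g: "integrable M (\<lambda>x. \<bar>g x\<bar> powr p)"
  shows "integrable M (\<lambda>x. \<bar>f x\<bar> powr (p - 2) * f x * g x)"
proof (rule Bochner_Integration.integrable_bound)
  show "integrable M (\<lambda>x. \<bar>\<bar>f x\<bar> + \<bar>g x\<bar>\<bar> powr p)"
    by (intro integrable_powr_add) (use f g p in auto)
qed (use abs_powr_mult_le[OF p] in auto)

lemma has_real_derivative_integral_abs_powr:
  fixes f g :: "'a \<Rightarrow> real"
  assumes p: "1 < p" and [measurable]: "f \<in> borel_measurable M" "g \<in> borel_measurable M"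
    and f: "integrable M (\<lambda>x. \<bar>f x\<bar> powr p)" and g: "integrable M (\<lambda>x. \<bar>g x\<bar> powr p)"
  shows "((\<lambda>t. \<integral>x. \<bar>f x + t * g x\<bar> powr p \<partial>M) has_real_derivative
    p * (\<integral>x. \<bar>f x\<bar> powr (p - 2) * f x * g x \<partial>M)) (at 0)"
  unfolding has_field_derivative_iff tendsto_at_iff_sequentially o_def
proof (intro allI impI)
  fix T :: "nat \<Rightarrow> real"
  assume T0: "\<forall>i. T i \<in> UNIV - {0}" and T: "T \<longlonglongrightarrow> 0"
  then have Tn: "T i \<noteq> 0" for i by auto
  have int: "integrable M (\<lambda>x. \<bar>f x + t * g x\<bar> powr p)" for t
    by (intro integrable_powr_add integrable_powr_cmult f g) (use p in auto)
  have bi: "integrable M (\<lambda>x. p * (\<bar>f x\<bar> + \<bar>g x\<bar>) powr p)"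
    using integrable_powr_add[of "\<lambda>x. \<bar>f x\<bar>" M "\<lambda>x. \<bar>g x\<bar>" p] f g p by simp
  let ?q = "\<lambda>t x. (\<bar>f x + t * g x\<bar> powr p - \<bar>f x\<bar> powr p) / t"
  have ptw: "((\<lambda>t. ?q t x) \<longlongrightarrow> p * (\<bar>f x\<bar> powr (p - 2) * f x * g x)) (at 0)" for x
  proof -
    have "((\<lambda>t. \<bar>f x + t * g x\<bar> powr p) has_real_derivative
        p * (\<bar>f x + 0 * g x\<bar> powr (p - 2) * (f x + 0 * g x)) * g x) (at 0)"
      by (rule DERIV_chain'[where f = "\<lambda>t. f x + t * g x" and g = "\<lambda>y. \<bar>y\<bar> powr p", rotated])
        (auto intro!: has_real_derivative_abs_powr p derivative_eq_intros)
    then show ?thesis by (simp add: has_field_derivative_iff algebra_simps)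
  qed
  define T' where "T' i = (if \<bar>T i\<bar> \<le> 1 then T i else 1)" for i
  have T'n: "T' i \<noteq> 0" and T'1: "\<bar>T' i\<bar> \<le> 1" for i using Tn by (auto simp: T'_def)
  have "\<forall>\<^sub>F i in sequentially. \<bar>T i\<bar> < 1"
    using order_tendstoD(2)[OF tendsto_rabs_zero[OF T], of 1] by simp
  then have ev: "\<forall>\<^sub>F i in sequentially. T' i = T i"
    by eventually_elim (simp add: T'_def)
  have T': "T' \<longlonglongrightarrow> 0" using T tendsto_cong[OF ev] by simp
  have "(\<lambda>i. \<integral>x. ?q (T' i) x \<partial>M) \<longlonglongrightarrow> (\<integral>x. p * (\<bar>f x\<bar> powr (p - 2) * f x * g x) \<partial>M)"
  proof (rule integral_dominated_convergence[OF _ _ bi])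
    show "AE x in M. (\<lambda>i. ?q (T' i) x) \<longlonglongrightarrow> p * (\<bar>f x\<bar> powr (p - 2) * f x * g x)"
      using ptw T' T'n by (auto simp: tendsto_at_iff_sequentially o_def intro!: always_eventually)
    show "AE x in M. norm (?q (T' i) x) \<le> p * (\<bar>f x\<bar> + \<bar>g x\<bar>) powr p" for i
    proof (intro always_eventually allI)
      fix x
      have "\<bar>\<bar>f x + T' i * g x\<bar> powr p - \<bar>f x\<bar> powr p\<bar> \<le> \<bar>T' i\<bar> * (p * (\<bar>f x\<bar> + \<bar>g x\<bar>) powr p)"
        by (rule abs_powr_diff_le[OF p T'1])
      then show "norm (?q (T' i) x) \<le> p * (\<bar>f x\<bar> + \<bar>g x\<bar>) powr p"
        using T'n[of i] by (simp add: abs_divide field_simps)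
    qed
  qed auto
  moreover have "(\<integral>x. ?q t x \<partial>M)
      = ((\<integral>x. \<bar>f x + t * g x\<bar> powr p \<partial>M) - (\<integral>x. \<bar>f x\<bar> powr p \<partial>M)) / t" for t
    using int[of t] f by simp
  ultimately have "(\<lambda>i. ((\<integral>x. \<bar>f x + T' i * g x\<bar> powr p \<partial>M) - (\<integral>x. \<bar>f x\<bar> powr p \<partial>M)) / T' i)
      \<longlonglongrightarrow> p * (\<integral>x. \<bar>f x\<bar> powr (p - 2) * f x * g x \<partial>M)"
    by (simp only: integral_mult_right_zero)
  then show "(\<lambda>i. ((\<integral>x. \<bar>f x + T i * g x\<bar> powr p \<partial>M) - (\<integral>x. \<bar>f x + 0 * g x\<bar> powr p \<partial>M)) / (T i - 0))
      \<longlonglongrightarrow> p * (\<integral>x. \<bar>f x\<bar> powr (p - 2) * f x * g x \<partial>M)"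
    by (rule Lim_transform_eventually) (use ev in eventually_elim, simp)
qed

section \<open>Functions of class \<open>C\<^sup>m\<close> and test functions\<close>

lemma Ck_SucI:
  assumes "\<And>x. (f has_derivative f' x) (at x)" "\<And>v. Ck m (\<lambda>x. f' x v)"
  shows "Ck (Suc m) f"
proof -
  have "frechet_derivative f (at x) = f' x" for x
    using assms(1) by (metis frechet_derivative_at)
  then show ?thesis
    using assms by (auto simp: differentiable_on_def differentiable_def)
qed

lemma Ck_SucD:
  assumes "Ck (Suc m) f"
  shows "\<exists>f'. (\<forall>x. (f has_derivative f' x) (at x)) \<and> (\<forall>v. Ck m (\<lambda>x. f' x v))"
proof (intro exI[of _ "\<lambda>x. frechet_derivative f (at x)"] conjI allI)
  show "(f has_derivative frechet_derivative f (at x)) (at x)" for x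
    using assms by (auto simp: differentiable_on_def intro: iffD1[OF frechet_derivative_works])
qed (use assms in auto)

lemma Ck_Suc_imp: "Ck (Suc m) f \<Longrightarrow> Ck m f"
proof (induction m arbitrary: f)
  case 0
  then show ?case by (simp add: differentiable_imp_continuous_on)
next
  case (Suc m)
  obtain f' where f': "\<And>x. (f has_derivative f' x) (at x)" "\<And>v. Ck (Suc m) (\<lambda>x. f' x v)"
    using Ck_SucD[OF Suc.prems] by blast
  show ?case by (rule Ck_SucI[OF f'(1) Suc.IH[OF f'(2)]])
qed

lemma Ck_const: "Ck m (\<lambda>x. c)"
proof (induction m arbitrary: c)
  case (Suc m)
  show ?case by (rule Ck_SucI[where f' = "\<lambda>x v. 0"]) (auto intro: Suc)
qed simp

lemma Ck_bounded_linear: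
  assumes "bounded_linear f"
  shows "Ck m f"
proof (cases m)
  case 0
  then show ?thesis using assms by (simp add: linear_continuous_on)
next
  case (Suc n)
  show ?thesis unfolding Suc
    by (rule Ck_SucI[where f' = "\<lambda>x. f"]) (auto intro: Ck_const bounded_linear_imp_has_derivative assms)
qed

lemma Ck_bounded_linear_compose:
  assumes L: "bounded_linear L" and "Ck m f"
  shows "Ck m (\<lambda>x. L (f x))"
  using assms(2)
proof (induction m arbitrary: f)
  case 0
  then show ?case using bounded_linear.continuous_on[OF L] by auto
next
  case (Suc m)
  obtain f' where f': "\<And>x. (f has_derivative f' x) (at x)" "\<And>v. Ck m (\<lambda>x. f' x v)"
    using Ck_SucD[OF Suc.prems] by blast
  show ?case
    by (rule Ck_SucI[where f' = "\<lambda>x v. L (f' x v)"])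
      (auto intro: Suc.IH f' bounded_linear.has_derivative[OF L])
qed

lemma Ck_add: "Ck m f \<Longrightarrow> Ck m g \<Longrightarrow> Ck m (\<lambda>x. f x + g x)"
proof (induction m arbitrary: f g)
  case 0
  then show ?case by (simp add: continuous_on_add)
next
  case (Suc m)
  obtain f' where f': "\<And>x. (f has_derivative f' x) (at x)" "\<And>v. Ck m (\<lambda>x. f' x v)"
    using Ck_SucD[OF Suc.prems(1)] by blast
  obtain g' where g': "\<And>x. (g has_derivative g' x) (at x)" "\<And>v. Ck m (\<lambda>x. g' x v)"
    using Ck_SucD[OF Suc.prems(2)] by blast
  show ?case
    by (rule Ck_SucI[where f' = "\<lambda>x v. f' x v + g' x v"]) (auto intro: Suc.IH f' g' has_derivative_add)
qed

lemma Ck_sum: "(\<And>i. i \<in> I \<Longrightarrow> Ck m (f i)) \<Longrightarrow> Ck m (\<lambda>x. \<Sum>i\<in>I. f i x)"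
  by (induction I rule: infinite_finite_induct) (auto intro: Ck_const Ck_add)

lemma Ck_scaleR:
  fixes f :: "'a::euclidean_space \<Rightarrow> real"
  shows "Ck m f \<Longrightarrow> Ck m g \<Longrightarrow> Ck m (\<lambda>x. f x *\<^sub>R g x)"
proof (induction m arbitrary: f g)
  case 0
  then show ?case by (simp add: continuous_on_scaleR)
next
  case (Suc m)
  obtain f' where f': "\<And>x. (f has_derivative f' x) (at x)" "\<And>v. Ck m (\<lambda>x. f' x v)"
    using Ck_SucD[OF Suc.prems(1)] by blast
  obtain g' where g': "\<And>x. (g has_derivative g' x) (at x)" "\<And>v. Ck m (\<lambda>x. g' x v)"
    using Ck_SucD[OF Suc.prems(2)] by blast
  show ?case
  proof (rule Ck_SucI)
    show "((\<lambda>x. f x *\<^sub>R g x) has_derivative (\<lambda>v. f x *\<^sub>R g' x v + f' x v *\<^sub>R g x)) (at x)" for x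
      by (rule has_derivative_scaleR[OF f'(1) g'(1)])
    show "Ck m (\<lambda>x. f x *\<^sub>R g' x v + f' x v *\<^sub>R g x)" for v
      by (intro Ck_add Suc.IH f'(2) g'(2) Ck_Suc_imp[OF Suc.prems(1)] Ck_Suc_imp[OF Suc.prems(2)])
  qed
qed

lemma Ck_compose: "Ck m g \<Longrightarrow> Ck m f \<Longrightarrow> Ck m (\<lambda>x. g (f x))"
proof (induction m arbitrary: f g)
  case 0
  then show ?case by (auto intro: continuous_on_compose2)
next
  case (Suc m)
  obtain g' where g': "\<And>x. (g has_derivative g' x) (at x)" "\<And>v. Ck m (\<lambda>x. g' x v)"
    using Ck_SucD[OF Suc.prems(1)] by blast
  obtain f' where f': "\<And>x. (f has_derivative f' x) (at x)" "\<And>v. Ck m (\<lambda>x. f' x v)"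
    using Ck_SucD[OF Suc.prems(2)] by blast
  have expand: "g' (f x) (f' x v) = (\<Sum>i\<in>Basis. (f' x v \<bullet> i) *\<^sub>R g' (f x) i)" for x v
  proof -
    have "linear (g' (f x))" by (rule has_derivative_linear[OF g'(1)])
    then have "g' (f x) (\<Sum>i\<in>Basis. (f' x v \<bullet> i) *\<^sub>R i) = (\<Sum>i\<in>Basis. (f' x v \<bullet> i) *\<^sub>R g' (f x) i)"
      by (simp add: linear_sum linear_cmul)
    then show ?thesis by (simp only: euclidean_representation)
  qed
  show ?case
  proof (rule Ck_SucI[where f' = "\<lambda>x v. g' (f x) (f' x v)"])
    show "((\<lambda>x. g (f x)) has_derivative (\<lambda>v. g' (f x) (f' x v))) (at x)" for x
      using diff_chain_at[OF f'(1) g'(1)] by (simp add: o_def)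
    show "Ck m (\<lambda>x. g' (f x) (f' x v))" for v
      unfolding expand
      by (intro Ck_sum Ck_scaleR Ck_bounded_linear_compose[OF bounded_linear_inner_left] f'(2)
          Suc.IH g'(2) Ck_Suc_imp[OF Suc.prems(2)])
  qed
qed

lemma Ck_Pair:
  assumes "Ck m f" "Ck m g"
  shows "Ck m (\<lambda>x. (f x, g x))"
proof -
  have "Ck m (\<lambda>x. (f x, 0) + (0, g x))"
    by (intro Ck_add Ck_bounded_linear_compose[OF _ assms(1)] Ck_bounded_linear_compose[OF _ assms(2)]
        bounded_linear_Pair bounded_linear_ident bounded_linear_zero)
  then show ?thesis by simp
qed

lemma smooth_compose: "smooth g \<Longrightarrow> smooth f \<Longrightarrow> smooth (\<lambda>x. g (f x))"
  by (auto simp: smooth_def intro: Ck_compose)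

lemma smooth_bounded_linear: "bounded_linear f \<Longrightarrow> smooth f"
  by (auto simp: smooth_def intro: Ck_bounded_linear)

lemma smooth_const: "smooth (\<lambda>x. c)"
  by (auto simp: smooth_def intro: Ck_const)

lemma smooth_Pair: "smooth f \<Longrightarrow> smooth g \<Longrightarrow> smooth (\<lambda>x. (f x, g x))"
  by (auto simp: smooth_def intro: Ck_Pair)

lemma smooth_imp_continuous: "smooth f \<Longrightarrow> continuous_on UNIV f"
  using Ck.simps(1)[of f] unfolding smooth_def by blast

lemma smooth_has_derivative:
  assumes "smooth f"
  shows "(f has_derivative frechet_derivative f (at x)) (at x)"
proof -
  have "Ck (Suc 0) f" using assms by (simp add: smooth_def)
  then show ?thesis by (auto simp: differentiable_on_def intro: iffD1[OF frechet_derivative_works])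
qed

lemma smooth_continuous_derivative:
  assumes "smooth f"
  shows "continuous_on UNIV (\<lambda>x. frechet_derivative f (at x) v)"
proof -
  have "Ck (Suc 0) f" using assms by (simp add: smooth_def)
  then show ?thesis by auto
qed

definition exp_bump :: "nat \<Rightarrow> real \<Rightarrow> real" where
  "exp_bump n t = (if 0 < t then (1 / t) ^ n * exp (- (1 / t)) else 0)"

lemma exp_bump_at_right: "(exp_bump n \<longlongrightarrow> 0) (at_right 0)"
proof -
  have "((\<lambda>x. x ^ n / exp x) \<longlongrightarrow> 0) (at_top :: real filter)"
    by (rule tendsto_power_div_exp_0)
  then have "((\<lambda>t. (inverse t) ^ n / exp (inverse t)) \<longlongrightarrow> 0) (at_right (0::real))"
    by (rule filterlim_compose) (rule filterlim_inverse_at_top_right)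
  then show ?thesis
    by (rule Lim_transform_eventually)
      (auto simp: exp_bump_def exp_minus field_simps eventually_at_filter)
qed

lemma exp_bump_at_left: "(exp_bump n \<longlongrightarrow> 0) (at_left 0)"
  by (rule Lim_transform_eventually[OF tendsto_const])
    (auto simp: exp_bump_def eventually_at_filter)

lemma exp_bump_has_derivative:
  "(exp_bump n has_real_derivative (exp_bump (n + 2) t - real n * exp_bump (n + 1) t)) (at t)"
proof -
  consider "0 < t" | "t < 0" | "t = 0" by linarith
  then show ?thesis
  proof cases
    case 1
    have "((\<lambda>t. (1 / t) ^ n * exp (- (1 / t))) has_real_derivative
        (exp_bump (n + 2) t - real n * exp_bump (n + 1) t)) (at t)"
    proof (cases n)
      case 0
      then show ?thesis using 1
        by (auto intro!: derivative_eq_intros simp: exp_bump_def field_simps power2_eq_square)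
    next
      case (Suc k)
      then show ?thesis using 1
        by (auto intro!: derivative_eq_intros simp: exp_bump_def field_simps power2_eq_square) (cases k; simp)
    qed
    then show ?thesis
      by (rule has_field_derivative_transform_within_open[of _ _ _ "{0<..}"])
        (use 1 in \<open>auto simp: exp_bump_def\<close>)
  next
    case 2
    have "((\<lambda>t. 0) has_real_derivative (exp_bump (n + 2) t - real n * exp_bump (n + 1) t)) (at t)"
      using 2 by (simp add: exp_bump_def)
    then show ?thesis
      by (rule has_field_derivative_transform_within_open[of _ _ _ "{..<0}"])
        (use 2 in \<open>auto simp: exp_bump_def\<close>)
  next
    case 3
    have eq: "(exp_bump n h - exp_bump n 0) / h = exp_bump (n + 1) h" for h
      by (simp add: exp_bump_def)
    have "(exp_bump (n + 1) \<longlongrightarrow> 0) (at 0)"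
      using exp_bump_at_left exp_bump_at_right by (simp add: filterlim_split_at)
    moreover have "exp_bump (n + 2) 0 - real n * exp_bump (n + 1) 0 = 0"
      by (simp add: exp_bump_def)
    ultimately show ?thesis using 3 by (simp add: has_field_derivative_iff eq)
  qed
qed

lemma Ck_exp_bump: "Ck m (exp_bump n)"
proof (induction m arbitrary: n)
  case 0
  show ?case
    using exp_bump_has_derivative by (auto intro!: DERIV_continuous_on)
next
  case (Suc m)
  show ?case
  proof (rule Ck_SucI)
    show "(exp_bump n has_derivative (*) (exp_bump (n + 2) x - real n * exp_bump (n + 1) x)) (at x)" for x
      using exp_bump_has_derivative by (simp add: has_field_derivative_def)
    have "Ck m (\<lambda>x. v * exp_bump (n + 2) x + - (real n * v) * exp_bump (n + 1) x)" for v
      by (intro Ck_add Ck_bounded_linear_compose[OF bounded_linear_mult_right] Suc)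
    then show "Ck m (\<lambda>x. (exp_bump (n + 2) x - real n * exp_bump (n + 1) x) * v)" for v
      by (simp add: algebra_simps)
  qed
qed

lemma smooth_bump: "smooth (\<lambda>x::'a::euclidean_space. exp_bump 0 (1 - x \<bullet> x))"
proof -
  have "Ck m (\<lambda>x::'a. 1 + (- 1) *\<^sub>R (\<Sum>i\<in>Basis. (x \<bullet> i) *\<^sub>R (x \<bullet> i)))" for m
    by (intro Ck_add Ck_const Ck_bounded_linear_compose[OF bounded_linear_scaleR_right] Ck_sum Ck_scaleR
        Ck_bounded_linear bounded_linear_inner_left)
  moreover have "1 + (- 1) *\<^sub>R (\<Sum>i\<in>Basis. (x \<bullet> i) *\<^sub>R (x \<bullet> i)) = 1 - x \<bullet> x" for x :: 'a
    unfolding euclidean_inner[of x x] by simp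
  ultimately have "Ck m (\<lambda>x::'a. 1 - x \<bullet> x)" for m by simp
  then show ?thesis
    unfolding smooth_def by (intro allI Ck_compose[OF Ck_exp_bump])
qed

lemma bump_in_test_functions: "(\<lambda>x::'a::euclidean_space. exp_bump 0 (1 - x \<bullet> x)) \<in> test_functions"
proof -
  have "{x::'a. exp_bump 0 (1 - x \<bullet> x) \<noteq> 0} \<subseteq> cball 0 1"
    by (auto simp: exp_bump_def norm_eq_sqrt_inner split: if_splits)
  then have "bounded {x::'a. exp_bump 0 (1 - x \<bullet> x) \<noteq> 0}" by (rule bounded_subset[OF bounded_cball])
  then show ?thesis by (simp add: test_functions_def smooth_bump compact_eq_bounded_closed bounded_closure)
qed

lemma test_functions_add:
  assumes "f \<in> test_functions" "g \<in> test_functions"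
  shows "(\<lambda>x. f x + g x) \<in> test_functions"
proof -
  have "smooth (\<lambda>x. f x + g x)" using assms by (auto simp: test_functions_def smooth_def intro: Ck_add)
  moreover have "closure {x. f x + g x \<noteq> 0} \<subseteq> closure {x. f x \<noteq> 0} \<union> closure {x. g x \<noteq> 0}"
    unfolding closure_Un[symmetric] by (intro closure_mono) auto
  moreover have "bounded (closure {x. f x \<noteq> 0} \<union> closure {x. g x \<noteq> 0})"
    using assms by (simp add: test_functions_def compact_eq_bounded_closed)
  ultimately show ?thesis
    unfolding test_functions_def compact_eq_bounded_closed mem_Collect_eq
    by (blast intro: bounded_subset closed_closure)
qed

lemma test_functions_cmult:
  assumes "f \<in> test_functions"
  shows "(\<lambda>x. c * f x) \<in> test_functions"
proof -
  have "smooth (\<lambda>x. c * f x)"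
    using assms by (auto simp: test_functions_def smooth_def intro: Ck_bounded_linear_compose[OF bounded_linear_mult_right])
  moreover have "closure {x. c * f x \<noteq> 0} \<subseteq> closure {x. f x \<noteq> 0}"
    by (intro closure_mono) auto
  moreover have "bounded (closure {x. f x \<noteq> 0})"
    using assms by (simp add: test_functions_def compact_eq_bounded_closed)
  ultimately show ?thesis
    by (simp add: test_functions_def compact_eq_bounded_closed bounded_subset)
qed

lemma test_functions_compose:
  fixes f :: "'a::euclidean_space \<Rightarrow> real" and h :: "'b::euclidean_space \<Rightarrow> 'a"
  assumes f: "f \<in> test_functions" and h: "smooth h"
    and h': "continuous_on UNIV h'" "\<And>x. h' (h x) = x"
  shows "(\<lambda>x. f (h x)) \<in> test_functions"
proof -
  have "smooth (\<lambda>x. f (h x))" using f h by (auto simp: test_functions_def intro: smooth_compose)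
  moreover have c: "compact (h' ` closure {x. f x \<noteq> 0})"
    using f by (intro compact_continuous_image continuous_on_subset[OF h'(1)]) (auto simp: test_functions_def)
  have "{x. f (h x) \<noteq> 0} \<subseteq> h' ` closure {x. f x \<noteq> 0}"
  proof
    fix x assume "x \<in> {x. f (h x) \<noteq> 0}"
    then have "h x \<in> closure {x. f x \<noteq> 0}" using closure_subset[of "{x. f x \<noteq> 0}"] by blast
    then show "x \<in> h' ` closure {x. f x \<noteq> 0}" using h'(2) by (metis imageI)
  qed
  then have "closure {x. f (h x) \<noteq> 0} \<subseteq> h' ` closure {x. f x \<noteq> 0}"
    by (rule closure_minimal) (rule compact_imp_closed[OF c])
  then have "compact (closure {x. f (h x) \<noteq> 0})"
    using bounded_subset[OF compact_imp_bounded[OF c]] by (simp add: compact_eq_bounded_closed)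
  ultimately show ?thesis by (simp add: test_functions_def)
qed

section \<open>Ahlfors regular kernels: integrability and non-vanishing\<close>

locale ahlfors_kernel =
  fixes \<delta> :: "'a::euclidean_space \<Rightarrow> 'a \<Rightarrow> real" and Q s p K c0 :: real
  assumes \<delta>_continuous: "continuous_on UNIV (\<lambda>z. \<delta> (fst z) (snd z))"
    and \<delta>_nonneg: "0 \<le> \<delta> x y"
    and \<delta>_eq_0: "\<delta> x y = 0 \<longleftrightarrow> x = y"
    and \<delta>_sym: "\<delta> x y = \<delta> y x"
    and \<delta>_triangle: "\<delta> x z \<le> K * (\<delta> x y + \<delta> y z)"
    and K_ge_1: "1 \<le> K"
    and c0_pos: "0 < c0"
    and emeasure_ball: "0 < r \<Longrightarrow> emeasure lborel {y. \<delta> x y < r} = ennreal (c0 * r powr Q)"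
    and s_pos: "0 < s" and p_gt_1: "1 < p" and Q_gt: "p * s < Q"
begin

lemma ps_pos: "0 < p * s" and Q_pos: "0 < Q" and p_pos: "0 < p"
proof -
  show "0 < p * s" using s_pos p_gt_1 by simp
  then show "0 < Q" using Q_gt by linarith
  show "0 < p" using p_gt_1 by simp
qed

lemma \<delta>_measurable[measurable (raw)]:
  assumes "f \<in> borel_measurable M" "g \<in> borel_measurable M"
  shows "(\<lambda>x. \<delta> (f x) (g x)) \<in> borel_measurable M"
  using borel_measurable_continuous_on[OF \<delta>_continuous borel_measurable_Pair[OF assms]] by simp

lemma open_kernel_ball: "open {y. \<delta> x y < r}"
proof -
  have "continuous_on UNIV (\<lambda>y. \<delta> (fst (x, y)) (snd (x, y)))"
    by (intro continuous_on_compose2[OF \<delta>_continuous] continuous_intros) auto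
  then show ?thesis by (intro open_Collect_less) (auto intro: continuous_intros)
qed

definition gag_at :: "('a \<Rightarrow> real) \<Rightarrow> 'a \<Rightarrow> ennreal" where
  "gag_at u x = (\<integral>\<^sup>+y. ennreal (\<bar>u x - u y\<bar> powr p / \<delta> x y powr (Q + p * s)) \<partial>lborel)"

definition gag :: "('a \<Rightarrow> real) \<Rightarrow> ennreal" where
  "gag u = (\<integral>\<^sup>+(x, y). ennreal (\<bar>u x - u y\<bar> powr p / \<delta> x y powr (Q + p * s)) \<partial>(lborel \<Otimes>\<^sub>M lborel))"

definition snorm :: "('a \<Rightarrow> real) \<Rightarrow> ennreal" where
  "snorm u = (\<integral>\<^sup>+x. ennreal (\<bar>u x\<bar> powr p) \<partial>lborel) + gag u"

lemma gag_at_measurable[measurable]: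
  assumes [measurable]: "u \<in> borel_measurable borel"
  shows "gag_at u \<in> borel_measurable borel"
  unfolding gag_at_def by measurable

lemma nn_integral_gag_at:
  assumes [measurable]: "u \<in> borel_measurable borel"
  shows "(\<integral>\<^sup>+x. gag_at u x \<partial>lborel) = gag u"
proof -
  let ?f = "\<lambda>(x, y). ennreal (\<bar>u x - u y\<bar> powr p / \<delta> x y powr (Q + p * s))"
  have "?f \<in> borel_measurable (lborel \<Otimes>\<^sub>M lborel)" by measurable
  from lborel.nn_integral_fst[OF this] show ?thesis
    by (simp add: gag_at_def gag_def)
qed

lemma AE_gag_at_finite:
  assumes "u \<in> borel_measurable borel" "gag u < \<infinity>"
  shows "AE x in lborel. gag_at u x < \<infinity>"
proof -
  have "AE x in lborel. gag_at u x \<noteq> \<infinity>"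
    by (rule nn_integral_noteq_infinite) (use assms in \<open>auto simp: nn_integral_gag_at\<close>)
  then show ?thesis by eventually_elim (simp add: top.not_eq_extremum)
qed

lemma ball_estimate_nn:
  assumes [measurable]: "u \<in> borel_measurable borel" and r: "0 < r" and x: "\<delta> z x < r"
  shows "(\<integral>\<^sup>+y\<in>{y. \<delta> z y < r}. ennreal (\<bar>u x - u y\<bar> powr p) \<partial>lborel)
    \<le> ennreal ((2 * K * r) powr (Q + p * s)) * gag_at u x"
proof -
  let ?B = "{y. \<delta> z y < r}" and ?k = "(2 * K * r) powr (Q + p * s)"
  have "ennreal (\<bar>u x - u y\<bar> powr p) * indicator ?B y
      \<le> ennreal ?k * ennreal (\<bar>u x - u y\<bar> powr p / \<delta> x y powr (Q + p * s))" for y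
  proof (cases "y \<in> ?B \<and> x \<noteq> y")
    case True
    have "\<delta> x y \<le> K * (\<delta> x z + \<delta> z y)" by (rule \<delta>_triangle)
    also have "\<dots> \<le> K * (r + r)"
      using True x K_ge_1 \<delta>_sym[of x z] by (intro mult_left_mono add_mono) auto
    finally have le: "\<delta> x y \<le> 2 * K * r" by simp
    have pos: "0 < \<delta> x y" using True \<delta>_nonneg[of x y] \<delta>_eq_0[of x y] by linarith
    have "\<delta> x y powr (Q + p * s) \<le> ?k"
      using le pos ps_pos Q_pos by (intro powr_mono2) auto
    then have "\<bar>u x - u y\<bar> powr p * \<delta> x y powr (Q + p * s) \<le> \<bar>u x - u y\<bar> powr p * ?k"
      by (intro mult_left_mono) auto
    then have "\<bar>u x - u y\<bar> powr p \<le> ?k * (\<bar>u x - u y\<bar> powr p / \<delta> x y powr (Q + p * s))"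
      using pos by (simp add: pos_le_divide_eq mult.commute)
    then show ?thesis using True by (simp flip: ennreal_mult)
  qed auto
  then have "(\<integral>\<^sup>+y\<in>?B. ennreal (\<bar>u x - u y\<bar> powr p) \<partial>lborel)
      \<le> (\<integral>\<^sup>+y. ennreal ?k * ennreal (\<bar>u x - u y\<bar> powr p / \<delta> x y powr (Q + p * s)) \<partial>lborel)"
    by (intro nn_integral_mono) auto
  also have "\<dots> = ennreal ?k * gag_at u x"
    unfolding gag_at_def by (subst nn_integral_cmult) auto
  finally show ?thesis .
qed

definition pointwise_const :: real where "pointwise_const = 2 powr p * ((2 * K) powr (Q + p * s) + 1) / c0"

lemma pointwise_const_pos: "0 < pointwise_const"
  using c0_pos K_ge_1 by (simp add: pointwise_const_def add_pos_pos)

lemma pointwise_estimate: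
  assumes u[measurable]: "u \<in> borel_measurable borel" and r: "0 < r" and x: "\<delta> z x < r"
    and fin: "gag_at u x < \<infinity>" and b: "0 \<le> b"
    and le: "(\<integral>\<^sup>+y\<in>{y. \<delta> z y < r}. ennreal (\<bar>u y\<bar> powr p) \<partial>lborel) \<le> ennreal b"
  shows "\<bar>u x\<bar> powr p \<le> pointwise_const * (r powr (p * s) * enn2real (gag_at u x) + r powr (- Q) * b)"
proof -
  let ?B = "{y. \<delta> z y < r}" and ?k = "(2 * K * r) powr (Q + p * s)" and ?g = "enn2real (gag_at u x)"
  have [measurable]: "?B \<in> sets borel" using open_kernel_ball by simp
  have "ennreal (\<bar>u x\<bar> powr p * (c0 * r powr Q)) = (\<integral>\<^sup>+y\<in>?B. ennreal (\<bar>u x\<bar> powr p) \<partial>lborel)"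
    using r c0_pos by (simp add: nn_integral_cmult_indicator emeasure_ball ennreal_mult)
  also have "\<dots> \<le> (\<integral>\<^sup>+y. ennreal (2 powr p) * (ennreal (\<bar>u x - u y\<bar> powr p) * indicator ?B y
      + ennreal (\<bar>u y\<bar> powr p) * indicator ?B y) \<partial>lborel)"
  proof (intro nn_integral_mono)
    fix y
    have "\<bar>u x\<bar> powr p \<le> 2 powr p * (\<bar>u x - u y\<bar> powr p + \<bar>u y\<bar> powr p)"
      using abs_add_powr_le[of p "u x - u y" "u y"] p_pos by simp
    then show "ennreal (\<bar>u x\<bar> powr p) * indicator ?B y \<le> ennreal (2 powr p)
        * (ennreal (\<bar>u x - u y\<bar> powr p) * indicator ?B y + ennreal (\<bar>u y\<bar> powr p) * indicator ?B y)"
      by (auto split: split_indicator simp flip: ennreal_plus ennreal_mult)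
  qed
  also have "\<dots> = ennreal (2 powr p) * ((\<integral>\<^sup>+y\<in>?B. ennreal (\<bar>u x - u y\<bar> powr p) \<partial>lborel)
      + (\<integral>\<^sup>+y\<in>?B. ennreal (\<bar>u y\<bar> powr p) \<partial>lborel))"
    by (simp add: nn_integral_cmult nn_integral_add)
  also have "\<dots> \<le> ennreal (2 powr p) * (ennreal ?k * gag_at u x + ennreal b)"
    by (intro mult_left_mono add_mono ball_estimate_nn[OF u r x] le) auto
  also have "gag_at u x = ennreal ?g" using fin by simp
  also have "ennreal (2 powr p) * (ennreal ?k * ennreal ?g + ennreal b) = ennreal (2 powr p * (?k * ?g + b))"
    using b by (simp add: ennreal_mult ennreal_plus)
  finally have "\<bar>u x\<bar> powr p * (c0 * r powr Q) \<le> 2 powr p * (?k * ?g + b)"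
    using b by (subst (asm) ennreal_le_iff) auto
  then have "\<bar>u x\<bar> powr p \<le> 2 powr p * (?k * ?g + b) / (c0 * r powr Q)"
    using c0_pos r by (subst pos_le_divide_eq) auto
  also have "\<dots> = 2 powr p / c0 * ((2 * K) powr (Q + p * s) * (r powr (p * s) * ?g) + r powr (- Q) * b)"
    using r K_ge_1 c0_pos by (simp add: powr_mult powr_add powr_minus field_simps)
  also have "\<dots> \<le> 2 powr p / c0 * (((2 * K) powr (Q + p * s) + 1) * (r powr (p * s) * ?g) +
      ((2 * K) powr (Q + p * s) + 1) * (r powr (- Q) * b))"
  proof (intro mult_left_mono add_mono)
    show "r powr (- Q) * b \<le> ((2 * K) powr (Q + p * s) + 1) * (r powr (- Q) * b)"
      using b mult_right_mono[of 1 "(2 * K) powr (Q + p * s) + 1" "r powr (- Q) * b"] by simp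
    show "(2 * K) powr (Q + p * s) * (r powr (p * s) * ?g)
        \<le> ((2 * K) powr (Q + p * s) + 1) * (r powr (p * s) * ?g)"
      by (rule mult_right_mono) auto
    show "0 \<le> 2 powr p / c0" using c0_pos by simp
  qed
  also have "\<dots> = pointwise_const * (r powr (p * s) * ?g + r powr (- Q) * b)"
  proof -
    have "2 powr p / c0 * (X * a + X * b) = 2 powr p * X / c0 * (a + b)" for X a b
      using c0_pos by (simp add: field_simps)
    then show ?thesis unfolding pointwise_const_def .
  qed
  finally show ?thesis .
qed

lemma powr_le_threshold:
  fixes t T m :: real
  assumes "0 \<le> t" "0 < T" "0 < a" "a \<le> m"
  shows "t powr a \<le> T powr a + T powr (a - m) * t powr m"
proof (cases "t \<le> T")
  case True
  then have "t powr a \<le> T powr a" using assms by (intro powr_mono2) auto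
  then show ?thesis by (simp add: add_increasing2)
next
  case False
  then have "t powr a = t powr (a - m) * t powr m" using assms by (simp flip: powr_add)
  also have "\<dots> \<le> T powr (a - m) * t powr m"
    using False assms by (intro mult_right_mono powr_mono2') auto
  finally show ?thesis by (simp add: add_increasing)
qed

lemma higher_integrability:
  assumes m: "p \<le> m" and A: "0 \<le> A"
  obtains C where "0 \<le> C" "\<And>u. u \<in> borel_measurable borel \<Longrightarrow> gag u < \<infinity> \<Longrightarrow>
    (\<integral>\<^sup>+x. ennreal (\<bar>u x\<bar> powr m) \<partial>lborel) \<le> ennreal A \<Longrightarrow>
    (\<integral>\<^sup>+x. ennreal (\<bar>u x\<bar> powr (p + p * s / Q * m)) \<partial>lborel) \<le> ennreal C * gag u"
proof -
  define C where "C = pointwise_const * (1 + c0 + A)"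
  have C: "0 < C" using pointwise_const_pos c0_pos A by (simp add: C_def)
  have m0: "0 < m" using m p_pos by linarith
  define \<beta> where "\<beta> = Q * p / m"
  have \<beta>: "0 < \<beta>" using Q_pos p_pos m0 by (simp add: \<beta>_def)
  have ex: "p * (1 + p * s / \<beta>) = p + p * s / Q * m"
    using Q_pos p_pos m0 by (simp add: \<beta>_def field_simps)
  let ?C = "(2 * C) powr (1 + p * s / \<beta>)"
  have "(\<integral>\<^sup>+x. ennreal (\<bar>u x\<bar> powr (p + p * s / Q * m)) \<partial>lborel) \<le> ennreal ?C * gag u"
    if u[measurable]: "u \<in> borel_measurable borel" and g: "gag u < \<infinity>"
      and uA: "(\<integral>\<^sup>+x. ennreal (\<bar>u x\<bar> powr m) \<partial>lborel) \<le> ennreal A" for u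
  proof -
    have "AE x in lborel. ennreal (\<bar>u x\<bar> powr (p + p * s / Q * m)) \<le> ennreal ?C * gag_at u x"
      using AE_gag_at_finite[OF u g]
    proof eventually_elim
      case (elim x)
      have "\<bar>u x\<bar> powr p \<le> C * (r powr (p * s) * enn2real (gag_at u x) + r powr (- \<beta>))" if r: "0 < r" for r
      proof -
        define T where "T = r powr (- (Q / m))"
        have T: "0 < T" using r by (simp add: T_def)
        define b where "b = r powr (Q - \<beta>) * (c0 + A)"
        have b: "0 \<le> b" using c0_pos A by (simp add: b_def)
        let ?B = "{y. \<delta> x y < r}"
        have [measurable]: "?B \<in> sets borel" using open_kernel_ball by simp
        have "(\<integral>\<^sup>+y\<in>?B. ennreal (\<bar>u y\<bar> powr p) \<partial>lborel)
          \<le> (\<integral>\<^sup>+y. ennreal (T powr p) * indicator ?B y + ennreal (T powr (p - m)) * ennreal (\<bar>u y\<bar> powr m) \<partial>lborel)"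
        proof (intro nn_integral_mono)
          fix y show "ennreal (\<bar>u y\<bar> powr p) * indicator ?B y \<le>
              ennreal (T powr p) * indicator ?B y + ennreal (T powr (p - m)) * ennreal (\<bar>u y\<bar> powr m)"
            using powr_le_threshold[of "\<bar>u y\<bar>" T p m] T m p_pos
            by (auto split: split_indicator simp flip: ennreal_plus ennreal_mult)
        qed
        also have "\<dots> = ennreal (T powr p) * emeasure lborel ?B
            + ennreal (T powr (p - m)) * (\<integral>\<^sup>+y. ennreal (\<bar>u y\<bar> powr m) \<partial>lborel)"
          by (simp add: nn_integral_add nn_integral_cmult nn_integral_cmult_indicator)
        also have "\<dots> \<le> ennreal (T powr p) * ennreal (c0 * r powr Q) + ennreal (T powr (p - m)) * ennreal A"
          using uA r by (intro add_mono mult_left_mono) (auto simp: emeasure_ball)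
        also have "\<dots> = ennreal (T powr p * (c0 * r powr Q) + T powr (p - m) * A)"
          using A c0_pos by (simp add: ennreal_mult ennreal_plus)
        also have "T powr p = r powr (- \<beta>)" by (simp add: T_def powr_powr \<beta>_def)
        also have "T powr (p - m) = r powr (Q - \<beta>)"
        proof -
          have "- (Q / m) * (p - m) = Q - \<beta>" using m0 by (simp add: \<beta>_def field_simps)
          then show ?thesis by (simp only: T_def powr_powr)
        qed
        also have "r powr (- \<beta>) * (c0 * r powr Q) + r powr (Q - \<beta>) * A = b"
          using r by (simp add: b_def algebra_simps powr_diff powr_minus divide_inverse)
        finally have "\<bar>u x\<bar> powr p \<le> pointwise_const * (r powr (p * s) * enn2real (gag_at u x) + r powr (- Q) * b)"
          using r \<delta>_eq_0[of x x] by (intro pointwise_estimate[OF u r _ elim b, of x]) auto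
        also have "r powr (- Q) * b = r powr (- \<beta>) * (c0 + A)"
          using r by (simp add: b_def powr_diff powr_minus field_simps)
        also have "pointwise_const * (r powr (p * s) * enn2real (gag_at u x) + r powr (- \<beta>) * (c0 + A))
          \<le> pointwise_const * ((1 + c0 + A) * (r powr (p * s) * enn2real (gag_at u x)) + (1 + c0 + A) * r powr (- \<beta>))"
        proof (intro mult_left_mono add_mono)
          show "r powr (p * s) * enn2real (gag_at u x) \<le> (1 + c0 + A) * (r powr (p * s) * enn2real (gag_at u x))"
            using c0_pos A mult_right_mono[of 1 "1 + c0 + A" "r powr (p * s) * enn2real (gag_at u x)"] by simp
          show "r powr (- \<beta>) * (c0 + A) \<le> (1 + c0 + A) * r powr (- \<beta>)"
            by (simp add: algebra_simps)
        qed (use pointwise_const_pos in auto)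
        also have "\<dots> = C * (r powr (p * s) * enn2real (gag_at u x) + r powr (- \<beta>))"
        proof -
          have "pointwise_const * (X * a + X * b) = pointwise_const * X * (a + b)" for X a b by (simp add: algebra_simps)
          then show ?thesis unfolding C_def .
        qed
        finally show ?thesis .
      qed
      from optimise_radius[OF _ C _ ps_pos \<beta> this]
      have "(\<bar>u x\<bar> powr p) powr (1 + p * s / \<beta>) \<le> ?C * enn2real (gag_at u x)" by simp
      then have "ennreal (\<bar>u x\<bar> powr (p + p * s / Q * m)) \<le> ennreal (?C * enn2real (gag_at u x))"
        unfolding powr_powr ex by (rule ennreal_leI)
      also have "\<dots> = ennreal ?C * gag_at u x" using elim by (simp add: ennreal_mult)
      finally show ?case .
    qed
    then have "(\<integral>\<^sup>+x. ennreal (\<bar>u x\<bar> powr (p + p * s / Q * m)) \<partial>lborel) \<le> (\<integral>\<^sup>+x. ennreal ?C * gag_at u x \<partial>lborel)"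
      by (rule nn_integral_mono_AE)
    then show ?thesis by (simp add: nn_integral_cmult nn_integral_gag_at)
  qed
  then show thesis by (intro that[of ?C]) auto
qed

definition subcritical_bound :: "real \<Rightarrow> bool" where
  "subcritical_bound m \<longleftrightarrow> (\<forall>R\<ge>0. \<exists>A\<ge>0. \<forall>u\<in>borel_measurable borel. snorm u \<le> ennreal R \<longrightarrow>
     (\<integral>\<^sup>+x. ennreal (\<bar>u x\<bar> powr m) \<partial>lborel) \<le> ennreal A)"

lemma snorm_leD:
  assumes "snorm u \<le> ennreal R"
  shows "gag u \<le> ennreal R" "(\<integral>\<^sup>+x. ennreal (\<bar>u x\<bar> powr p) \<partial>lborel) \<le> ennreal R"
  using assms order_trans[OF _ assms] unfolding snorm_def by (auto simp: add_increasing add_increasing2)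

lemma subcritical_bound_step:
  assumes "subcritical_bound m" "p \<le> m"
  shows "subcritical_bound (p + p * s / Q * m)"
  unfolding subcritical_bound_def
proof (intro allI impI)
  fix R :: real assume R: "0 \<le> R"
  with assms(1) obtain A where A: "0 \<le> A" "\<forall>u\<in>borel_measurable borel. snorm u \<le> ennreal R \<longrightarrow>
     (\<integral>\<^sup>+x. ennreal (\<bar>u x\<bar> powr m) \<partial>lborel) \<le> ennreal A"
    unfolding subcritical_bound_def by blast
  obtain C where C: "0 \<le> C" "\<And>u. u \<in> borel_measurable borel \<Longrightarrow> gag u < \<infinity> \<Longrightarrow>
    (\<integral>\<^sup>+x. ennreal (\<bar>u x\<bar> powr m) \<partial>lborel) \<le> ennreal A \<Longrightarrow>
    (\<integral>\<^sup>+x. ennreal (\<bar>u x\<bar> powr (p + p * s / Q * m)) \<partial>lborel) \<le> ennreal C * gag u"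
    using higher_integrability[OF assms(2) A(1)] by blast
  have "(\<integral>\<^sup>+x. ennreal (\<bar>u x\<bar> powr (p + p * s / Q * m)) \<partial>lborel) \<le> ennreal (C * R)"
    if u: "u \<in> borel_measurable borel" and le: "snorm u \<le> ennreal R" for u
  proof -
    have g: "gag u \<le> ennreal R" by (rule snorm_leD[OF le])
    then have "gag u < \<infinity>" by (simp add: le_less_trans)
    with C(2)[OF u] A(2) u le have "(\<integral>\<^sup>+x. ennreal (\<bar>u x\<bar> powr (p + p * s / Q * m)) \<partial>lborel) \<le> ennreal C * gag u"
      by blast
    also have "\<dots> \<le> ennreal C * ennreal R" using g by (rule mult_left_mono) simp
    finally show ?thesis using C R by (simp add: ennreal_mult)
  qed
  then show "\<exists>A\<ge>0. \<forall>u\<in>borel_measurable borel. snorm u \<le> ennreal R \<longrightarrow>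
     (\<integral>\<^sup>+x. ennreal (\<bar>u x\<bar> powr (p + p * s / Q * m)) \<partial>lborel) \<le> ennreal A"
    using C R by (intro exI[of _ "C * R"]) auto
qed

lemma subcritical_embedding:
  assumes "p \<le> q" "q < Q * p / (Q - p * s)"
  shows "subcritical_bound q"
proof -
  define \<theta> where "\<theta> = p * s / Q"
  define P where "P = Q * p / (Q - p * s)"
  have \<theta>: "0 < \<theta>" "\<theta> < 1" using ps_pos Q_pos Q_gt by (auto simp: \<theta>_def)
  have P: "p + \<theta> * P = P" using Q_pos Q_gt by (simp add: P_def \<theta>_def field_simps)
  have "p < P" using assms unfolding P_def by linarith
  define m where "m i = P - (P - p) * \<theta> ^ i" for i :: nat
  have m_ge: "p \<le> m i" for i
  proof -
    have "(P - p) * \<theta> ^ i \<le> (P - p) * 1"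
      using \<theta> \<open>p < P\<close> by (intro mult_left_mono power_le_one) auto
    then show ?thesis by (simp add: m_def)
  qed
  have m_bound: "subcritical_bound (m i)" for i
  proof (induction i)
    case 0
    show ?case using snorm_leD(2) by (auto simp: m_def subcritical_bound_def)
  next
    case (Suc i)
    have "p + p * s / Q * m i = p + \<theta> * P - (P - p) * \<theta> ^ Suc i"
      unfolding m_def \<theta>_def[symmetric] by (simp add: algebra_simps)
    then have "p + p * s / Q * m i = m (Suc i)" using P by (simp add: m_def)
    with subcritical_bound_step[OF Suc m_ge] show ?case by simp
  qed
  have "(\<lambda>i. (P - p) * \<theta> ^ i) \<longlonglongrightarrow> (P - p) * 0"
    using \<theta> by (intro tendsto_intros LIMSEQ_realpow_zero) auto
  then have "\<forall>\<^sub>F i in sequentially. (P - p) * \<theta> ^ i < P - q"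
    using assms(2) by (intro order_tendstoD(2)) (auto simp: P_def)
  then have "\<exists>i. (P - p) * \<theta> ^ i < P - q" by (rule eventually_happens'[OF sequentially_bot])
  then obtain i where i: "q < m i" unfolding m_def by (auto simp: algebra_simps)
  show ?thesis unfolding subcritical_bound_def
  proof (intro allI impI)
    fix R :: real assume R: "0 \<le> R"
    with m_bound[of i] obtain A where A: "0 \<le> A" "\<forall>u\<in>borel_measurable borel. snorm u \<le> ennreal R \<longrightarrow>
       (\<integral>\<^sup>+x. ennreal (\<bar>u x\<bar> powr m i) \<partial>lborel) \<le> ennreal A"
      unfolding subcritical_bound_def by blast
    have "(\<integral>\<^sup>+x. ennreal (\<bar>u x\<bar> powr q) \<partial>lborel) \<le> ennreal (R + A)"
      if u[measurable]: "u \<in> borel_measurable borel" and le: "snorm u \<le> ennreal R" for u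
    proof -
      have "(\<integral>\<^sup>+x. ennreal (\<bar>u x\<bar> powr q) \<partial>lborel)
          \<le> (\<integral>\<^sup>+x. ennreal (\<bar>u x\<bar> powr p) + ennreal (\<bar>u x\<bar> powr m i) \<partial>lborel)"
      proof (intro nn_integral_mono)
        fix x
        have "\<bar>u x\<bar> powr q \<le> \<bar>u x\<bar> powr p + \<bar>u x\<bar> powr m i"
          using assms(1) i by (intro powr_le_sum_powr) auto
        then show "ennreal (\<bar>u x\<bar> powr q) \<le> ennreal (\<bar>u x\<bar> powr p) + ennreal (\<bar>u x\<bar> powr m i)"
          by (simp flip: ennreal_plus)
      qed
      also have "\<dots> = (\<integral>\<^sup>+x. ennreal (\<bar>u x\<bar> powr p) \<partial>lborel) + (\<integral>\<^sup>+x. ennreal (\<bar>u x\<bar> powr m i) \<partial>lborel)"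
        by (rule nn_integral_add) auto
      also have "\<dots> \<le> ennreal R + ennreal A"
        using A(2) u le snorm_leD(2)[OF le] by (intro add_mono) auto
      finally show ?thesis using A R by (simp add: ennreal_plus)
    qed
    then show "\<exists>A\<ge>0. \<forall>u\<in>borel_measurable borel. snorm u \<le> ennreal R \<longrightarrow>
       (\<integral>\<^sup>+x. ennreal (\<bar>u x\<bar> powr q) \<partial>lborel) \<le> ennreal A"
      using A R by (intro exI[of _ "R + A"]) auto
  qed
qed

lemma vanishing_estimate:
  assumes u[measurable]: "u \<in> borel_measurable borel" and le: "snorm u \<le> ennreal R" and R: "0 \<le> R"
    and \<eta>: "0 < \<eta>" and small: "\<And>x. (\<integral>\<^sup>+y\<in>{y. \<delta> x y < 1}. ennreal (\<bar>u y\<bar> powr p) \<partial>lborel) \<le> ennreal \<eta>"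
  shows "(\<integral>\<^sup>+x. ennreal (\<bar>u x\<bar> powr (p * (1 + p * s / Q))) \<partial>lborel)
    \<le> ennreal ((2 * pointwise_const * \<eta>) powr (p * s / Q) * (R + 2 * pointwise_const * R))"
proof -
  let ?k = "(2 * pointwise_const * \<eta>) powr (p * s / Q)"
  have g: "gag u < \<infinity>" using snorm_leD(1)[OF le] by (simp add: le_less_trans)
  have "AE x in lborel. ennreal (\<bar>u x\<bar> powr (p * (1 + p * s / Q)))
      \<le> ennreal ?k * (ennreal (\<bar>u x\<bar> powr p) + ennreal (2 * pointwise_const) * gag_at u x)"
    using AE_gag_at_finite[OF u g]
  proof eventually_elim
    case (elim x)
    have "\<bar>u x\<bar> powr p \<le> pointwise_const * (r powr (p * s) * enn2real (gag_at u x) + r powr (- Q) * \<eta>)"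
      if r: "0 < r" "r \<le> 1" for r
    proof (rule pointwise_estimate[OF u r(1) _ elim, of x])
      have "(\<integral>\<^sup>+y\<in>{y. \<delta> x y < r}. ennreal (\<bar>u y\<bar> powr p) \<partial>lborel)
          \<le> (\<integral>\<^sup>+y\<in>{y. \<delta> x y < 1}. ennreal (\<bar>u y\<bar> powr p) \<partial>lborel)"
        using r by (intro nn_integral_mono) (auto split: split_indicator)
      then show "(\<integral>\<^sup>+y\<in>{y. \<delta> x y < r}. ennreal (\<bar>u y\<bar> powr p) \<partial>lborel) \<le> ennreal \<eta>"
        using small by (rule order_trans)
    qed (use \<eta> r \<delta>_eq_0[of x x] in auto)
    from optimise_radius_le_1[OF _ pointwise_const_pos _ ps_pos Q_pos \<eta> this]
    have "\<bar>u x\<bar> powr (p * (1 + p * s / Q)) \<le> ?k * (\<bar>u x\<bar> powr p + 2 * pointwise_const * enn2real (gag_at u x))"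
      by (simp add: powr_powr)
    then have "ennreal (\<bar>u x\<bar> powr (p * (1 + p * s / Q))) \<le> ennreal (?k * (\<bar>u x\<bar> powr p + 2 * pointwise_const * enn2real (gag_at u x)))"
      by (rule ennreal_leI)
    also have "\<dots> = ennreal ?k * (ennreal (\<bar>u x\<bar> powr p) + ennreal (2 * pointwise_const) * ennreal (enn2real (gag_at u x)))"
      using pointwise_const_pos by (simp add: ennreal_mult ennreal_plus)
    finally show ?case using elim by simp
  qed
  then have "(\<integral>\<^sup>+x. ennreal (\<bar>u x\<bar> powr (p * (1 + p * s / Q))) \<partial>lborel)
      \<le> (\<integral>\<^sup>+x. ennreal ?k * (ennreal (\<bar>u x\<bar> powr p) + ennreal (2 * pointwise_const) * gag_at u x) \<partial>lborel)"
    by (rule nn_integral_mono_AE)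
  also have "\<dots> = ennreal ?k * ((\<integral>\<^sup>+x. ennreal (\<bar>u x\<bar> powr p) \<partial>lborel) + ennreal (2 * pointwise_const) * gag u)"
    by (simp add: nn_integral_cmult nn_integral_add nn_integral_gag_at)
  also have "\<dots> \<le> ennreal ?k * (ennreal R + ennreal (2 * pointwise_const) * ennreal R)"
    by (intro mult_left_mono add_mono snorm_leD[OF le]) auto
  finally show ?thesis using pointwise_const_pos R by (simp add: ennreal_mult ennreal_plus)
qed

lemma non_vanishing:
  assumes q: "p < q" "q < Q * p / (Q - p * s)" and R: "0 \<le> R"
  obtains \<eta> where "0 < \<eta>" "\<And>u. u \<in> borel_measurable borel \<Longrightarrow> snorm u \<le> ennreal R \<Longrightarrow>
    (\<And>x. (\<integral>\<^sup>+y\<in>{y. \<delta> x y < 1}. ennreal (\<bar>u y\<bar> powr p) \<partial>lborel) \<le> ennreal \<eta>) \<Longrightarrow>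
    (\<integral>\<^sup>+x. ennreal (\<bar>u x\<bar> powr q) \<partial>lborel) < 1"
proof -
  obtain m where m: "q < m" "m < Q * p / (Q - p * s)" using dense[OF q(2)] by blast
  have "subcritical_bound m" using m q by (intro subcritical_embedding) auto
  with R obtain A where A: "0 \<le> A" "\<forall>u\<in>borel_measurable borel. snorm u \<le> ennreal R \<longrightarrow>
     (\<integral>\<^sup>+x. ennreal (\<bar>u x\<bar> powr m) \<partial>lborel) \<le> ennreal A"
    unfolding subcritical_bound_def by blast
  define \<theta> where "\<theta> = p * s / Q"
  define t where "t = p * (1 + \<theta>)"
  have \<theta>: "0 < \<theta>" using ps_pos Q_pos by (simp add: \<theta>_def)
  then have t: "0 < t" using p_pos by (simp add: t_def)
  define \<epsilon> where "\<epsilon> = 1 / (4 * (R + A + 1))"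
  have \<epsilon>: "0 < \<epsilon>" "\<epsilon> * (R + A) \<le> 1 / 4" using R A(1) by (auto simp: \<epsilon>_def divide_simps)
  obtain C where C: "0 \<le> C" "\<And>\<tau>. 0 \<le> \<tau> \<Longrightarrow> \<tau> powr q \<le> \<epsilon> * (\<tau> powr p + \<tau> powr m) + C * \<tau> powr t"
    using powr_interpolate_eps[OF p_pos q(1) m(1) t \<epsilon>(1)] by blast
  define L where "L = C * (R + 2 * pointwise_const * R)"
  have L: "0 \<le> L" using C R pointwise_const_pos by (simp add: L_def)
  define \<eta> where "\<eta> = (1 / (4 * (L + 1))) powr (1 / \<theta>) / (2 * pointwise_const)"
  have \<eta>: "0 < \<eta>" using L pointwise_const_pos by (simp add: \<eta>_def)
  have eq: "(2 * pointwise_const * \<eta>) powr \<theta> = 1 / (4 * (L + 1))"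
    using pointwise_const_pos \<theta> L by (simp add: \<eta>_def powr_powr)
  have \<eta>L: "(2 * pointwise_const * \<eta>) powr \<theta> * L \<le> 1 / 4" unfolding eq using L by (simp add: divide_simps)
  have "(\<integral>\<^sup>+x. ennreal (\<bar>u x\<bar> powr q) \<partial>lborel) < 1"
    if u[measurable]: "u \<in> borel_measurable borel" and le: "snorm u \<le> ennreal R"
      and small: "\<And>x. (\<integral>\<^sup>+y\<in>{y. \<delta> x y < 1}. ennreal (\<bar>u y\<bar> powr p) \<partial>lborel) \<le> ennreal \<eta>" for u
  proof -
    have "(\<integral>\<^sup>+x. ennreal (\<bar>u x\<bar> powr q) \<partial>lborel) \<le> (\<integral>\<^sup>+x. ennreal \<epsilon> * (ennreal (\<bar>u x\<bar> powr p)
        + ennreal (\<bar>u x\<bar> powr m)) + ennreal C * ennreal (\<bar>u x\<bar> powr t) \<partial>lborel)"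
      using C \<epsilon>(1) by (intro nn_integral_mono) (simp flip: ennreal_plus ennreal_mult)
    also have "\<dots> = ennreal \<epsilon> * ((\<integral>\<^sup>+x. ennreal (\<bar>u x\<bar> powr p) \<partial>lborel) + (\<integral>\<^sup>+x. ennreal (\<bar>u x\<bar> powr m) \<partial>lborel))
        + ennreal C * (\<integral>\<^sup>+x. ennreal (\<bar>u x\<bar> powr t) \<partial>lborel)"
      by (simp add: nn_integral_cmult nn_integral_add)
    also have "\<dots> \<le> ennreal \<epsilon> * (ennreal R + ennreal A)
        + ennreal C * ennreal ((2 * pointwise_const * \<eta>) powr \<theta> * (R + 2 * pointwise_const * R))"
      using A(2) u le snorm_leD(2)[OF le] vanishing_estimate[OF u le R \<eta> small]
      unfolding t_def \<theta>_def by (intro add_mono mult_left_mono) auto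
    also have "\<dots> = ennreal (\<epsilon> * (R + A) + (2 * pointwise_const * \<eta>) powr \<theta> * L)"
      using \<epsilon> R A C pointwise_const_pos by (simp add: L_def mult_ac flip: ennreal_plus ennreal_mult)
    also have "\<dots> < ennreal 1"
      using \<epsilon>(2) \<eta>L by (intro ennreal_lessI) auto
    finally show ?thesis by simp
  qed
  with \<eta> show thesis by (rule that)
qed

end

section \<open>Local compactness\<close>

lemma bounded_diagonal_subsequence:
  fixes a :: "nat \<Rightarrow> 'i::countable \<Rightarrow> real"
  assumes "\<And>n i. \<bar>a n i\<bar> \<le> M i"
  obtains r where "strict_mono r" "\<And>i. \<exists>l. (\<lambda>n. a (r n) i) \<longlonglongrightarrow> l"
proof -
  let ?K = "PiE UNIV (\<lambda>i. {- M i..M i})"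
  have "compactin (product_topology (\<lambda>i. euclidean) UNIV) ?K"
    by (simp add: compactin_PiE)
  then have "compact ?K" by (simp add: euclidean_product_topology)
  then have "seq_compact ?K" by (rule compact_imp_seq_compact)
  moreover have "a n \<in> ?K" for n using assms by (force simp: abs_le_iff minus_le_iff)
  ultimately obtain l r where r: "strict_mono (r :: nat \<Rightarrow> nat)" "(a \<circ> r) \<longlonglongrightarrow> l"
    by (metis seq_compactE)
  have "(\<lambda>n. a (r n) i) \<longlonglongrightarrow> l i" for i
  proof -
    have "((\<lambda>n. (a \<circ> r) n i) \<longlongrightarrow> l i) sequentially"
      by (rule continuous_on_tendsto_compose[OF continuous_on_product_coordinates r(2)]) auto
    then show ?thesis by simp
  qed
  with r(1) show thesis by (intro that[of r]) auto
qed

lemma powr_le_of_threshold_bounds: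
  fixes w A p :: real
  assumes "0 \<le> w" "0 \<le> A" "1 < p" and le: "\<And>t. 0 < t \<Longrightarrow> w \<le> t + t powr (1 - p) * A"
  shows "w powr p \<le> 2 powr p * A"
proof (cases "A = 0")
  case True
  have "w \<le> 0"
  proof (rule field_le_epsilon)
    fix e :: real assume "0 < e"
    then show "w \<le> 0 + e" using le[of e] True by simp
  qed
  with assms(1) True show ?thesis by simp
next
  case False
  then have A: "0 < A" using assms by simp
  have "(A powr (1 / p)) powr (1 - p) * A = A powr (1 / p * (1 - p) + 1)"
    using A by (simp add: powr_powr powr_add)
  also have "1 / p * (1 - p) + 1 = 1 / p" using assms by (simp add: field_simps)
  finally have "w \<le> 2 * A powr (1 / p)" using le[of "A powr (1 / p)"] A by simp
  then have "w powr p \<le> (2 * A powr (1 / p)) powr p" using assms by (intro powr_mono2) auto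
  also have "\<dots> = 2 powr p * A" using A assms by (simp add: powr_mult powr_powr)
  finally show ?thesis .
qed

lemma exists_bounded_positive_integrable:
  obtains H :: "'a::euclidean_space \<Rightarrow> real"
  where "H \<in> borel_measurable borel" "\<And>x. 0 < H x" "\<And>x. H x \<le> 1" "integrable lborel H"
proof -
  have "\<exists>h\<in>borel_measurable (lborel :: 'a measure). integral\<^sup>N lborel h \<noteq> \<infinity>
      \<and> (\<forall>x\<in>space lborel. 0 < h x \<and> h x < \<infinity>)"
    by (rule sigma_finite_measure.Ex_finite_integrable_function[OF sigma_finite_lborel])
  then obtain h :: "'a \<Rightarrow> ennreal" where h[measurable]: "h \<in> borel_measurable lborel"
    and fin: "integral\<^sup>N lborel h \<noteq> \<infinity>" and pos: "\<And>x. 0 < h x \<and> h x < \<infinity>"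
    by auto
  define H where "H x = enn2real (min 1 (h x))" for x
  have eq: "ennreal (H x) = min 1 (h x)" for x
    unfolding H_def by (intro ennreal_enn2real) (simp add: min_less_iff_disj)
  have [measurable]: "H \<in> borel_measurable borel" unfolding H_def by measurable
  have "0 < H x" for x
  proof -
    have "0 < ennreal (H x)" unfolding eq using pos[of x] by (simp add: min_def)
    then show ?thesis by simp
  qed
  moreover have "H x \<le> 1" for x
  proof -
    have "ennreal (H x) \<le> ennreal 1" unfolding eq by simp
    then show ?thesis by (simp add: ennreal_le_iff)
  qed
  moreover have "integrable lborel H"
  proof (subst integrable_iff_nn_integral_finite)
    show "0 \<le> H x" for x by (simp add: H_def)
    have "(\<integral>\<^sup>+x. ennreal (H x) \<partial>lborel) \<le> integral\<^sup>N lborel h"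
      by (intro nn_integral_mono) (simp add: eq)
    then show "(\<integral>\<^sup>+x. ennreal (H x) \<partial>lborel) < \<infinity>" using fin by (simp add: le_less_trans top.not_eq_extremum)
  qed simp
  ultimately show thesis by (intro that[of H]) auto
qed

context ahlfors_kernel
begin

definition avg :: "('a \<Rightarrow> real) \<Rightarrow> 'a \<Rightarrow> real \<Rightarrow> real" where
  "avg u z r = (\<integral>y. indicator {y. \<delta> z y < r} y * u y \<partial>lborel) / (c0 * r powr Q)"

lemma integrable_ball_const:
  assumes "0 < r"
  shows "integrable lborel (\<lambda>y. indicator {y. \<delta> z y < r} y * (c::real))"
    "(\<integral>y. indicator {y. \<delta> z y < r} y * c \<partial>lborel) = c0 * r powr Q * c"
proof -
  have [measurable]: "{y. \<delta> z y < r} \<in> sets borel" using open_kernel_ball by simp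
  have fin: "emeasure lborel {y. \<delta> z y < r} < \<infinity>" using assms by (simp add: emeasure_ball)
  show "integrable lborel (\<lambda>y. indicator {y. \<delta> z y < r} y * c)"
    using fin by (intro integrable_mult_left integrable_real_indicator) auto
  have "measure lborel {y. \<delta> z y < r} = c0 * r powr Q"
    using assms c0_pos by (simp add: measure_def emeasure_ball)
  then show "(\<integral>y. indicator {y. \<delta> z y < r} y * c \<partial>lborel) = c0 * r powr Q * c" by simp
qed

lemma integrable_ball:
  assumes [measurable]: "u \<in> borel_measurable borel" and int: "integrable lborel (\<lambda>x. \<bar>u x\<bar> powr p)" and r: "0 < r"
  shows "integrable lborel (\<lambda>y. indicator {y. \<delta> z y < r} y * u y)"
proof (rule Bochner_Integration.integrable_bound)
  have [measurable]: "{y. \<delta> z y < r} \<in> sets borel" using open_kernel_ball by simp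
  show "integrable lborel (\<lambda>y. indicator {y. \<delta> z y < r} y * 1 + \<bar>u y\<bar> powr p)"
    using int r by (intro Bochner_Integration.integrable_add integrable_ball_const)
  show "AE y in lborel. norm (indicator {y. \<delta> z y < r} y * u y) \<le> norm (indicator {y. \<delta> z y < r} y * 1 + \<bar>u y\<bar> powr p)"
    using powr_le_threshold[of "\<bar>u y\<bar>" 1 1 p for y] p_gt_1 by (auto split: split_indicator)
  show "(\<lambda>y. indicator {y. \<delta> z y < r} y * u y) \<in> borel_measurable lborel" by simp
qed

lemma avg_bound:
  assumes u[measurable]: "u \<in> borel_measurable borel" and int: "integrable lborel (\<lambda>x. \<bar>u x\<bar> powr p)" and r: "0 < r"
  shows "\<bar>avg u z r\<bar> \<le> 1 + (\<integral>x. \<bar>u x\<bar> powr p \<partial>lborel) / (c0 * r powr Q)"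
proof -
  let ?B = "{y. \<delta> z y < r}"
  have "\<bar>\<integral>y. indicator ?B y * u y \<partial>lborel\<bar> \<le> (\<integral>y. \<bar>indicator ?B y * u y\<bar> \<partial>lborel)"
    by (rule integral_abs_bound)
  also have "\<dots> \<le> (\<integral>y. indicator ?B y * 1 + \<bar>u y\<bar> powr p \<partial>lborel)"
  proof (intro integral_mono)
    show "\<bar>indicator ?B y * u y\<bar> \<le> indicator ?B y * 1 + \<bar>u y\<bar> powr p" for y
      using powr_le_threshold[of "\<bar>u y\<bar>" 1 1 p] p_gt_1 by (auto split: split_indicator)
  qed (intro integrable_abs integrable_ball Bochner_Integration.integrable_add integrable_ball_const u int r)+
  also have "\<dots> = c0 * r powr Q * 1 + (\<integral>y. \<bar>u y\<bar> powr p \<partial>lborel)"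
    using int integrable_ball_const[OF r, of z 1] by (subst Bochner_Integration.integral_add) simp_all
  finally show ?thesis using c0_pos r by (simp add: avg_def abs_divide field_simps)
qed

definition average_const :: real where "average_const = 2 powr p * (2 * K) powr (Q + p * s) / c0"

lemma average_const_pos: "0 < average_const"
  using c0_pos K_ge_1 by (simp add: average_const_def)

lemma avg_estimate:
  assumes u[measurable]: "u \<in> borel_measurable borel" and int: "integrable lborel (\<lambda>x. \<bar>u x\<bar> powr p)"
    and r: "0 < r" and x: "\<delta> z x < r" and fin: "gag_at u x < \<infinity>"
  shows "\<bar>u x - avg u z r\<bar> powr p \<le> average_const * r powr (p * s) * enn2real (gag_at u x)"
proof -
  let ?B = "{y. \<delta> z y < r}" and ?g = "enn2real (gag_at u x)"
  have [measurable]: "?B \<in> sets borel" using open_kernel_ball by simp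
  define m where "m = c0 * r powr Q"
  have m: "0 < m" using c0_pos r by (simp add: m_def)
  define G where "G = (2 * K * r) powr (Q + p * s) * ?g"
  have G: "0 \<le> G" by (simp add: G_def)
  have "(\<integral>\<^sup>+y. ennreal (indicator ?B y * \<bar>u x - u y\<bar> powr p) \<partial>lborel)
      = (\<integral>\<^sup>+y\<in>?B. ennreal (\<bar>u x - u y\<bar> powr p) \<partial>lborel)"
    by (intro nn_integral_cong) (auto split: split_indicator)
  also have "\<dots> \<le> ennreal ((2 * K * r) powr (Q + p * s)) * gag_at u x"
    by (rule ball_estimate_nn[OF u r x])
  also have "\<dots> = ennreal G" using fin by (simp add: G_def ennreal_mult)
  finally have nn: "(\<integral>\<^sup>+y. ennreal (indicator ?B y * \<bar>u x - u y\<bar> powr p) \<partial>lborel) \<le> ennreal G" .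
  then have dint: "integrable lborel (\<lambda>y. indicator ?B y * \<bar>u x - u y\<bar> powr p)"
    by (subst integrable_iff_nn_integral_finite) (auto simp: le_less_trans)
  have dle: "(\<integral>y. indicator ?B y * \<bar>u x - u y\<bar> powr p \<partial>lborel) \<le> G"
    using nn G by (simp add: nn_integral_eq_integral[OF dint])
  have cint: "integrable lborel (\<lambda>y. indicator ?B y * c)" for c :: real by (rule integrable_ball_const[OF r])
  have uint: "integrable lborel (\<lambda>y. indicator ?B y * u y)" by (rule integrable_ball[OF u int r])
  have "(\<integral>y. indicator ?B y * u x - indicator ?B y * u y \<partial>lborel)
      = m * u x - (\<integral>y. indicator ?B y * u y \<partial>lborel)"
    by (simp only: Bochner_Integration.integral_diff[OF cint uint] integrable_ball_const(2)[OF r] m_def)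
  then have "u x - avg u z r = (\<integral>y. indicator ?B y * u x - indicator ?B y * u y \<partial>lborel) / m"
    using m by (simp only: avg_def m_def[symmetric] diff_divide_distrib) simp
  then have eq: "\<bar>u x - avg u z r\<bar> = \<bar>\<integral>y. indicator ?B y * u x - indicator ?B y * u y \<partial>lborel\<bar> / m"
    using m by simp
  have "\<bar>u x - avg u z r\<bar> \<le> t + t powr (1 - p) * (G / m)" if t: "0 < t" for t
  proof -
    have "\<bar>\<integral>y. indicator ?B y * u x - indicator ?B y * u y \<partial>lborel\<bar>
        \<le> (\<integral>y. \<bar>indicator ?B y * u x - indicator ?B y * u y\<bar> \<partial>lborel)"
      by (rule integral_abs_bound)
    also have "\<dots> \<le> (\<integral>y. indicator ?B y * t + t powr (1 - p) * (indicator ?B y * \<bar>u x - u y\<bar> powr p) \<partial>lborel)"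
    proof (intro integral_mono)
      show "\<bar>indicator ?B y * u x - indicator ?B y * u y\<bar>
          \<le> indicator ?B y * t + t powr (1 - p) * (indicator ?B y * \<bar>u x - u y\<bar> powr p)" for y
        using powr_le_threshold[of "\<bar>u x - u y\<bar>" t 1 p] t p_gt_1 by (auto split: split_indicator)
      show "integrable lborel (\<lambda>y. \<bar>indicator ?B y * u x - indicator ?B y * u y\<bar>)"
        by (rule integrable_abs, rule Bochner_Integration.integrable_diff[OF cint uint])
      show "integrable lborel (\<lambda>y. indicator ?B y * t + t powr (1 - p) * (indicator ?B y * \<bar>u x - u y\<bar> powr p))"
        by (rule Bochner_Integration.integrable_add[OF cint integrable_mult_right[OF dint]])
    qed
    also have "\<dots> = m * t + t powr (1 - p) * (\<integral>y. indicator ?B y * \<bar>u x - u y\<bar> powr p \<partial>lborel)"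
      using cint[of t] dint integrable_ball_const(2)[OF r, of z t]
      by (subst Bochner_Integration.integral_add) (simp_all add: m_def)
    also have "\<dots> \<le> m * t + t powr (1 - p) * G" using dle by (intro add_left_mono mult_left_mono) auto
    finally show ?thesis using m by (simp add: eq field_simps)
  qed
  then have "\<bar>u x - avg u z r\<bar> powr p \<le> 2 powr p * (G / m)"
    using G m p_gt_1 by (intro powr_le_of_threshold_bounds) auto
  also have "\<dots> = average_const * r powr (p * s) * ?g"
    using r K_ge_1 c0_pos by (simp add: G_def m_def average_const_def powr_mult powr_add field_simps)
  finally show ?thesis .
qed

lemma dense_sequence:
  obtains D :: "nat \<Rightarrow> 'a" where "\<And>x r. 0 < r \<Longrightarrow> \<exists>i. \<delta> (D i) x < r"
proof -
  obtain E :: "'a set" where E: "countable E" "\<And>X. open X \<Longrightarrow> X \<noteq> {} \<Longrightarrow> \<exists>d\<in>E. d \<in> X"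
    by (erule countable_dense_setE)
  have ne: "E \<noteq> {}" using E(2)[of UNIV] by auto
  have "\<exists>i. \<delta> (from_nat_into E i) x < r" if "0 < r" for x r
  proof -
    have "x \<in> {y. \<delta> x y < r}" using that \<delta>_eq_0[of x x] by simp
    then obtain d where "d \<in> E" "\<delta> x d < r" using E(2)[OF open_kernel_ball, of x r] by blast
    then show ?thesis using from_nat_into_surj[OF E(1)] \<delta>_sym by metis
  qed
  then show thesis by (rule that)
qed

text \<open>Averages over the countably many balls centred in a dense sequence converge along a diagonal
  subsequence. Replacing \<open>u x\<close> by its average over the first of the balls of radius \<open>\<rho>\<close> that contains
  \<open>x\<close> costs \<open>O(\<rho>\<^bsup>ps\<^esup>)\<close> uniformly along the sequence, which is thus Cauchy in a weighted \<open>L\<^sup>1\<close>.\<close>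

lemma compactness:
  fixes u :: "nat \<Rightarrow> 'a \<Rightarrow> real"
  assumes u[measurable]: "\<And>n. u n \<in> borel_measurable borel" and le: "\<And>n. snorm (u n) \<le> ennreal R" and R: "0 \<le> R"
  obtains r v where "strict_mono r" "v \<in> borel_measurable borel" "AE x in lborel. (\<lambda>n. u (r n) x) \<longlonglongrightarrow> v x"
proof -
  obtain D :: "nat \<Rightarrow> 'a" where D: "\<And>x r. 0 < r \<Longrightarrow> \<exists>i. \<delta> (D i) x < r" using dense_sequence by blast
  obtain H :: "'a \<Rightarrow> real" where H[measurable]: "H \<in> borel_measurable borel"
    and H_pos: "\<And>x. 0 < H x" and H_le: "\<And>x. H x \<le> 1" and H_int: "integrable lborel H"
    using exists_bounded_positive_integrable by blast
  have H_nn: "0 \<le> H x" for x using H_pos[of x] by simp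
  define I0 where "I0 = (\<integral>x. H x \<partial>lborel)"
  have I0: "0 \<le> I0" unfolding I0_def using H_nn by (rule Bochner_Integration.integral_nonneg)
  have nn_le: "(\<integral>\<^sup>+x. ennreal (\<bar>u n x\<bar> powr p) \<partial>lborel) \<le> ennreal R" for n by (rule snorm_leD[OF le])
  have int: "integrable lborel (\<lambda>x. \<bar>u n x\<bar> powr p)" for n
    using nn_le[of n] by (subst integrable_iff_nn_integral_finite) (auto simp: le_less_trans)
  have int_le: "(\<integral>x. \<bar>u n x\<bar> powr p \<partial>lborel) \<le> R" for n
    using nn_le[of n] R by (simp add: nn_integral_eq_integral[OF int])
  have gag_le: "gag (u n) \<le> ennreal R" for n by (rule snorm_leD[OF le])
  define \<rho> where "\<rho> j = 1 / real (Suc j)" for j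
  have \<rho>: "0 < \<rho> j" for j by (simp add: \<rho>_def)
  define M where "M j = 1 + R / (c0 * \<rho> j powr Q)" for j
  have M: "0 \<le> M j" for j using R c0_pos by (simp add: M_def)
  have avg_M: "\<bar>avg (u n) z (\<rho> j)\<bar> \<le> M j" for n j z
  proof -
    have "(\<integral>x. \<bar>u n x\<bar> powr p \<partial>lborel) / (c0 * \<rho> j powr Q) \<le> R / (c0 * \<rho> j powr Q)"
      using int_le c0_pos by (intro divide_right_mono) auto
    then show ?thesis using avg_bound[OF u int \<rho>, of n z j] by (simp add: M_def)
  qed
  obtain r where r: "strict_mono r" and rl: "\<And>k. \<exists>l. (\<lambda>n. avg (u (r n)) (D (snd k)) (\<rho> (fst k))) \<longlonglongrightarrow> l"
    using bounded_diagonal_subsequence[of "\<lambda>n k. avg (u n) (D (snd k)) (\<rho> (fst k))" "\<lambda>k. M (fst k)"] avg_M by blast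
  define \<iota> where "\<iota> j x = (LEAST i. \<delta> (D i) x < \<rho> j)" for j x
  have \<iota>: "\<delta> (D (\<iota> j x)) x < \<rho> j" for j x unfolding \<iota>_def using D[OF \<rho>] by (rule LeastI_ex)
  have \<iota>_meas[measurable]: "\<iota> j \<in> measurable borel (count_space UNIV)" for j
    unfolding \<iota>_def by measurable
  define T where "T j n x = avg (u n) (D (\<iota> j x)) (\<rho> j)" for j n x
  have T_meas[measurable]: "T j n \<in> borel_measurable borel" for j n
    unfolding T_def by measurable
  have T_le: "\<bar>T j n x\<bar> \<le> M j" for j n x unfolding T_def by (rule avg_M)
  have T_lim: "\<exists>l. (\<lambda>n. T j (r n) x) \<longlonglongrightarrow> l" for j x using rl[of "(j, \<iota> j x)"] by (simp add: T_def)
  have HT_int: "integrable lborel (\<lambda>x. H x * T j n x)" for j n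
  proof (rule Bochner_Integration.integrable_bound)
    show "integrable lborel (\<lambda>x. M j * H x)" using H_int by simp
    show "AE x in lborel. norm (H x * T j n x) \<le> norm (M j * H x)"
      using T_le M H_nn by (auto simp: abs_mult mult.commute[of _ "H _"] intro!: mult_left_mono)
  qed simp
  have Hu_int: "integrable lborel (\<lambda>x. H x * u n x)" for n
  proof (rule Bochner_Integration.integrable_bound)
    show "integrable lborel (\<lambda>x. H x + \<bar>u n x\<bar> powr p)" using H_int int by simp
    show "AE x in lborel. norm (H x * u n x) \<le> norm (H x + \<bar>u n x\<bar> powr p)"
    proof (intro always_eventually allI)
      fix x
      have "H x * \<bar>u n x\<bar> \<le> H x * (1 + \<bar>u n x\<bar> powr p)"
        using powr_le_threshold[of "\<bar>u n x\<bar>" 1 1 p] p_gt_1 H_nn by (intro mult_left_mono) auto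
      also have "\<dots> \<le> H x + \<bar>u n x\<bar> powr p"
        using H_le[of x] by (simp add: algebra_simps mult_left_le_one_le H_nn)
      finally show "norm (H x * u n x) \<le> norm (H x + \<bar>u n x\<bar> powr p)" using H_nn[of x] by (simp add: abs_mult)
    qed
  qed simp
  have uT: "(\<integral>x. \<bar>H x * u n x - H x * T j n x\<bar> \<partial>lborel) \<le> \<epsilon> * I0 + \<epsilon> powr (1 - p) * (average_const * \<rho> j powr (p * s) * R)"
    if \<epsilon>: "0 < \<epsilon>" for \<epsilon> n j
  proof -
    let ?d = "\<lambda>x. \<bar>u n x - T j n x\<bar> powr p" and ?c = "average_const * \<rho> j powr (p * s)"
    have c: "0 \<le> ?c" using average_const_pos by simp
    have "(\<integral>\<^sup>+x. ennreal (?d x) \<partial>lborel) \<le> (\<integral>\<^sup>+x. ennreal ?c * gag_at (u n) x \<partial>lborel)"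
    proof (rule nn_integral_mono_AE)
      have "gag (u n) < \<infinity>" using gag_le[of n] by (simp add: le_less_trans)
      from AE_gag_at_finite[OF u this]
      show "AE x in lborel. ennreal (?d x) \<le> ennreal ?c * gag_at (u n) x"
      proof eventually_elim
        case (elim x)
        have "ennreal (?d x) \<le> ennreal (?c * enn2real (gag_at (u n) x))"
          unfolding T_def by (intro ennreal_leI avg_estimate u int \<rho> \<iota> elim)
        also have "\<dots> = ennreal ?c * gag_at (u n) x" using elim c by (simp add: ennreal_mult)
        finally show ?case .
      qed
    qed
    also have "\<dots> = ennreal ?c * gag (u n)" by (simp add: nn_integral_cmult nn_integral_gag_at)
    also have "\<dots> \<le> ennreal ?c * ennreal R" by (intro mult_left_mono gag_le) auto
    also have "\<dots> = ennreal (?c * R)" using c R by (simp add: ennreal_mult)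
    finally have nn: "(\<integral>\<^sup>+x. ennreal (?d x) \<partial>lborel) \<le> ennreal (?c * R)" .
    then have d_int: "integrable lborel ?d"
      by (subst integrable_iff_nn_integral_finite) (auto simp: le_less_trans)
    have d_le: "(\<integral>x. ?d x \<partial>lborel) \<le> ?c * R"
      using nn c R by (simp add: nn_integral_eq_integral[OF d_int])
    have "(\<integral>x. \<bar>H x * u n x - H x * T j n x\<bar> \<partial>lborel) \<le> (\<integral>x. \<epsilon> * H x + \<epsilon> powr (1 - p) * ?d x \<partial>lborel)"
    proof (rule integral_mono)
      fix x
      have "\<bar>H x * u n x - H x * T j n x\<bar> = H x * \<bar>u n x - T j n x\<bar>"
        using H_nn[of x] by (simp add: abs_mult flip: right_diff_distrib)
      also have "\<dots> \<le> H x * (\<epsilon> + \<epsilon> powr (1 - p) * ?d x)"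
        using powr_le_threshold[of "\<bar>u n x - T j n x\<bar>" \<epsilon> 1 p] p_gt_1 H_nn \<epsilon> by (intro mult_left_mono) auto
      also have "\<dots> \<le> \<epsilon> * H x + \<epsilon> powr (1 - p) * ?d x"
        using mult_right_mono[OF H_le[of x], of "\<epsilon> powr (1 - p) * ?d x"] by (simp add: algebra_simps)
      finally show "\<bar>H x * u n x - H x * T j n x\<bar> \<le> \<epsilon> * H x + \<epsilon> powr (1 - p) * ?d x" .
    qed (use Hu_int HT_int H_int d_int in auto)
    also have "\<dots> = \<epsilon> * I0 + \<epsilon> powr (1 - p) * (\<integral>x. ?d x \<partial>lborel)"
      using H_int d_int by (simp add: I0_def)
    also have "\<dots> \<le> \<epsilon> * I0 + \<epsilon> powr (1 - p) * (?c * R)"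
      using d_le by (intro add_left_mono mult_left_mono) auto
    finally show ?thesis .
  qed
  have "\<exists>N. \<forall>i\<ge>N. \<forall>k\<ge>N. (\<integral>x. norm (H x * u (r i) x - H x * u (r k) x) \<partial>lborel) < e" if e: "0 < e" for e
  proof -
    define \<epsilon> where "\<epsilon> = e / (8 * (I0 + 1))"
    have \<epsilon>: "0 < \<epsilon>" "\<epsilon> * I0 \<le> e / 8" using e I0 by (auto simp: \<epsilon>_def field_simps)
    define c where "c = \<epsilon> powr (1 - p) * (average_const * R)"
    have "(\<lambda>j. c * \<rho> j powr (p * s)) \<longlonglongrightarrow> c * 0"
    proof (intro tendsto_mult_left)
      have "(\<lambda>j. \<rho> j) \<longlonglongrightarrow> 0" unfolding \<rho>_def using LIMSEQ_inverse_real_of_nat by (simp add: inverse_eq_divide)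
      then show "(\<lambda>j. \<rho> j powr (p * s)) \<longlonglongrightarrow> 0"
        using ps_pos \<rho> by (intro tendsto_zero_powrI[where b = "p * s"]) (auto intro!: always_eventually less_imp_le)
    qed
    then have "\<forall>\<^sub>F j in sequentially. c * \<rho> j powr (p * s) < e / 8"
      using e by (intro order_tendstoD(2)) auto
    then obtain j where j: "c * \<rho> j powr (p * s) < e / 8"
      using eventually_happens'[OF sequentially_bot] by blast
    have uT': "(\<integral>x. \<bar>H x * u n x - H x * T j n x\<bar> \<partial>lborel) \<le> e / 4" for n
      using uT[OF \<epsilon>(1), of n j] j \<epsilon>(2) by (simp add: c_def mult_ac)
    obtain L where L: "\<And>x. (\<lambda>n. T j (r n) x) \<longlonglongrightarrow> L x" using T_lim[of j] by metis
    have [measurable]: "L \<in> borel_measurable borel"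
      by (rule borel_measurable_LIMSEQ_real[OF L]) simp
    have L_le: "\<bar>L x\<bar> \<le> M j" for x
      using T_le by (intro LIMSEQ_le_const2[OF tendsto_rabs[OF L]]) auto
    have HL_int: "integrable lborel (\<lambda>x. H x * L x)"
    proof (rule Bochner_Integration.integrable_bound)
      show "integrable lborel (\<lambda>x. M j * H x)" using H_int by simp
      show "AE x in lborel. norm (H x * L x) \<le> norm (M j * H x)"
        using L_le M H_nn by (auto simp: abs_mult mult.commute[of _ "H _"] intro!: mult_left_mono)
    qed simp
    have "(\<lambda>n. \<integral>x. \<bar>H x * T j (r n) x - H x * L x\<bar> \<partial>lborel) \<longlonglongrightarrow> (\<integral>x. 0 \<partial>(lborel :: 'a measure))"
    proof (rule integral_dominated_convergence)
      show "integrable lborel (\<lambda>x. 2 * M j * H x)" using H_int by simp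
      show "AE x in lborel. (\<lambda>n. \<bar>H x * T j (r n) x - H x * L x\<bar>) \<longlonglongrightarrow> 0"
      proof (intro always_eventually allI)
        fix x
        have "(\<lambda>n. \<bar>H x * T j (r n) x - H x * L x\<bar>) \<longlonglongrightarrow> \<bar>H x * L x - H x * L x\<bar>"
          by (intro tendsto_intros L)
        then show "(\<lambda>n. \<bar>H x * T j (r n) x - H x * L x\<bar>) \<longlonglongrightarrow> 0" by simp
      qed
      show "AE x in lborel. norm \<bar>H x * T j (r n) x - H x * L x\<bar> \<le> 2 * M j * H x" for n
      proof (intro always_eventually allI)
        fix x
        have "\<bar>T j (r n) x - L x\<bar> \<le> 2 * M j" using T_le[of j "r n" x] L_le[of x] by linarith
        then have "H x * \<bar>T j (r n) x - L x\<bar> \<le> H x * (2 * M j)" using H_nn by (rule mult_left_mono)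
        then show "norm \<bar>H x * T j (r n) x - H x * L x\<bar> \<le> 2 * M j * H x"
          using H_nn[of x] by (simp add: abs_mult mult.commute flip: right_diff_distrib)
      qed
    qed auto
    then have "(\<lambda>n. \<integral>x. \<bar>H x * T j (r n) x - H x * L x\<bar> \<partial>lborel) \<longlonglongrightarrow> 0" by simp
    then have "\<forall>\<^sub>F n in sequentially. (\<integral>x. \<bar>H x * T j (r n) x - H x * L x\<bar> \<partial>lborel) < e / 8"
      using e by (intro order_tendstoD(2)) auto
    then obtain N where N: "\<And>n. N \<le> n \<Longrightarrow> (\<integral>x. \<bar>H x * T j (r n) x - H x * L x\<bar> \<partial>lborel) < e / 8"
      unfolding eventually_sequentially by blast
    have "(\<integral>x. norm (H x * u (r i) x - H x * u (r k) x) \<partial>lborel) < e" if "N \<le> i" "N \<le> k" for i k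
    proof -
      let ?a = "\<lambda>n x. \<bar>H x * u (r n) x - H x * T j (r n) x\<bar>" and ?b = "\<lambda>n x. \<bar>H x * T j (r n) x - H x * L x\<bar>"
      have ai: "integrable lborel (?a n)" and bi: "integrable lborel (?b n)" for n
        using Hu_int HT_int HL_int by auto
      have "(\<integral>x. norm (H x * u (r i) x - H x * u (r k) x) \<partial>lborel)
        \<le> (\<integral>x. (?a i x + ?b i x) + (?a k x + ?b k x) \<partial>lborel)"
        using Hu_int ai bi by (intro integral_mono) auto
      also have "\<dots> = ((\<integral>x. ?a i x \<partial>lborel) + (\<integral>x. ?b i x \<partial>lborel)) + ((\<integral>x. ?a k x \<partial>lborel) + (\<integral>x. ?b k x \<partial>lborel))"
        using ai bi by (simp only: Bochner_Integration.integral_add Bochner_Integration.integrable_add)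
      also have "\<dots> < e" using uT'[of "r i"] uT'[of "r k"] N[OF that(1)] N[OF that(2)] e by linarith
      finally show ?thesis .
    qed
    then show ?thesis by blast
  qed
  then obtain r' where r': "strict_mono r'" "AE x in lborel. Cauchy (\<lambda>i. H x * u (r (r' i)) x)"
    using cauchy_L1_AE_cauchy_subseq[of lborel "\<lambda>n x. H x * u (r n) x"] Hu_int by blast
  have conv: "AE x in lborel. convergent (\<lambda>i. u (r (r' i)) x)"
    using r'(2)
  proof eventually_elim
    case (elim x)
    then have "convergent (\<lambda>i. H x * u (r (r' i)) x)" by (simp add: Cauchy_convergent_iff)
    then have "convergent (\<lambda>i. inverse (H x) * (H x * u (r (r' i)) x))"
      by (rule convergent_mult[OF convergent_const])
    then show ?case using H_pos[of x] by (simp add: mult.assoc[symmetric])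
  qed
  define v where "v x = lim (\<lambda>i. u (r (r' i)) x)" for x
  have "v \<in> borel_measurable borel" unfolding v_def by (rule borel_measurable_lim_metric) simp
  moreover have "AE x in lborel. (\<lambda>i. u ((r \<circ> r') i) x) \<longlonglongrightarrow> v x"
    using conv by eventually_elim (simp add: v_def convergent_LIMSEQ_iff)
  moreover have "strict_mono (r \<circ> r')" using r r'(1) by (rule strict_mono_o)
  ultimately show thesis by (intro that)
qed

end

section \<open>Invariance of Lebesgue measure on a stratified group\<close>

text \<open>The change of variables formulas of the library require a well-ordered index type. The
  following copy of a finite type carries such an order.\<close>

typedef 'n reindexed = "UNIV :: 'n set"
  morphisms of_reindexed to_reindexed by auto

lemma inj_of_reindexed: "inj of_reindexed"
  by (rule inj_on_inverseI[of _ to_reindexed]) (rule of_reindexed_inverse)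

lemma bij_of_reindexed: "bij of_reindexed"
  by (intro bijI inj_of_reindexed surjI[of _ to_reindexed]) (simp add: to_reindexed_inverse)

instance reindexed :: (finite) finite
proof
  show "finite (UNIV :: 'a reindexed set)"
    by (rule finite_imageD[OF finite inj_of_reindexed])
qed

instantiation reindexed :: (finite) wellorder
begin

definition "x \<le> y \<longleftrightarrow> to_nat (of_reindexed x) \<le> to_nat (of_reindexed y)"
definition "x < y \<longleftrightarrow> to_nat (of_reindexed x) < to_nat (of_reindexed y)"

instance
proof
  fix P :: "'a reindexed \<Rightarrow> bool" and a :: "'a reindexed"
  assume step: "\<And>x. (\<And>y. y < x \<Longrightarrow> P y) \<Longrightarrow> P x"
  show "P a"
  proof (induction "to_nat (of_reindexed a)" arbitrary: a rule: less_induct)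
    case less
    show ?case
      by (rule step, rule less) (simp add: less_reindexed_def)
  qed
qed (auto simp: less_eq_reindexed_def less_reindexed_def inj_of_reindexed[THEN inj_eq])

end

definition reindex :: "real^'n \<Rightarrow> real^('n reindexed)" where
  "reindex x = (\<chi> i. x $ of_reindexed i)"

definition unreindex :: "real^('n reindexed) \<Rightarrow> real^'n" where
  "unreindex y = (\<chi> i. y $ to_reindexed i)"

lemma reindex_inverse [simp]: "unreindex (reindex x) = x"
  by (simp add: reindex_def unreindex_def to_reindexed_inverse vec_eq_iff)

lemma unreindex_inverse [simp]: "reindex (unreindex y) = y"
  by (simp add: reindex_def unreindex_def of_reindexed_inverse vec_eq_iff)

lemma linear_reindex: "linear reindex"
  by (rule linearI) (auto simp: reindex_def vec_eq_iff)

lemma linear_unreindex: "linear unreindex"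
  by (rule linearI) (auto simp: unreindex_def vec_eq_iff)

lemma bounded_linear_reindex: "bounded_linear reindex" and bounded_linear_unreindex: "bounded_linear unreindex"
  using linear_reindex linear_unreindex by (auto simp: linear_conv_bounded_linear)

lemma prod_Basis_vec: "(\<Prod>b\<in>Basis. f ((x::real^'n) \<bullet> b)) = (\<Prod>i\<in>UNIV. f (x $ i))"
proof -
  have eq: "(Basis :: (real^'n) set) = (\<lambda>i. axis i 1) ` UNIV" by (auto simp: Basis_vec_def)
  show ?thesis unfolding eq
    by (subst prod.reindex) (auto simp: inj_on_def axis_eq_axis inner_axis)
qed

lemma Basis_vec_le_iff: "(\<forall>b\<in>Basis. (x::real^'n) \<bullet> b \<le> y \<bullet> b) \<longleftrightarrow> (\<forall>i. x $ i \<le> y $ i)"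
  by (auto simp: Basis_vec_def inner_axis)

lemma lborel_distr_unreindex: "distr lborel borel unreindex = (lborel :: (real^'n) measure)"
proof (rule lborel_eqI[symmetric])
  fix l u :: "real^'n" assume "\<And>b. b \<in> Basis \<Longrightarrow> l \<bullet> b \<le> u \<bullet> b"
  then have le: "l $ i \<le> u $ i" for i using Basis_vec_le_iff by blast
  have [measurable]: "unreindex \<in> borel_measurable (borel :: (real^('n reindexed)) measure)"
    by (intro borel_measurable_continuous_onI linear_continuous_on bounded_linear_unreindex)
  have "unreindex -` box l u = box (reindex l) (reindex u)"
    by (auto simp: mem_box_cart unreindex_def reindex_def) (metis of_reindexed_inverse to_reindexed_inverse UNIV_I)+
  then have "emeasure (distr lborel borel unreindex) (box l u) = emeasure lborel (box (reindex l) (reindex u))"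
    by (simp add: emeasure_distr)
  also have "\<dots> = (\<Prod>b\<in>Basis. (reindex u - reindex l) \<bullet> b)"
    using le by (intro emeasure_lborel_box) (auto simp: Basis_vec_def inner_axis reindex_def)
  also have "\<dots> = (\<Prod>i\<in>UNIV. (u - l) $ of_reindexed i)"
    using prod_Basis_vec[of "\<lambda>x. x" "reindex u - reindex l"] by (simp add: reindex_def)
  also have "\<dots> = (\<Prod>i\<in>UNIV. (u - l) $ i)"
    using prod.reindex_bij_betw[OF bij_of_reindexed, of "\<lambda>i. (u - l) $ i"] by simp
  also have "\<dots> = (\<Prod>b\<in>Basis. (u - l) \<bullet> b)"
    using prod_Basis_vec[of "\<lambda>x. x" "u - l"] by simp
  finally show "emeasure (distr lborel borel unreindex) (box l u) = ennreal (\<Prod>b\<in>Basis. (u - l) \<bullet> b)" .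
qed simp

lemma lborel_distr_unimodular_wellorder:
  fixes f g :: "real^'m::{finite,wellorder} \<Rightarrow> real^'m::_"
  assumes f: "continuous_on UNIV f"
    and g: "\<And>x. (g has_derivative g' x) (at x)" and det: "\<And>x. \<bar>det (matrix (g' x))\<bar> = 1"
    and inv: "\<And>x. f (g x) = x" "\<And>x. g (f x) = x"
  shows "distr lborel borel f = lborel"
proof (rule lborel_eqI[symmetric])
  fix l u :: "(real, 'm) vec" assume le: "\<And>b. b \<in> Basis \<Longrightarrow> l \<bullet> b \<le> u \<bullet> b"
  have [measurable]: "f \<in> borel_measurable borel" using f by (rule borel_measurable_continuous_onI)
  let ?S = "box l u"
  have fin: "emeasure lborel ?S < \<infinity>" using le by (simp add: emeasure_lborel_box_eq)
  have img: "f -` ?S = g ` ?S"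
  proof safe
    fix x assume "f x \<in> ?S"
    then show "x \<in> g ` ?S" using inv(2)[of x] by (intro image_eqI[of _ _ "f x"]) auto
  qed (simp add: inv)
  have fS: "f -` ?S \<in> sets borel" using measurable_sets[of f borel borel ?S] by simp
  have "((\<lambda>x. 1 :: real) has_integral measure lborel ?S) ?S"
    using fin by (intro has_integral_measure_lborel) auto
  then have "g ` ?S \<in> lmeasurable \<and> measure lebesgue (g ` ?S) = measure lborel ?S"
    using has_measure_differentiable_image[of ?S g g' "measure lborel ?S"] det inv
    by (auto intro: has_derivative_at_withinI[OF g] inj_on_inverseI)
  then have m: "f -` ?S \<in> lmeasurable" "measure lebesgue (f -` ?S) = measure lborel ?S"
    unfolding img by auto
  have "emeasure lborel (f -` ?S) = emeasure lebesgue (f -` ?S)" using fS by simp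
  also have "\<dots> = ennreal (measure lborel ?S)"
    using m by (metis emeasure_eq_measure2)
  also have "\<dots> = emeasure lborel ?S" using fin by (simp add: emeasure_eq_ennreal_measure less_top)
  finally have "emeasure lborel (f -` ?S) = emeasure lborel ?S" .
  then show "emeasure (distr lborel borel f) ?S = ennreal (\<Prod>b\<in>Basis. (u - l) \<bullet> b)"
    using le by (simp add: emeasure_distr emeasure_lborel_box)
qed simp

lemma lborel_distr_unimodular:
  fixes f g :: "real^'n \<Rightarrow> real^'n"
  assumes f: "continuous_on UNIV f"
    and g: "\<And>x. (g has_derivative g' x) (at x)"
    and det: "\<And>x. \<bar>det (matrix (\<lambda>v. reindex (g' x (unreindex v))))\<bar> = 1"
    and inv: "\<And>x. f (g x) = x" "\<And>x. g (f x) = x"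
  shows "distr lborel borel f = lborel"
proof -
  let ?f = "\<lambda>y. reindex (f (unreindex y))" and ?g = "\<lambda>y. reindex (g (unreindex y))"
  have cf: "continuous_on UNIV ?f"
    by (intro continuous_on_compose2[OF linear_continuous_on[OF bounded_linear_reindex]]
        continuous_on_compose2[OF f] linear_continuous_on bounded_linear_unreindex) auto
  have *: "distr lborel borel ?f = lborel"
  proof (rule lborel_distr_unimodular_wellorder[OF cf])
    show "(?g has_derivative (\<lambda>v. reindex (g' (unreindex y) (unreindex v)))) (at y)" for y
      using has_derivative_compose[OF has_derivative_compose[OF
            bounded_linear_imp_has_derivative[OF bounded_linear_unreindex] g]
          bounded_linear_imp_has_derivative[OF bounded_linear_reindex], of y UNIV] by simp
  qed (use det inv in auto)
  have [measurable]: "f \<in> borel_measurable borel" "?f \<in> borel_measurable borel"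
    using f cf by (auto intro: borel_measurable_continuous_onI)
  have [measurable]: "unreindex \<in> borel_measurable (borel :: (real^('n reindexed)) measure)"
    by (intro borel_measurable_continuous_onI linear_continuous_on bounded_linear_unreindex)
  have "distr lborel borel f = distr (distr lborel borel unreindex) borel f"
    by (simp add: lborel_distr_unreindex)
  also have "\<dots> = distr lborel borel (unreindex \<circ> ?f)"
    by (subst distr_distr) (auto simp: o_def)
  also have "\<dots> = distr (distr lborel borel ?f) borel unreindex"
    by (subst distr_distr) auto
  also have "\<dots> = lborel" by (simp only: * lborel_distr_unreindex)
  finally show ?thesis .
qed

lemma homogeneous_dim_eq_sum:
  fixes deg :: "'n::finite \<Rightarrow> nat"
  assumes "range deg = {1..k}"
  shows "homogeneous_dim k deg = (\<Sum>j\<in>UNIV. deg j)"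
proof -
  have "(\<Sum>j\<in>UNIV. deg j) = (\<Sum>i\<in>{1..k}. \<Sum>j\<in>{j\<in>UNIV. deg j = i}. deg j)"
    by (rule sum.group[symmetric]) (use assms in auto)
  also have "\<dots> = (\<Sum>i\<in>{1..k}. i * card {j. deg j = i})"
    by (intro sum.cong) auto
  finally show ?thesis by (simp add: homogeneous_dim_def)
qed

lemma dilation_dilation: "dilation deg a (dilation deg b x) = dilation deg (a * b) x"
  by (simp add: dilation_def vec_eq_iff power_mult_distrib)

lemma dilation_1 [simp]: "dilation deg 1 x = x"
  by (simp add: dilation_def vec_eq_iff)

lemma dilation_inverse:
  assumes "0 < l"
  shows "dilation deg l (dilation deg (1 / l) x) = x" "dilation deg (1 / l) (dilation deg l x) = x"
  using assms by (simp_all add: dilation_dilation)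

lemma dilation_zero [simp]: "dilation deg l 0 = 0"
  by (simp add: dilation_def vec_eq_iff)

lemma linear_dilation: "linear (dilation deg l)"
  by (rule linearI) (auto simp: dilation_def vec_eq_iff algebra_simps)

lemma bounded_linear_dilation: "bounded_linear (dilation deg l)"
  using linear_dilation by (simp add: linear_conv_bounded_linear)

lemma dilation_measurable[measurable]: "dilation deg l \<in> borel_measurable borel"
  by (intro borel_measurable_continuous_onI linear_continuous_on bounded_linear_dilation)

lemma lborel_density_dilation:
  fixes deg :: "'n::finite \<Rightarrow> nat"
  assumes l: "0 < l" and range: "range deg = {1..k}"
  shows "density (distr lborel borel (dilation deg l)) (\<lambda>_. ennreal (l ^ homogeneous_dim k deg)) = lborel"
proof (rule lborel_eqI[symmetric])
  fix a b :: "real^'n" assume "\<And>e. e \<in> Basis \<Longrightarrow> a \<bullet> e \<le> b \<bullet> e"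
  then have le: "a $ i \<le> b $ i" for i using Basis_vec_le_iff by blast
  let ?D = "dilation deg l" and ?E = "dilation deg (1 / l)"
  have lp: "0 < l ^ n" for n using l by simp
  have "?D -` box a b = box (?E a) (?E b)"
    using lp by (auto simp: mem_box_cart dilation_def power_one_over field_simps)
  then have "emeasure (distr lborel borel ?D) (box a b) = emeasure lborel (box (?E a) (?E b))"
    by (simp add: emeasure_distr)
  also have "\<dots> = (\<Prod>e\<in>Basis. (?E b - ?E a) \<bullet> e)"
    using le lp by (intro emeasure_lborel_box)
      (auto simp: Basis_vec_def inner_axis dilation_def power_one_over divide_right_mono less_imp_le)
  also have "\<dots> = (\<Prod>i\<in>UNIV. (b - a) $ i / l ^ deg i)"
    using prod_Basis_vec[of "\<lambda>x. x" "?E b - ?E a"] l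
    by (simp add: dilation_def power_one_over diff_divide_distrib)
  also have "\<dots> = (\<Prod>e\<in>Basis. (b - a) \<bullet> e) / l ^ homogeneous_dim k deg"
    using prod_Basis_vec[of "\<lambda>x. x" "b - a"]
    by (simp add: prod_dividef homogeneous_dim_eq_sum[OF range] power_sum)
  finally have "emeasure (density (distr lborel borel ?D) (\<lambda>_. ennreal (l ^ homogeneous_dim k deg))) (box a b)
      = ennreal (l ^ homogeneous_dim k deg) * ennreal ((\<Prod>e\<in>Basis. (b - a) \<bullet> e) / l ^ homogeneous_dim k deg)"
    by (simp add: emeasure_density nn_integral_cmult_indicator)
  also have "\<dots> = ennreal (\<Prod>e\<in>Basis. (b - a) \<bullet> e)"
    using l by (simp flip: ennreal_mult')
  finally show "emeasure (density (distr lborel borel ?D) (\<lambda>_. ennreal (l ^ homogeneous_dim k deg))) (box a b)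
      = ennreal (\<Prod>e\<in>Basis. (b - a) \<bullet> e)" .
qed simp

lemma nn_integral_dilation:
  fixes deg :: "'n::finite \<Rightarrow> nat"
  assumes l: "0 < l" and range: "range deg = {1..k}" and [measurable]: "f \<in> borel_measurable borel"
  shows "(\<integral>\<^sup>+x. f (dilation deg l x) \<partial>lborel) = ennreal (1 / l ^ homogeneous_dim k deg) * (\<integral>\<^sup>+x. f x \<partial>lborel)"
proof -
  let ?c = "l ^ homogeneous_dim k deg"
  have c: "0 < ?c" using l by simp
  have "(\<integral>\<^sup>+x. f x \<partial>lborel) = ennreal ?c * (\<integral>\<^sup>+x. f (dilation deg l x) \<partial>lborel)"
    by (subst lborel_density_dilation[OF l range, symmetric])
      (simp add: nn_integral_density nn_integral_distr nn_integral_cmult)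
  then have "ennreal (1 / ?c) * (\<integral>\<^sup>+x. f x \<partial>lborel) = ennreal (1 / ?c) * ennreal ?c * (\<integral>\<^sup>+x. f (dilation deg l x) \<partial>lborel)"
    by (simp add: mult.assoc)
  also have "ennreal (1 / ?c) * ennreal ?c = 1" using c l by (simp flip: ennreal_mult')
  finally show ?thesis by simp
qed

context stratified_lie_group
begin

lemma carrier_simp [simp]: "x \<in> carrier G" by (simp add: carrier_UNIV)

lemma dilation_mult: "0 < l \<Longrightarrow> dilation deg l (x \<otimes> y) = dilation deg l x \<otimes> dilation deg l y"
  using dilation_automorphism[of l] by (auto simp: iso_def hom_def carrier_UNIV)

lemma deg_pos: "1 \<le> deg j" and deg_le: "deg j \<le> k"
proof -
  have "deg j \<in> {1..k}" unfolding strata[symmetric] by (rule rangeI)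
  then show "1 \<le> deg j" "deg j \<le> k" by auto
qed

lemma one_eq_zero: "\<one> = 0"
proof -
  let ?D = "dilation deg (1 / 2)"
  have "?D \<one> \<otimes> \<one> = ?D \<one> \<otimes> ?D \<one>"
    using dilation_mult[of "1 / 2" \<one> \<one>] by simp
  then have "?D \<one> = \<one>" by simp
  then have "(1 / 2) ^ deg j * \<one> $ j = \<one> $ j" for j by (simp add: dilation_def vec_eq_iff)
  moreover have "(1 / 2 :: real) ^ deg j \<noteq> 1" for j
    using deg_pos[of j] power_strict_decreasing[of 0 "deg j" "1 / 2 :: real"] by simp
  ultimately have "\<one> $ j = 0" for j by (metis mult_cancel_right1 mult.commute)
  then show ?thesis by (simp add: vec_eq_iff)
qed

lemma mult_zero [simp]: "0 \<otimes> x = x" "x \<otimes> 0 = x"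
  using l_one[of x] r_one[of x] by (simp_all add: one_eq_zero)

lemma smooth_left_mult: "smooth (\<lambda>x. z \<otimes> x)"
proof -
  have "smooth (\<lambda>x. (\<lambda>(x, y). x \<otimes> y) (z, x))"
    by (rule smooth_compose[OF smooth_mult])
      (intro smooth_Pair smooth_const smooth_bounded_linear bounded_linear_ident)
  then show ?thesis by simp
qed

definition mult_deriv :: "(real^'n) \<times> (real^'n) \<Rightarrow> real^'n \<Rightarrow> real^'n" where
  "mult_deriv w v = frechet_derivative (\<lambda>(x, y). x \<otimes> y) (at w) (0, v)"

lemma left_mult_has_derivative: "((\<lambda>y. z \<otimes> y) has_derivative mult_deriv (z, y)) (at y)"
proof -
  have "((\<lambda>y. (z, y)) has_derivative (\<lambda>v. (0, v))) (at y)"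
    by (intro has_derivative_Pair has_derivative_const has_derivative_ident)
  from has_derivative_compose[OF this smooth_has_derivative[OF smooth_mult]]
  show ?thesis unfolding mult_deriv_def by simp
qed

definition jacobian_det :: "(real^'n) \<times> (real^'n) \<Rightarrow> real" where
  "jacobian_det w = det (matrix (\<lambda>v. reindex (mult_deriv w (unreindex v))))"

lemma continuous_jacobian_det: "continuous_on UNIV jacobian_det"
proof -
  have "continuous_on UNIV (\<lambda>w. reindex (mult_deriv w (unreindex (axis j 1))) $ i)" for i j
    unfolding mult_deriv_def
    by (intro continuous_intros continuous_on_compose2[OF linear_continuous_on[OF bounded_linear_reindex]]
        smooth_continuous_derivative smooth_mult) auto
  then show ?thesis
    unfolding jacobian_det_def det_def matrix_def vec_lambda_beta
    by (intro continuous_on_sum continuous_on_mult continuous_on_const continuous_on_prod)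
qed

text \<open>Dilations being automorphisms, the Jacobian of a left translation is invariant under dilating
  both the translation and the point; letting the dilation factor tend to \<open>0\<close> it equals the
  Jacobian of the identity.\<close>

lemma jacobian_det_dilation:
  assumes l: "0 < l"
  shows "jacobian_det (dilation deg l z, dilation deg l y) = jacobian_det (z, y)"
proof -
  let ?D = "dilation deg l" and ?E = "dilation deg (1 / l)"
  let ?M = "\<lambda>w v. reindex (mult_deriv w (unreindex v))"
  let ?D' = "\<lambda>v. reindex (?D (unreindex v))" and ?E' = "\<lambda>v. reindex (?E (unreindex v))"
  have bD: "(?D has_derivative ?D) (at x)" for x
    by (intro bounded_linear_imp_has_derivative bounded_linear_dilation)
  have "((\<lambda>y. ?D (z \<otimes> y)) has_derivative (\<lambda>v. ?D (mult_deriv (z, y) v))) (at y)"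
    by (rule has_derivative_compose[OF left_mult_has_derivative bD])
  moreover have "((\<lambda>y. ?D z \<otimes> ?D y) has_derivative (\<lambda>v. mult_deriv (?D z, ?D y) (?D v))) (at y)"
    by (rule has_derivative_compose[OF bD left_mult_has_derivative])
  ultimately have eq: "?D (mult_deriv (z, y) v) = mult_deriv (?D z, ?D y) (?D v)" for v
    unfolding dilation_mult[OF l] by (metis has_derivative_unique)
  have lin: "linear (?M w)" for w
  proof -
    have "linear (mult_deriv w)" using left_mult_has_derivative[of "fst w" "snd w"] by (simp add: has_derivative_linear)
    then show ?thesis
      using linear_compose[OF linear_compose[OF linear_unreindex _] linear_reindex] by (simp add: o_def)
  qed
  have linD: "linear ?D'" "linear ?E'"
    using linear_compose[OF linear_compose[OF linear_unreindex linear_dilation] linear_reindex]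
    by (auto simp: o_def)
  have "?D' \<circ> ?M (z, y) = ?M (?D z, ?D y) \<circ> ?D'" by (simp add: fun_eq_iff eq)
  then have "matrix ?D' ** matrix (?M (z, y)) = matrix (?M (?D z, ?D y)) ** matrix ?D'"
    using matrix_compose[OF lin linD(1)] matrix_compose[OF linD(1) lin] by metis
  then have 1: "det (matrix ?D') * jacobian_det (z, y) = jacobian_det (?D z, ?D y) * det (matrix ?D')"
    unfolding jacobian_det_def by (metis det_mul)
  have "?D' \<circ> ?E' = id" by (simp add: fun_eq_iff dilation_inverse[OF l])
  then have "matrix ?D' ** matrix ?E' = mat 1"
    using matrix_compose[OF linD(2) linD(1)] matrix_id_mat_1 by metis
  then have "det (matrix ?D') * det (matrix ?E') = 1" by (metis det_mul det_I)
  then have "det (matrix ?D') \<noteq> 0" by auto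
  with 1 show ?thesis by simp
qed

lemma jacobian_det_eq_1: "jacobian_det w = 1"
proof -
  define r where "r n = 1 / real (Suc n)" for n
  have r: "0 < r n" for n by (simp add: r_def)
  have r0: "r \<longlonglongrightarrow> 0" unfolding r_def using LIMSEQ_inverse_real_of_nat by (simp add: inverse_eq_divide)
  have D0: "(\<lambda>n. dilation deg (r n) x) \<longlonglongrightarrow> 0" for x :: "real^'n"
  proof (rule vec_tendstoI)
    fix i
    have "(\<lambda>n. r n ^ deg i * x $ i) \<longlonglongrightarrow> 0 ^ deg i * x $ i" by (intro tendsto_intros r0)
    then show "(\<lambda>n. dilation deg (r n) x $ i) \<longlonglongrightarrow> 0 $ i"
      using deg_pos[of i] by (simp add: dilation_def power_0_left)
  qed
  have "(\<lambda>n. jacobian_det (dilation deg (r n) (fst w), dilation deg (r n) (snd w))) \<longlonglongrightarrow> jacobian_det (0, 0)"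
    by (rule continuous_on_tendsto_compose[OF continuous_jacobian_det]) (auto intro!: tendsto_Pair D0)
  then have "(\<lambda>n. jacobian_det w) \<longlonglongrightarrow> jacobian_det (0, 0)"
    by (simp add: jacobian_det_dilation[OF r])
  then have "jacobian_det w = jacobian_det (0, 0)" using LIMSEQ_unique tendsto_const by blast
  moreover have "mult_deriv (0, 0) = id"
    using left_mult_has_derivative[of 0 0] has_derivative_unique[OF _ has_derivative_id] by (simp add: id_def)
  then have "jacobian_det (0, 0) = 1"
    by (simp add: jacobian_det_def matrix_id_mat_1[unfolded id_def])
  ultimately show ?thesis by simp
qed

lemma left_mult_continuous: "continuous_on UNIV (\<lambda>x. z \<otimes> x)"
  by (rule smooth_imp_continuous[OF smooth_left_mult])

lemma left_mult_inverse: "inv z \<otimes> (z \<otimes> x) = x" "z \<otimes> (inv z \<otimes> x) = x"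
proof -
  have "inv z \<otimes> (z \<otimes> x) = (inv z \<otimes> z) \<otimes> x" "z \<otimes> (inv z \<otimes> x) = (z \<otimes> inv z) \<otimes> x"
    by (simp_all only: m_assoc[OF carrier_simp carrier_simp carrier_simp])
  then show "inv z \<otimes> (z \<otimes> x) = x" "z \<otimes> (inv z \<otimes> x) = x"
    by (simp_all add: one_eq_zero)
qed

lemma left_mult_measurable[measurable]: "(\<lambda>x. z \<otimes> x) \<in> borel_measurable borel"
  by (rule borel_measurable_continuous_onI[OF left_mult_continuous])

lemma lborel_distr_left_mult: "distr lborel borel (\<lambda>x. z \<otimes> x) = lborel"
proof (rule lborel_distr_unimodular[OF left_mult_continuous left_mult_has_derivative])
  show "\<bar>det (matrix (\<lambda>v. reindex (mult_deriv (inv z, x) (unreindex v))))\<bar> = 1" for x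
    using jacobian_det_eq_1[of "(inv z, x)"] by (simp add: jacobian_det_def)
qed (simp_all add: left_mult_inverse)

lemma nn_integral_left_mult:
  assumes [measurable]: "f \<in> borel_measurable borel"
  shows "(\<integral>\<^sup>+x. f (z \<otimes> x) \<partial>lborel) = (\<integral>\<^sup>+x. f x \<partial>lborel)"
proof -
  have "(\<integral>\<^sup>+x. f x \<partial>lborel) = (\<integral>\<^sup>+x. f x \<partial>distr lborel borel (\<lambda>x. z \<otimes> x))"
    by (simp only: lborel_distr_left_mult)
  then show ?thesis by (simp add: nn_integral_distr)
qed

end

section \<open>The Gagliardo seminorm\<close>

context ahlfors_kernel
begin

definition kmeas :: "('a \<times> 'a) measure" where
  "kmeas = density (lborel \<Otimes>\<^sub>M lborel) (\<lambda>z. ennreal (1 / \<delta> (fst z) (snd z) powr (Q + p * s)))"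

definition incr :: "('a \<Rightarrow> real) \<Rightarrow> 'a \<times> 'a \<Rightarrow> real" where
  "incr u z = u (fst z) - u (snd z)"

lemma sets_kmeas [measurable_cong]: "sets kmeas = sets (borel \<Otimes>\<^sub>M borel)"
  by (simp add: kmeas_def cong: sets_pair_measure_cong)

lemma incr_measurable[measurable]:
  assumes [measurable]: "u \<in> borel_measurable borel"
  shows "incr u \<in> borel_measurable kmeas"
  unfolding incr_def by measurable

lemma nn_integral_kmeas:
  assumes [measurable]: "f \<in> borel_measurable (borel \<Otimes>\<^sub>M borel)" and "\<And>z. 0 \<le> f z"
  shows "(\<integral>\<^sup>+z. ennreal (f z) \<partial>kmeas)
    = (\<integral>\<^sup>+z. ennreal (f z / \<delta> (fst z) (snd z) powr (Q + p * s)) \<partial>(lborel \<Otimes>\<^sub>M lborel))"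
  unfolding kmeas_def using assms(2)
  by (subst nn_integral_density) (auto intro!: nn_integral_cong simp flip: ennreal_mult)

lemma integral_kmeas:
  fixes f :: "'a \<times> 'a \<Rightarrow> real"
  assumes [measurable]: "f \<in> borel_measurable (borel \<Otimes>\<^sub>M borel)"
  shows "(\<integral>z. f z \<partial>kmeas) = (\<integral>z. f z / \<delta> (fst z) (snd z) powr (Q + p * s) \<partial>(lborel \<Otimes>\<^sub>M lborel))"
  unfolding kmeas_def by (subst integral_density) auto

lemma gag_eq_kmeas:
  assumes [measurable]: "u \<in> borel_measurable borel"
  shows "gag u = (\<integral>\<^sup>+z. ennreal (\<bar>incr u z\<bar> powr p) \<partial>kmeas)"
  by (subst nn_integral_kmeas) (auto simp: gag_def incr_def case_prod_unfold)

lemma snorm_add_le: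
  assumes [measurable]: "u \<in> borel_measurable borel" "v \<in> borel_measurable borel"
  shows "snorm (\<lambda>x. u x + v x) \<le> ennreal (2 powr p) * (snorm u + snorm v)"
proof -
  have "snorm (\<lambda>x. u x + v x) = (\<integral>\<^sup>+x. ennreal (\<bar>u x + v x\<bar> powr p) \<partial>lborel)
      + (\<integral>\<^sup>+z. ennreal (\<bar>incr u z + incr v z\<bar> powr p) \<partial>kmeas)"
    unfolding snorm_def by (subst gag_eq_kmeas) (auto simp: incr_def algebra_simps)
  also have "\<dots> \<le> ennreal (2 powr p) * ((\<integral>\<^sup>+x. ennreal (\<bar>u x\<bar> powr p) \<partial>lborel) + (\<integral>\<^sup>+x. ennreal (\<bar>v x\<bar> powr p) \<partial>lborel))
      + ennreal (2 powr p) * ((\<integral>\<^sup>+z. ennreal (\<bar>incr u z\<bar> powr p) \<partial>kmeas) + (\<integral>\<^sup>+z. ennreal (\<bar>incr v z\<bar> powr p) \<partial>kmeas))"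
    using p_pos by (intro add_mono nn_integral_powr_add_le) auto
  also have "\<dots> = ennreal (2 powr p) * (snorm u + snorm v)"
    unfolding snorm_def by (simp add: gag_eq_kmeas algebra_simps)
  finally show ?thesis .
qed

lemma snorm_cmult:
  assumes [measurable]: "u \<in> borel_measurable borel"
  shows "snorm (\<lambda>x. c * u x) = ennreal (\<bar>c\<bar> powr p) * snorm u"
proof -
  have inc: "incr (\<lambda>x. c * u x) z = c * incr u z" for z by (simp add: incr_def algebra_simps)
  show ?thesis unfolding snorm_def
    by (simp add: gag_eq_kmeas inc abs_mult powr_mult ennreal_mult nn_integral_cmult distrib_left)
qed

lemma snorm_zero: "snorm (\<lambda>x. 0) = 0"
  using snorm_cmult[of "\<lambda>x. 0" 0] by simp

lemma uniform_convexity: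
  assumes \<epsilon>: "0 < \<epsilon>"
  obtains C where "0 \<le> C" "\<And>u v. u \<in> borel_measurable borel \<Longrightarrow> v \<in> borel_measurable borel \<Longrightarrow>
    snorm (\<lambda>x. u x - v x) + ennreal C * snorm (\<lambda>x. (u x + v x) / 2) \<le> ennreal (\<epsilon> + C / 2) * (snorm u + snorm v)"
proof -
  obtain C where C: "0 \<le> C"
    "\<And>a b. \<bar>a - b\<bar> powr p + C * \<bar>(a + b) / 2\<bar> powr p \<le> (\<epsilon> + C / 2) * (\<bar>a\<bar> powr p + \<bar>b\<bar> powr p)"
    using uniform_convexity_pointwise[OF p_gt_1 \<epsilon>] by blast
  have gen: "(\<integral>\<^sup>+x. ennreal (\<bar>f x - g x\<bar> powr p) \<partial>M) + ennreal C * (\<integral>\<^sup>+x. ennreal (\<bar>(f x + g x) / 2\<bar> powr p) \<partial>M)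
      \<le> ennreal (\<epsilon> + C / 2) * ((\<integral>\<^sup>+x. ennreal (\<bar>f x\<bar> powr p) \<partial>M) + (\<integral>\<^sup>+x. ennreal (\<bar>g x\<bar> powr p) \<partial>M))"
    if [measurable]: "f \<in> borel_measurable M" "g \<in> borel_measurable M" for f g :: "'b \<Rightarrow> real" and M
  proof -
    have "(\<integral>\<^sup>+x. ennreal (\<bar>f x - g x\<bar> powr p) \<partial>M) + ennreal C * (\<integral>\<^sup>+x. ennreal (\<bar>(f x + g x) / 2\<bar> powr p) \<partial>M)
        = (\<integral>\<^sup>+x. ennreal (\<bar>f x - g x\<bar> powr p) + ennreal C * ennreal (\<bar>(f x + g x) / 2\<bar> powr p) \<partial>M)"
      by (simp add: nn_integral_add nn_integral_cmult)
    also have "\<dots> \<le> (\<integral>\<^sup>+x. ennreal (\<epsilon> + C / 2) * (ennreal (\<bar>f x\<bar> powr p) + ennreal (\<bar>g x\<bar> powr p)) \<partial>M)"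
    proof (intro nn_integral_mono)
      fix x
      have "ennreal (\<bar>f x - g x\<bar> powr p + C * \<bar>(f x + g x) / 2\<bar> powr p)
          \<le> ennreal ((\<epsilon> + C / 2) * (\<bar>f x\<bar> powr p + \<bar>g x\<bar> powr p))"
        by (intro ennreal_leI C)
      then show "ennreal (\<bar>f x - g x\<bar> powr p) + ennreal C * ennreal (\<bar>(f x + g x) / 2\<bar> powr p)
          \<le> ennreal (\<epsilon> + C / 2) * (ennreal (\<bar>f x\<bar> powr p) + ennreal (\<bar>g x\<bar> powr p))"
        using C(1) \<epsilon> by (simp only: ennreal_plus ennreal_mult powr_ge_zero mult_nonneg_nonneg add_nonneg_nonneg
            divide_nonneg_nonneg less_imp_le zero_le_numeral)
    qed
    also have "\<dots> = ennreal (\<epsilon> + C / 2) * ((\<integral>\<^sup>+x. ennreal (\<bar>f x\<bar> powr p) \<partial>M) + (\<integral>\<^sup>+x. ennreal (\<bar>g x\<bar> powr p) \<partial>M))"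
      by (simp add: nn_integral_add nn_integral_cmult)
    finally show ?thesis .
  qed
  have "snorm (\<lambda>x. u x - v x) + ennreal C * snorm (\<lambda>x. (u x + v x) / 2) \<le> ennreal (\<epsilon> + C / 2) * (snorm u + snorm v)"
    if [measurable]: "u \<in> borel_measurable borel" "v \<in> borel_measurable borel" for u v
  proof -
    have inc: "incr (\<lambda>x. u x - v x) z = incr u z - incr v z"
      "incr (\<lambda>x. (u x + v x) / 2) z = (incr u z + incr v z) / 2" for z
      by (simp_all add: incr_def field_simps)
    have g: "gag (\<lambda>x. u x - v x) = (\<integral>\<^sup>+z. ennreal (\<bar>incr u z - incr v z\<bar> powr p) \<partial>kmeas)"
      "gag (\<lambda>x. (u x + v x) / 2) = (\<integral>\<^sup>+z. ennreal (\<bar>(incr u z + incr v z) / 2\<bar> powr p) \<partial>kmeas)"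
      by (simp_all only: gag_eq_kmeas inc borel_measurable_diff borel_measurable_add borel_measurable_divide
          borel_measurable_const that)
    have "snorm (\<lambda>x. u x - v x) + ennreal C * snorm (\<lambda>x. (u x + v x) / 2)
      = ((\<integral>\<^sup>+x. ennreal (\<bar>u x - v x\<bar> powr p) \<partial>lborel) + ennreal C * (\<integral>\<^sup>+x. ennreal (\<bar>(u x + v x) / 2\<bar> powr p) \<partial>lborel))
      + ((\<integral>\<^sup>+z. ennreal (\<bar>incr u z - incr v z\<bar> powr p) \<partial>kmeas)
        + ennreal C * (\<integral>\<^sup>+z. ennreal (\<bar>(incr u z + incr v z) / 2\<bar> powr p) \<partial>kmeas))"
      unfolding snorm_def g distrib_left by (simp only: add_ac)
    also have "\<dots> \<le> ennreal (\<epsilon> + C / 2) * ((\<integral>\<^sup>+x. ennreal (\<bar>u x\<bar> powr p) \<partial>lborel) + (\<integral>\<^sup>+x. ennreal (\<bar>v x\<bar> powr p) \<partial>lborel))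
      + ennreal (\<epsilon> + C / 2) * ((\<integral>\<^sup>+z. ennreal (\<bar>incr u z\<bar> powr p) \<partial>kmeas) + (\<integral>\<^sup>+z. ennreal (\<bar>incr v z\<bar> powr p) \<partial>kmeas))"
      by (intro add_mono gen) auto
    also have "\<dots> = ennreal (\<epsilon> + C / 2) * (snorm u + snorm v)"
      unfolding snorm_def gag_eq_kmeas[OF that(1)] gag_eq_kmeas[OF that(2)] distrib_left by (simp only: add_ac)
    finally show ?thesis .
  qed
  with C(1) show thesis by (rule that)
qed

lemma ennreal_le_suminf: "f j \<le> (\<Sum>j. f j :: ennreal)"
  using sum_le_suminf[of f "{j}"] by simp

lemma dyadic_bounds:
  fixes t :: real
  assumes "0 < t" "t < 1"
  obtains j :: nat where "(1 / 2) ^ Suc j \<le> t" "t < (1 / 2) ^ j"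
proof -
  have "\<exists>n. (1 / 2) ^ n \<le> t"
    using real_arch_pow_inv[of t "1 / 2"] assms by (auto intro: less_imp_le)
  define n where "n = (LEAST n. (1 / 2) ^ n \<le> t)"
  have n: "(1 / 2) ^ n \<le> t" unfolding n_def by (rule LeastI_ex) fact
  then have "n \<noteq> 0" using assms by (intro notI) simp
  then obtain j where j: "n = Suc j" using not0_implies_Suc by blast
  have "\<not> (1 / 2) ^ j \<le> t" using not_less_Least[of j "\<lambda>n. (1 / 2) ^ n \<le> t"] j by (simp add: n_def)
  with n j show thesis by (intro that[of j]) auto
qed

lemma ennreal_geometric:
  assumes "0 \<le> c" "0 < a"
  shows "(\<Sum>j. ennreal (c * (1 / 2) powr (a * real j))) < \<infinity>"
proof -
  have "summable (\<lambda>j. c * ((1 / 2) powr a) ^ j)"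
    using assms powr_less_mono'[of "1/2" 0 a] by (intro summable_mult summable_geometric) auto
  then have "summable (\<lambda>j. c * (1 / 2) powr (a * real j))"
    by (simp add: powr_powr[symmetric] powr_realpow)
  then show ?thesis using assms by (subst suminf_ennreal2) auto
qed

lemma nn_integral_inner:
  assumes a: "0 < a"
  obtains B where "B < \<infinity>" "\<And>x. (\<integral>\<^sup>+y. ennreal (if \<delta> x y < 1 then \<delta> x y powr (a - Q) else 0) \<partial>lborel) \<le> B"
proof -
  let ?t = "\<lambda>j::nat. 2 powr Q * (1 / 2) powr (a * real j) * 2 powr (Q * real j)"
  let ?B = "\<Sum>j. ennreal (2 powr Q * c0 * (1 / 2) powr (a * real j))"
  have "(\<integral>\<^sup>+y. ennreal (if \<delta> x y < 1 then \<delta> x y powr (a - Q) else 0) \<partial>lborel) \<le> ?B" for x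
  proof -
    let ?S = "\<lambda>j. {y. \<delta> x y < (1 / 2) ^ j}"
    have [measurable]: "?S j \<in> sets borel" for j using open_kernel_ball by simp
    have "(\<integral>\<^sup>+y. ennreal (if \<delta> x y < 1 then \<delta> x y powr (a - Q) else 0) \<partial>lborel)
        \<le> (\<integral>\<^sup>+y. (\<Sum>j. ennreal (?t j) * indicator (?S j) y) \<partial>lborel)"
    proof (intro nn_integral_mono)
      fix y
      show "ennreal (if \<delta> x y < 1 then \<delta> x y powr (a - Q) else 0) \<le> (\<Sum>j. ennreal (?t j) * indicator (?S j) y)"
      proof (cases "0 < \<delta> x y \<and> \<delta> x y < 1")
        case True
        then obtain j where j: "(1 / 2) ^ Suc j \<le> \<delta> x y" "\<delta> x y < (1 / 2) ^ j" using dyadic_bounds by blast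
        have "\<delta> x y powr (a - Q) = \<delta> x y powr a * \<delta> x y powr (- Q)"
          by (simp flip: powr_add)
        also have "\<dots> \<le> ((1 / 2) ^ j) powr a * ((1 / 2) ^ Suc j) powr (- Q)"
          using True j a Q_pos by (intro mult_mono powr_mono2 powr_mono2') auto
        also have "((1 / 2 :: real) ^ j) powr a = (1 / 2) powr (a * real j)"
          by (simp add: powr_powr mult.commute flip: powr_realpow)
        also have "((1 / 2 :: real) ^ Suc j) powr (- Q) = 2 powr (Q * real (Suc j))"
        proof -
          have "(1 / 2 :: real) ^ Suc j = 2 powr (- real (Suc j))"
            by (simp add: powr_minus powr_realpow power_one_over inverse_eq_divide del: of_nat_Suc power_Suc)
          then show ?thesis by (simp only: powr_powr minus_mult_minus mult.commute)
        qed
        also have "2 powr (Q * real (Suc j)) = 2 powr Q * 2 powr (Q * real j)"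
          by (simp add: algebra_simps flip: powr_add)
        finally have "ennreal (\<delta> x y powr (a - Q)) \<le> ennreal (?t j) * indicator (?S j) y"
          using j by (simp add: ennreal_leI mult_ac)
        also have "\<dots> \<le> (\<Sum>j. ennreal (?t j) * indicator (?S j) y)"
          by (rule ennreal_le_suminf[of "\<lambda>j. ennreal (?t j) * indicator (?S j) y"])
        finally show ?thesis using True by simp
      next
        case False
        then have "(if \<delta> x y < 1 then \<delta> x y powr (a - Q) else 0) = 0"
          using \<delta>_nonneg[of x y] by (cases "\<delta> x y = 0") auto
        then show ?thesis by (simp only: ennreal_0 zero_le)
      qed
    qed
    also have "\<dots> = (\<Sum>j. \<integral>\<^sup>+y. ennreal (?t j) * indicator (?S j) y \<partial>lborel)"
      by (rule nn_integral_suminf) measurable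
    also have "\<dots> = (\<Sum>j. ennreal (?t j) * emeasure lborel (?S j))"
      by (intro suminf_cong nn_integral_cmult_indicator) measurable
    also have "\<dots> = ?B"
    proof (intro suminf_cong)
      fix j :: nat
      have "((1 / 2 :: real) ^ j) powr Q = 1 / 2 powr (Q * real j)"
      proof -
        have "((1 / 2 :: real) ^ j) = 2 powr (- real j)"
          by (simp add: powr_minus powr_realpow power_one_over inverse_eq_divide)
        moreover have "- real j * Q = - (Q * real j)" by simp
        ultimately have "((1 / 2 :: real) ^ j) powr Q = 2 powr (- (Q * real j))"
          by (simp only: powr_powr)
        then show ?thesis by (simp only: powr_minus_divide)
      qed
      then show "ennreal (?t j) * emeasure lborel (?S j) = ennreal (2 powr Q * c0 * (1 / 2) powr (a * real j))"
        using c0_pos by (simp add: emeasure_ball flip: ennreal_mult)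
    qed
    finally show ?thesis .
  qed
  moreover have "?B < \<infinity>" using a c0_pos by (intro ennreal_geometric) auto
  ultimately show thesis by (rule that[rotated])
qed

lemma nn_integral_outer:
  assumes a: "0 < a"
  obtains B where "B < \<infinity>" "\<And>x. (\<integral>\<^sup>+y. ennreal (if 1 \<le> \<delta> x y then \<delta> x y powr (- (Q + a)) else 0) \<partial>lborel) \<le> B"
proof -
  let ?t = "\<lambda>j::nat. (1 / 2) powr (a * real j) / 2 powr (Q * real j)"
  let ?B = "\<Sum>j. ennreal (2 powr Q * c0 * (1 / 2) powr (a * real j))"
  have "(\<integral>\<^sup>+y. ennreal (if 1 \<le> \<delta> x y then \<delta> x y powr (- (Q + a)) else 0) \<partial>lborel) \<le> ?B" for x
  proof -
    let ?S = "\<lambda>j. {y. \<delta> x y < 2 ^ Suc j}"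
    have [measurable]: "?S j \<in> sets borel" for j using open_kernel_ball by simp
    have "(\<integral>\<^sup>+y. ennreal (if 1 \<le> \<delta> x y then \<delta> x y powr (- (Q + a)) else 0) \<partial>lborel)
        \<le> (\<integral>\<^sup>+y. (\<Sum>j. ennreal (?t j) * indicator (?S j) y) \<partial>lborel)"
    proof (intro nn_integral_mono)
      fix y
      show "ennreal (if 1 \<le> \<delta> x y then \<delta> x y powr (- (Q + a)) else 0) \<le> (\<Sum>j. ennreal (?t j) * indicator (?S j) y)"
      proof (cases "1 \<le> \<delta> x y")
        case True
        then have "1 / (\<delta> x y * 2) < 1" "0 < 1 / (\<delta> x y * 2)" by (auto simp: field_simps)
        then obtain i where i: "(1 / 2) ^ Suc i \<le> 1 / (\<delta> x y * 2)" "1 / (\<delta> x y * 2) < (1 / 2) ^ i"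
          using dyadic_bounds by blast
        have i1: "\<delta> x y \<le> 2 ^ i" "2 ^ i < \<delta> x y * 2"
          using i True by (auto simp: field_simps power_one_over)
        have j: "2 ^ (i - 1) \<le> \<delta> x y" "\<delta> x y < 2 ^ Suc i" using i1 True by (cases i; simp)+
        have j': "\<delta> x y < 2 ^ Suc (i - 1) \<or> \<delta> x y = 2 ^ i" using i1 by (cases i) auto
        obtain j where jj: "2 ^ j \<le> \<delta> x y" "\<delta> x y < 2 ^ Suc j"
        proof (cases "\<delta> x y = 2 ^ i")
          case True
          then show thesis by (intro that[of i]) auto
        next
          case False
          then show thesis using j j' by (intro that[of "i - 1"]) auto
        qed
        have "\<delta> x y powr (- (Q + a)) \<le> (2 ^ j) powr (- (Q + a))"
          using jj a Q_pos by (intro powr_mono2') auto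
        also have "\<dots> = ?t j"
        proof -
          have "(2 :: real) ^ j = 2 powr real j" by (simp add: powr_realpow)
          moreover have "(1 / 2 :: real) powr (a * real j) = 2 powr (- (a * real j))"
            by (simp add: powr_divide powr_minus_divide)
          moreover have "real j * (- (Q + a)) = - (a * real j) - Q * real j" by (simp add: algebra_simps)
          ultimately show ?thesis by (simp only: powr_powr powr_diff)
        qed
        finally have "ennreal (\<delta> x y powr (- (Q + a))) \<le> ennreal (?t j) * indicator (?S j) y"
          using jj by (simp add: ennreal_leI)
        also have "\<dots> \<le> (\<Sum>j. ennreal (?t j) * indicator (?S j) y)"
          by (rule ennreal_le_suminf[of "\<lambda>j. ennreal (?t j) * indicator (?S j) y"])
        finally show ?thesis using True by simp
      qed simp
    qed
    also have "\<dots> = (\<Sum>j. \<integral>\<^sup>+y. ennreal (?t j) * indicator (?S j) y \<partial>lborel)"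
      by (rule nn_integral_suminf) measurable
    also have "\<dots> = (\<Sum>j. ennreal (?t j) * emeasure lborel (?S j))"
      by (intro suminf_cong nn_integral_cmult_indicator) measurable
    also have "\<dots> = ?B"
    proof (intro suminf_cong)
      fix j :: nat
      have "((2 :: real) ^ Suc j) powr Q = 2 powr Q * 2 powr (Q * real j)"
        by (simp add: powr_powr algebra_simps powr_mult flip: powr_realpow)
      then have "emeasure lborel (?S j) = ennreal (c0 * (2 powr Q * 2 powr (Q * real j)))"
        by (subst emeasure_ball) auto
      then show "ennreal (?t j) * emeasure lborel (?S j) = ennreal (2 powr Q * c0 * (1 / 2) powr (a * real j))"
        using c0_pos by (simp flip: ennreal_mult)
    qed
    finally show ?thesis .
  qed
  moreover have "?B < \<infinity>" using a c0_pos by (intro ennreal_geometric) auto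
  ultimately show thesis by (rule that[rotated])
qed

lemma gag_finite_of_lipschitz:
  assumes \<phi>[measurable]: "\<phi> \<in> borel_measurable borel" and \<phi>1: "\<And>x. \<bar>\<phi> x\<bar> \<le> 1"
    and S[measurable]: "S \<in> sets borel" and fin: "emeasure lborel S < \<infinity>" and supp: "\<And>x. x \<notin> S \<Longrightarrow> \<phi> x = 0"
    and lip: "\<And>x y. x \<in> S \<Longrightarrow> \<delta> x y < 1 \<Longrightarrow> \<bar>\<phi> x - \<phi> y\<bar> \<le> L * \<delta> x y" and L: "0 \<le> L" and s1: "s < 1"
  shows "gag \<phi> < \<infinity>"
proof -
  have a: "0 < p * (1 - s)" using p_pos s1 by simp
  obtain B1 where B1: "B1 < \<infinity>"
    "\<And>x. (\<integral>\<^sup>+y. ennreal (if \<delta> x y < 1 then \<delta> x y powr (p * (1 - s) - Q) else 0) \<partial>lborel) \<le> B1"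
    using nn_integral_inner[OF a] by blast
  obtain B2 where B2: "B2 < \<infinity>"
    "\<And>x. (\<integral>\<^sup>+y. ennreal (if 1 \<le> \<delta> x y then \<delta> x y powr (- (Q + p * s)) else 0) \<partial>lborel) \<le> B2"
    using nn_integral_outer[OF ps_pos] by blast
  let ?f = "\<lambda>x y. ennreal (\<bar>\<phi> x - \<phi> y\<bar> powr p / \<delta> x y powr (Q + p * s))"
  have le: "gag_at \<phi> x \<le> ennreal (L powr p) * B1 + ennreal (2 powr p) * B2" if x: "x \<in> S" for x
  proof -
    have "gag_at \<phi> x \<le> (\<integral>\<^sup>+y. ennreal (L powr p) * ennreal (if \<delta> x y < 1 then \<delta> x y powr (p * (1 - s) - Q) else 0)
        + ennreal (2 powr p) * ennreal (if 1 \<le> \<delta> x y then \<delta> x y powr (- (Q + p * s)) else 0) \<partial>lborel)"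
      unfolding gag_at_def
    proof (intro nn_integral_mono)
      fix y
      show "?f x y \<le> ennreal (L powr p) * ennreal (if \<delta> x y < 1 then \<delta> x y powr (p * (1 - s) - Q) else 0)
        + ennreal (2 powr p) * ennreal (if 1 \<le> \<delta> x y then \<delta> x y powr (- (Q + p * s)) else 0)"
      proof (cases "\<delta> x y < 1")
        case True
        have "\<bar>\<phi> x - \<phi> y\<bar> powr p \<le> (L * \<delta> x y) powr p"
          using lip[OF x True] p_pos by (intro powr_mono2) auto
        then have "\<bar>\<phi> x - \<phi> y\<bar> powr p / \<delta> x y powr (Q + p * s) \<le> (L * \<delta> x y) powr p / \<delta> x y powr (Q + p * s)"
          by (rule divide_right_mono) simp
        also have "\<dots> = L powr p * \<delta> x y powr (p - (Q + p * s))"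
          using L \<delta>_nonneg[of x y] by (simp add: powr_mult powr_diff)
        also have "p - (Q + p * s) = p * (1 - s) - Q" by (simp add: algebra_simps)
        finally show ?thesis using True by (simp add: ennreal_leI flip: ennreal_mult)
      next
        case False
        have "\<bar>\<phi> x - \<phi> y\<bar> \<le> 2" using \<phi>1[of x] \<phi>1[of y] by linarith
        then have "\<bar>\<phi> x - \<phi> y\<bar> powr p \<le> 2 powr p"
          using p_pos by (intro powr_mono2) auto
        then have "\<bar>\<phi> x - \<phi> y\<bar> powr p / \<delta> x y powr (Q + p * s) \<le> 2 powr p / \<delta> x y powr (Q + p * s)"
          by (rule divide_right_mono) simp
        also have "\<dots> = 2 powr p * \<delta> x y powr (- (Q + p * s))" by (simp only: powr_minus_divide) simp
        finally show ?thesis using False by (simp add: ennreal_leI flip: ennreal_mult)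
      qed
    qed
    also have "\<dots> = ennreal (L powr p) * (\<integral>\<^sup>+y. ennreal (if \<delta> x y < 1 then \<delta> x y powr (p * (1 - s) - Q) else 0) \<partial>lborel)
        + ennreal (2 powr p) * (\<integral>\<^sup>+y. ennreal (if 1 \<le> \<delta> x y then \<delta> x y powr (- (Q + p * s)) else 0) \<partial>lborel)"
      by (simp add: nn_integral_add nn_integral_cmult)
    also have "\<dots> \<le> ennreal (L powr p) * B1 + ennreal (2 powr p) * B2"
      by (intro add_mono mult_left_mono B1 B2) auto
    finally show ?thesis .
  qed
  have half: "(\<integral>\<^sup>+x. (\<integral>\<^sup>+y. ?f x y * indicator S x \<partial>lborel) \<partial>lborel)
      \<le> (ennreal (L powr p) * B1 + ennreal (2 powr p) * B2) * emeasure lborel S"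
  proof -
    have "(\<integral>\<^sup>+x. (\<integral>\<^sup>+y. ?f x y * indicator S x \<partial>lborel) \<partial>lborel) = (\<integral>\<^sup>+x. gag_at \<phi> x * indicator S x \<partial>lborel)"
      unfolding gag_at_def by (intro nn_integral_cong nn_integral_multc) measurable
    also have "\<dots> \<le> (\<integral>\<^sup>+x. (ennreal (L powr p) * B1 + ennreal (2 powr p) * B2) * indicator S x \<partial>lborel)"
      using le by (intro nn_integral_mono) (auto split: split_indicator)
    also have "\<dots> = (ennreal (L powr p) * B1 + ennreal (2 powr p) * B2) * emeasure lborel S"
      by (rule nn_integral_cmult_indicator) simp
    finally show ?thesis .
  qed
  have "gag \<phi> = (\<integral>\<^sup>+x. (\<integral>\<^sup>+y. ?f x y \<partial>lborel) \<partial>lborel)"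
    using nn_integral_gag_at[OF \<phi>] by (simp add: gag_at_def)
  also have "\<dots> \<le> (\<integral>\<^sup>+x. (\<integral>\<^sup>+y. ?f x y * indicator S x \<partial>lborel) + (\<integral>\<^sup>+y. ?f x y * indicator S y \<partial>lborel) \<partial>lborel)"
  proof (intro nn_integral_mono)
    fix x
    have "(\<integral>\<^sup>+y. ?f x y \<partial>lborel) \<le> (\<integral>\<^sup>+y. ?f x y * indicator S x + ?f x y * indicator S y \<partial>lborel)"
      using supp by (intro nn_integral_mono) (auto split: split_indicator)
    also have "\<dots> = (\<integral>\<^sup>+y. ?f x y * indicator S x \<partial>lborel) + (\<integral>\<^sup>+y. ?f x y * indicator S y \<partial>lborel)"
      by (rule nn_integral_add) measurable
    finally show "(\<integral>\<^sup>+y. ?f x y \<partial>lborel) \<le> (\<integral>\<^sup>+y. ?f x y * indicator S x \<partial>lborel) + (\<integral>\<^sup>+y. ?f x y * indicator S y \<partial>lborel)" .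
  qed
  also have "\<dots> = (\<integral>\<^sup>+x. (\<integral>\<^sup>+y. ?f x y * indicator S x \<partial>lborel) \<partial>lborel)
      + (\<integral>\<^sup>+x. (\<integral>\<^sup>+y. ?f x y * indicator S y \<partial>lborel) \<partial>lborel)"
    by (rule nn_integral_add) measurable
  also have "(\<integral>\<^sup>+x. (\<integral>\<^sup>+y. ?f x y * indicator S y \<partial>lborel) \<partial>lborel)
      = (\<integral>\<^sup>+y. (\<integral>\<^sup>+x. ?f x y * indicator S y \<partial>lborel) \<partial>lborel)"
    by (rule lborel_pair.Fubini') measurable
  also have "\<dots> = (\<integral>\<^sup>+x. (\<integral>\<^sup>+y. ?f x y * indicator S x \<partial>lborel) \<partial>lborel)"
    by (simp add: \<delta>_sym abs_minus_commute)
  also have "(\<integral>\<^sup>+x. (\<integral>\<^sup>+y. ?f x y * indicator S x \<partial>lborel) \<partial>lborel) + (\<integral>\<^sup>+x. (\<integral>\<^sup>+y. ?f x y * indicator S x \<partial>lborel) \<partial>lborel)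
      \<le> (ennreal (L powr p) * B1 + ennreal (2 powr p) * B2) * emeasure lborel S
        + (ennreal (L powr p) * B1 + ennreal (2 powr p) * B2) * emeasure lborel S"
    by (intro add_mono half)
  also have "\<dots> < \<infinity>"
    using fin B1(1) B2(1) by (simp add: ennreal_mult_less_top)
  finally show ?thesis .
qed

end

section \<open>The space \<open>W\<^sub>0\<close> on a stratified group\<close>

lemma open_not_null_sets:
  assumes "open S" "S \<noteq> {}"
  shows "S \<notin> null_sets lborel"
proof
  assume "S \<in> null_sets lborel"
  then have "S \<in> null_sets lebesgue" by (rule null_sets_completionI)
  then have "negligible S" by (simp add: negligible_iff_null_sets)
  with assms show False using open_not_negligible by blast
qed

locale fractional_sobolev = stratified_lie_group G k deg
  for G :: "(real^'n) monoid" (structure) and k :: nat and deg :: "'n \<Rightarrow> nat" +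
  fixes \<nu> :: "real^'n \<Rightarrow> real" and Q s p :: real
  assumes quasi_norm: "homogeneous_quasi_norm G deg \<nu>"
    and Q_def: "Q = real (homogeneous_dim k deg)"
    and s_gt_0: "0 < s" and s_lt_1: "s < 1" and p_gt: "1 < p" and ps_less: "p * s < Q"
begin

lemma \<nu>_continuous: "continuous_on UNIV \<nu>" and \<nu>_nonneg: "0 \<le> \<nu> x" and \<nu>_eq_0: "\<nu> x = 0 \<longleftrightarrow> x = 0"
  and \<nu>_inv: "\<nu> (inv x) = \<nu> x" and \<nu>_dilation: "0 < l \<Longrightarrow> \<nu> (dilation deg l x) = l * \<nu> x"
  using quasi_norm unfolding homogeneous_quasi_norm_def by blast+

lemma deg_ne_0 [simp]: "deg j \<noteq> 0"
  using deg_pos[of j] by simp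

lemma \<nu>_0 [simp]: "\<nu> 0 = 0"
  by (simp add: \<nu>_eq_0)

lemma norm_dilation_ge:
  assumes "0 \<le> l" "l \<le> 1"
  shows "l ^ k * norm x \<le> norm (dilation deg l x)"
proof -
  have "norm (l ^ k *\<^sub>R x) \<le> norm (dilation deg l x)"
  proof (rule norm_le_componentwise_cart)
    fix i
    have "l ^ k \<le> l ^ deg i" using assms deg_le by (intro power_decreasing) auto
    then show "norm ((l ^ k *\<^sub>R x) $ i) \<le> norm (dilation deg l x $ i)"
      using assms by (simp add: dilation_def abs_mult mult_right_mono)
  qed
  then show ?thesis using assms by simp
qed

lemma norm_dilation_le:
  assumes "0 \<le> l" "l \<le> 1"
  shows "norm (dilation deg l x) \<le> l * norm x"
proof -
  have "norm (dilation deg l x) \<le> norm (l *\<^sub>R x)"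
  proof (rule norm_le_componentwise_cart)
    fix i
    have "l ^ deg i \<le> l ^ 1" using assms deg_pos by (intro power_decreasing) auto
    then show "norm (dilation deg l x $ i) \<le> norm ((l *\<^sub>R x) $ i)"
      using assms by (simp add: dilation_def abs_mult mult_right_mono)
  qed
  then show ?thesis using assms by simp
qed

lemma unit_ball_bounded:
  obtains R where "0 < R" "\<And>x. \<nu> x \<le> 1 \<Longrightarrow> norm x \<le> R"
proof -
  let ?S = "sphere (0 :: real^'n) 1"
  obtain j :: 'n where True by blast
  have "axis j (1::real) \<in> ?S" by simp
  then have "?S \<noteq> {}" by blast
  then obtain x0 where x0: "x0 \<in> ?S" "\<And>x. x \<in> ?S \<Longrightarrow> \<nu> x0 \<le> \<nu> x"
    using continuous_attains_inf[OF compact_sphere _ continuous_on_subset[OF \<nu>_continuous]] by (metis subset_UNIV)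
  define m where "m = \<nu> x0"
  have "x0 \<noteq> 0" using x0(1) by auto
  then have m: "0 < m" using \<nu>_nonneg[of x0] \<nu>_eq_0[of x0] by (simp add: m_def)
  have "norm x \<le> max 1 (1 / m ^ k)" if \<nu>: "\<nu> x \<le> 1" for x
  proof (cases "norm x \<le> 1")
    case False
    have "continuous_on {0..1} (\<lambda>l. norm (dilation deg l x))"
      unfolding dilation_def by (intro continuous_intros)
    moreover have "norm (dilation deg 0 x) \<le> 1"
    proof -
      have "dilation deg 0 x = 0" by (simp add: dilation_def vec_eq_iff power_0_left)
      then show ?thesis by simp
    qed
    ultimately obtain l where l: "0 \<le> l" "l \<le> 1" "norm (dilation deg l x) = 1"
      using IVT'[of "\<lambda>l. norm (dilation deg l x)" 0 1 1] False by auto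
    have "l \<noteq> 0"
    proof
      assume "l = 0"
      then have "dilation deg l x = 0" by (simp add: dilation_def vec_eq_iff power_0_left)
      with l(3) show False by simp
    qed
    then have l0: "0 < l" using l by simp
    have "m \<le> \<nu> (dilation deg l x)" unfolding m_def using l(3) by (intro x0(2)) simp
    also have "\<dots> = l * \<nu> x" by (rule \<nu>_dilation[OF l0])
    also have "\<dots> \<le> l" using \<nu> l0 by simp
    finally have "m ^ k \<le> l ^ k" using m by (intro power_mono) auto
    then have "m ^ k * norm x \<le> l ^ k * norm x" by (intro mult_right_mono) auto
    also have "\<dots> \<le> 1" using norm_dilation_ge[OF l(1,2), of x] l(3) by simp
    finally have "norm x \<le> 1 / m ^ k" using m by (simp add: field_simps)
    then show ?thesis by simp
  qed simp
  then show thesis by (intro that[of "max 1 (1 / m ^ k)"]) auto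
qed

lemma compact_unit_ball: "compact {x. \<nu> x \<le> 1}"
proof -
  obtain R where R: "\<And>x. \<nu> x \<le> 1 \<Longrightarrow> norm x \<le> R" using unit_ball_bounded by blast
  have "closed {x. \<nu> x \<le> 1}" using \<nu>_continuous by (intro closed_Collect_le) auto
  moreover have "bounded {x. \<nu> x \<le> 1}" using R by (auto simp: bounded_iff)
  ultimately show ?thesis by (simp add: compact_eq_bounded_closed)
qed

lemma dilation_to_unit:
  assumes "0 < l" "\<nu> x \<le> l"
  obtains x' where "x = dilation deg l x'" "\<nu> x' \<le> 1"
proof (rule that[of "dilation deg (1 / l) x"])
  show "x = dilation deg l (dilation deg (1 / l) x)" using assms by (simp add: dilation_inverse)
  show "\<nu> (dilation deg (1 / l) x) \<le> 1" using assms by (simp add: \<nu>_dilation)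
qed

lemma norm_le_\<nu>:
  obtains R where "0 < R" "\<And>x. \<nu> x \<le> 1 \<Longrightarrow> norm x \<le> R * \<nu> x"
proof -
  obtain R where R: "0 < R" "\<And>x. \<nu> x \<le> 1 \<Longrightarrow> norm x \<le> R" using unit_ball_bounded by blast
  have "norm x \<le> R * \<nu> x" if "\<nu> x \<le> 1" for x
  proof (cases "x = 0")
    case False
    then have pos: "0 < \<nu> x" using \<nu>_nonneg[of x] \<nu>_eq_0[of x] by simp
    obtain x' where x': "x = dilation deg (\<nu> x) x'" "\<nu> x' \<le> 1" using dilation_to_unit[OF pos order_refl] by blast
    have "norm x \<le> \<nu> x * norm x'" using norm_dilation_le[of "\<nu> x" x'] pos that x'(1) by simp
    also have "\<dots> \<le> \<nu> x * R" using pos R(2)[OF x'(2)] by simp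
    finally show ?thesis by (simp add: mult.commute)
  qed simp
  with R(1) show thesis by (rule that)
qed

lemma mult_continuous: "continuous_on UNIV (\<lambda>(x, y). x \<otimes> y)"
  by (rule smooth_imp_continuous[OF smooth_mult])

lemma inverse_continuous: "continuous_on UNIV (\<lambda>x. inv x)"
  by (rule smooth_imp_continuous[OF smooth_inverse])

lemma ex_quasi_triangle: "\<exists>K\<ge>1. \<forall>x y. \<nu> (x \<otimes> y) \<le> K * (\<nu> x + \<nu> y)"
proof -
  let ?B = "{x. \<nu> x \<le> 1}"
  have "0 \<in> ?B" using \<nu>_eq_0[of 0] by simp
  then have ne: "?B \<times> ?B \<noteq> {}" by blast
  have "continuous_on UNIV (\<lambda>z. \<nu> ((\<lambda>(x, y). x \<otimes> y) z))"
    using continuous_on_compose2[OF \<nu>_continuous mult_continuous] by simp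
  then obtain z0 where z0: "\<And>z. z \<in> ?B \<times> ?B \<Longrightarrow> \<nu> ((\<lambda>(x, y). x \<otimes> y) z) \<le> \<nu> ((\<lambda>(x, y). x \<otimes> y) z0)"
    using continuous_attains_sup[OF compact_Times[OF compact_unit_ball compact_unit_ball] ne
        continuous_on_subset[OF _ subset_UNIV]] by blast
  define C where "C = max 1 (\<nu> ((\<lambda>(x, y). x \<otimes> y) z0))"
  have C: "\<nu> (x \<otimes> y) \<le> C" if "\<nu> x \<le> 1" "\<nu> y \<le> 1" for x y
    using z0[of "(x, y)"] that by (simp add: C_def)
  have "\<nu> (x \<otimes> y) \<le> C * (\<nu> x + \<nu> y)" for x y
  proof (cases "max (\<nu> x) (\<nu> y) = 0")
    case True
    then have "\<nu> x = 0" "\<nu> y = 0" using \<nu>_nonneg[of x] \<nu>_nonneg[of y] by (auto simp: max_def split: if_splits)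
    then show ?thesis using \<nu>_eq_0 by simp
  next
    case False
    define l where "l = max (\<nu> x) (\<nu> y)"
    have l: "0 < l" using False \<nu>_nonneg[of x] by (simp add: l_def max_def split: if_splits)
    obtain x' where x': "x = dilation deg l x'" "\<nu> x' \<le> 1" using dilation_to_unit[OF l, of x] by (auto simp: l_def)
    obtain y' where y': "y = dilation deg l y'" "\<nu> y' \<le> 1" using dilation_to_unit[OF l, of y] by (auto simp: l_def)
    have "\<nu> (x \<otimes> y) = l * \<nu> (x' \<otimes> y')" by (simp add: x'(1) y'(1) \<nu>_dilation[OF l] flip: dilation_mult[OF l])
    also have "\<dots> \<le> l * C" using C[OF x'(2) y'(2)] l by simp
    also have "\<dots> \<le> (\<nu> x + \<nu> y) * C"
      using \<nu>_nonneg[of x] \<nu>_nonneg[of y] by (intro mult_right_mono) (auto simp: l_def C_def)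
    finally show ?thesis by (simp add: mult.commute)
  qed
  then show ?thesis by (intro exI[of _ C]) (simp add: C_def)
qed

lemma \<nu>_measurable[measurable]: "\<nu> \<in> borel_measurable borel"
  by (rule borel_measurable_continuous_onI[OF \<nu>_continuous])

lemma ex_ball_volume: "\<exists>c>0. \<forall>r>0. emeasure lborel {x. \<nu> x < r} = ennreal (c * r powr Q)"
proof -
  have op: "open {x. \<nu> x < r}" for r using \<nu>_continuous by (intro open_Collect_less) auto
  then have [measurable]: "{x. \<nu> x < r} \<in> sets borel" for r by simp
  have "bounded {x. \<nu> x < 1}"
    by (rule bounded_subset[OF compact_imp_bounded[OF compact_unit_ball]]) auto
  then have fin: "emeasure lborel {x. \<nu> x < 1} < \<infinity>" by (rule emeasure_bounded_finite)
  have "emeasure lborel {x. \<nu> x < 1} \<noteq> 0"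
  proof
    assume "emeasure lborel {x. \<nu> x < 1} = 0"
    then have "{x. \<nu> x < 1} \<in> null_sets lborel" by auto
    moreover have "0 \<in> {x. \<nu> x < 1}" using \<nu>_eq_0[of 0] by simp
    ultimately show False using open_not_null_sets[OF op] by blast
  qed
  define c where "c = enn2real (emeasure lborel {x. \<nu> x < 1})"
  have c: "emeasure lborel {x. \<nu> x < 1} = ennreal c" using fin by (simp add: c_def)
  have cpos: "0 < c" using c \<open>emeasure lborel {x. \<nu> x < 1} \<noteq> 0\<close> by (metis ennreal_eq_0_iff not_le)
  have "emeasure lborel {x. \<nu> x < r} = ennreal (c * r powr Q)" if r: "0 < r" for r
  proof -
    let ?N = "homogeneous_dim k deg"
    have "ennreal c = (\<integral>\<^sup>+x. indicator {x. \<nu> x < r} (dilation deg r x) \<partial>lborel)"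
    proof -
      have "(\<integral>\<^sup>+x. indicator {x. \<nu> x < r} (dilation deg r x) \<partial>lborel) = (\<integral>\<^sup>+x. indicator {x. \<nu> x < 1} x \<partial>lborel)"
        using r by (intro nn_integral_cong) (simp add: indicator_def \<nu>_dilation)
      then show ?thesis by (simp add: c)
    qed
    also have "\<dots> = ennreal (1 / r ^ ?N) * emeasure lborel {x. \<nu> x < r}"
      by (subst nn_integral_dilation[OF r strata]) auto
    finally have "ennreal (r ^ ?N) * ennreal c = ennreal (r ^ ?N) * ennreal (1 / r ^ ?N) * emeasure lborel {x. \<nu> x < r}"
      by (simp add: mult.assoc)
    also have "ennreal (r ^ ?N) * ennreal (1 / r ^ ?N) = 1" using r by (simp flip: ennreal_mult')
    finally have "emeasure lborel {x. \<nu> x < r} = ennreal (r ^ ?N) * ennreal c" by simp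
    also have "\<dots> = ennreal (c * r powr Q)"
      using r cpos by (simp add: Q_def powr_realpow mult.commute flip: ennreal_mult)
    finally show ?thesis .
  qed
  with cpos show ?thesis by blast
qed

definition quasi_const :: real where
  "quasi_const = (SOME K. K \<ge> 1 \<and> (\<forall>x y. \<nu> (x \<otimes> y) \<le> K * (\<nu> x + \<nu> y)))"

definition ball_const :: real where
  "ball_const = (SOME c. c > 0 \<and> (\<forall>r>0. emeasure lborel {x. \<nu> x < r} = ennreal (c * r powr Q)))"

lemma quasi_const: "1 \<le> quasi_const" "\<nu> (x \<otimes> y) \<le> quasi_const * (\<nu> x + \<nu> y)"
  using someI_ex[OF ex_quasi_triangle] unfolding quasi_const_def by blast+

lemma ball_const: "0 < ball_const" "0 < r \<Longrightarrow> emeasure lborel {x. \<nu> x < r} = ennreal (ball_const * r powr Q)"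
  using someI_ex[OF ex_ball_volume] unfolding ball_const_def by blast+

definition qdist :: "real^'n \<Rightarrow> real^'n \<Rightarrow> real" where
  "qdist x y = \<nu> (inv y \<otimes> x)"

lemma inv_mult_inv: "inv (inv y \<otimes> x) = inv x \<otimes> y"
  by (simp add: inv_mult_group)

lemma qdist_sym: "qdist x y = qdist y x"
  using \<nu>_inv[of "inv y \<otimes> x"] by (simp add: qdist_def inv_mult_inv)

lemma qdist_left_mult: "qdist (z \<otimes> x) (z \<otimes> y) = qdist x y"
proof -
  have "inv (z \<otimes> y) \<otimes> (z \<otimes> x) = inv y \<otimes> (inv z \<otimes> (z \<otimes> x))"
    by (simp add: inv_mult_group m_assoc)
  then show ?thesis by (simp add: qdist_def left_mult_inverse)
qed

lemma qdist_dilation: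
  assumes "0 < l"
  shows "qdist (dilation deg l x) (dilation deg l y) = l * qdist x y"
proof -
  have "dilation deg l (inv y) \<otimes> dilation deg l y = \<one>"
    by (simp add: one_eq_zero flip: dilation_mult[OF assms])
  then have "inv (dilation deg l y) = dilation deg l (inv y)" by (intro inv_equality) auto
  then show ?thesis by (simp add: qdist_def \<nu>_dilation[OF assms] flip: dilation_mult[OF assms])
qed

sublocale ahlfors_kernel qdist Q s p quasi_const ball_const
proof
  show "continuous_on UNIV (\<lambda>z. qdist (fst z) (snd z))"
  proof -
    have "continuous_on UNIV (\<lambda>z. (inv (snd z), fst z))"
      by (intro continuous_on_Pair continuous_on_compose2[OF inverse_continuous] continuous_on_fst
          continuous_on_snd continuous_on_id) auto
    from continuous_on_compose2[OF mult_continuous this]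
    have "continuous_on UNIV (\<lambda>z. inv (snd z) \<otimes> fst z)" by simp
    from continuous_on_compose2[OF \<nu>_continuous this] show ?thesis by (simp add: qdist_def)
  qed
  show "0 \<le> qdist x y" for x y by (simp add: qdist_def \<nu>_nonneg)
  show "qdist x y = 0 \<longleftrightarrow> x = y" for x y
  proof
    assume "qdist x y = 0"
    then have "inv y \<otimes> x = \<one>" by (simp add: qdist_def \<nu>_eq_0 one_eq_zero)
    then show "x = y" by (metis left_mult_inverse(2) mult_zero(2) one_eq_zero)
  next
    assume "x = y" then show "qdist x y = 0" by (simp add: qdist_def \<nu>_eq_0 one_eq_zero)
  qed
  show "qdist x y = qdist y x" for x y by (rule qdist_sym)
  show "qdist x z \<le> quasi_const * (qdist x y + qdist y z)" for x y z
  proof -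
    have "inv z \<otimes> x = (inv z \<otimes> y) \<otimes> (inv y \<otimes> x)" by (simp add: m_assoc left_mult_inverse)
    then show ?thesis using quasi_const(2)[of "inv z \<otimes> y" "inv y \<otimes> x"] by (simp add: qdist_def add.commute)
  qed
  show "1 \<le> quasi_const" by (rule quasi_const)
  show "0 < ball_const" by (rule ball_const)
  show "emeasure lborel {y. qdist x y < r} = ennreal (ball_const * r powr Q)" if "0 < r" for x r
  proof -
    have [measurable]: "{x. \<nu> x < r} \<in> sets borel" by measurable
    have "emeasure lborel {y. qdist x y < r} = (\<integral>\<^sup>+y. indicator {y. \<nu> y < r} (inv x \<otimes> y) \<partial>lborel)"
    proof -
      have eq: "indicator {y. qdist x y < r} y = (indicator {y. \<nu> y < r} (inv x \<otimes> y) :: ennreal)" for y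
        using qdist_sym[of x y] by (simp add: indicator_def qdist_def)
      have m: "{y. qdist x y < r} \<in> sets lborel"
      proof -
        have "(\<lambda>y. inv x \<otimes> y) -` {y. \<nu> y < r} \<in> sets borel"
          using measurable_sets[OF left_mult_measurable, of "{y. \<nu> y < r}" "inv x"] by simp
        moreover have "{y. qdist x y < r} = (\<lambda>y. inv x \<otimes> y) -` {y. \<nu> y < r}"
          using qdist_sym[of x] by (auto simp: qdist_def)
        ultimately show ?thesis by simp
      qed
      show ?thesis unfolding nn_integral_indicator[OF m, symmetric] eq ..
    qed
    also have "\<dots> = (\<integral>\<^sup>+y. indicator {y. \<nu> y < r} y \<partial>lborel)" by (rule nn_integral_left_mult) simp
    also have "\<dots> = ennreal (ball_const * r powr Q)" using ball_const(2)[OF that] by simp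
    finally show ?thesis .
  qed
qed (use s_gt_0 p_gt ps_less in auto)

lemma gagliardo_pow_eq: "gagliardo_pow G \<nu> Q s p u = gag u"
  by (simp add: gagliardo_pow_def gag_def qdist_def)

lemma sobolev_norm_pow_eq: "sobolev_norm_pow G \<nu> Q s p u = snorm u"
  by (simp add: sobolev_norm_pow_def snorm_def gagliardo_pow_eq)

abbreviation W0 :: "(real^'n \<Rightarrow> real) set" where "W0 \<equiv> sobolev_space0 G \<nu> Q s p"

lemma test_functions_measurable: "\<phi> \<in> test_functions \<Longrightarrow> \<phi> \<in> borel_measurable borel"
  unfolding test_functions_def mem_Collect_eq
  by (intro borel_measurable_continuous_onI smooth_imp_continuous) (rule conjunct1)

lemma W0_iff: "u \<in> W0 \<longleftrightarrow> u \<in> borel_measurable borel \<and> snorm u < \<infinity> \<and>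
    (\<forall>\<epsilon>>0. \<exists>\<phi>\<in>test_functions. snorm (\<lambda>x. u x - \<phi> x) < ennreal \<epsilon>)" (is "?l \<longleftrightarrow> ?r")
proof -
  have eq: "(\<forall>\<epsilon>>0. P (ennreal (\<epsilon> powr p))) \<longleftrightarrow> (\<forall>\<epsilon>>0. P (ennreal \<epsilon>))" for P
  proof safe
    fix \<epsilon> :: real assume *: "\<forall>\<epsilon>>0. P (ennreal (\<epsilon> powr p))" and \<epsilon>: "0 < \<epsilon>"
    have "(\<epsilon> powr (1 / p)) powr p = \<epsilon>" using \<epsilon> p_pos by (simp add: powr_powr)
    with *[rule_format, of "\<epsilon> powr (1 / p)"] \<epsilon> show "P (ennreal \<epsilon>)" by simp
  qed auto
  have fin: "snorm u < \<infinity> \<longleftrightarrow> (\<integral>\<^sup>+x. ennreal (\<bar>u x\<bar> powr p) \<partial>lborel) < \<infinity> \<and> gag u < \<infinity>"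
    by (simp add: snorm_def)
  show ?thesis
    unfolding fin sobolev_space0_def sobolev_space_def mem_Collect_eq gagliardo_pow_eq sobolev_norm_pow_eq
      eq[of "\<lambda>e. \<exists>\<phi>\<in>test_functions. snorm (\<lambda>x. u x - \<phi> x) < e"]
    by (simp only: conj_assoc)
qed

lemma W0_measurable: "u \<in> W0 \<Longrightarrow> u \<in> borel_measurable borel" by (simp add: W0_iff)
lemma W0_snorm: "u \<in> W0 \<Longrightarrow> snorm u < \<infinity>" by (simp add: W0_iff)

lemma W0_approx:
  assumes "u \<in> W0" "0 < \<epsilon>"
  obtains \<phi> where "\<phi> \<in> test_functions" "snorm (\<lambda>x. u x - \<phi> x) < ennreal \<epsilon>"
  using assms by (auto simp: W0_iff)

lemma ennreal_mult_divide_cancel: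
  assumes "0 < c" "0 \<le> \<epsilon>"
  shows "ennreal c * ennreal (\<epsilon> / c) = ennreal \<epsilon>"
  using assms by (simp flip: ennreal_mult)

lemma ennreal_small_mult:
  assumes "0 < \<epsilon>" "0 < c" "a < ennreal (\<epsilon> / (2 * c))" "b < ennreal (\<epsilon> / (2 * c))"
  shows "ennreal c * (a + b) < ennreal \<epsilon>"
proof -
  have "a + b < ennreal (\<epsilon> / (2 * c)) + ennreal (\<epsilon> / (2 * c))" using assms by (intro add_strict_mono)
  also have "\<dots> = ennreal (\<epsilon> / c)" using assms by (simp flip: ennreal_plus)
  finally have "ennreal c * (a + b) < ennreal c * ennreal (\<epsilon> / c)"
    using assms by (intro ennreal_mult_strict_left_mono) auto
  also have "\<dots> = ennreal \<epsilon>" using assms by (intro ennreal_mult_divide_cancel) auto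
  finally show ?thesis .
qed

lemma W0_add:
  assumes u: "u \<in> W0" and v: "v \<in> W0"
  shows "(\<lambda>x. u x + v x) \<in> W0"
proof -
  note [measurable] = W0_measurable[OF u] W0_measurable[OF v]
  have "snorm (\<lambda>x. u x + v x) < \<infinity>"
    by (rule le_less_trans[OF snorm_add_le]) (use W0_snorm[OF u] W0_snorm[OF v] in \<open>auto simp: ennreal_mult_less_top\<close>)
  moreover have "\<exists>\<phi>\<in>test_functions. snorm (\<lambda>x. (u x + v x) - \<phi> x) < ennreal \<epsilon>" if \<epsilon>: "0 < \<epsilon>" for \<epsilon>
  proof -
    let ?e = "\<epsilon> / (2 * 2 powr p)"
    have e: "0 < ?e" using \<epsilon> by simp
    obtain \<phi> where \<phi>: "\<phi> \<in> test_functions" "snorm (\<lambda>x. u x - \<phi> x) < ennreal ?e" by (rule W0_approx[OF u e])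
    obtain \<psi> where \<psi>: "\<psi> \<in> test_functions" "snorm (\<lambda>x. v x - \<psi> x) < ennreal ?e" by (rule W0_approx[OF v e])
    note [measurable] = test_functions_measurable[OF \<phi>(1)] test_functions_measurable[OF \<psi>(1)]
    have "snorm (\<lambda>x. (u x + v x) - (\<phi> x + \<psi> x)) = snorm (\<lambda>x. (u x - \<phi> x) + (v x - \<psi> x))"
      by (simp add: algebra_simps)
    also have "\<dots> \<le> ennreal (2 powr p) * (snorm (\<lambda>x. u x - \<phi> x) + snorm (\<lambda>x. v x - \<psi> x))"
      by (rule snorm_add_le) auto
    also have "\<dots> < ennreal \<epsilon>" using \<epsilon> \<phi> \<psi> by (intro ennreal_small_mult) auto
    finally show ?thesis using test_functions_add[OF \<phi>(1) \<psi>(1)] by (intro bexI[of _ "\<lambda>x. \<phi> x + \<psi> x"])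
  qed
  ultimately show ?thesis by (simp add: W0_iff)
qed

lemma W0_cmult:
  assumes u: "u \<in> W0"
  shows "(\<lambda>x. c * u x) \<in> W0"
proof -
  note [measurable] = W0_measurable[OF u]
  have "snorm (\<lambda>x. c * u x) < \<infinity>"
    using W0_snorm[OF u] by (subst snorm_cmult) (auto simp: ennreal_mult_less_top)
  moreover have "\<exists>\<phi>\<in>test_functions. snorm (\<lambda>x. c * u x - \<phi> x) < ennreal \<epsilon>" if \<epsilon>: "0 < \<epsilon>" for \<epsilon>
  proof -
    let ?c = "\<bar>c\<bar> powr p + 1"
    have "0 < \<epsilon> / ?c" using \<epsilon> by (simp add: add_nonneg_pos)
    then obtain \<phi> where \<phi>: "\<phi> \<in> test_functions" "snorm (\<lambda>x. u x - \<phi> x) < ennreal (\<epsilon> / ?c)" by (rule W0_approx[OF u])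
    note [measurable] = test_functions_measurable[OF \<phi>(1)]
    have "snorm (\<lambda>x. c * u x - c * \<phi> x) = snorm (\<lambda>x. c * (u x - \<phi> x))" by (simp add: algebra_simps)
    also have "\<dots> = ennreal (\<bar>c\<bar> powr p) * snorm (\<lambda>x. u x - \<phi> x)" by (rule snorm_cmult) auto
    also have "\<dots> \<le> ennreal ?c * snorm (\<lambda>x. u x - \<phi> x)" by (intro mult_right_mono ennreal_leI) auto
    also have "\<dots> < ennreal ?c * ennreal (\<epsilon> / ?c)"
      using \<phi>(2) by (intro ennreal_mult_strict_left_mono) (auto simp: add_nonneg_pos)
    also have "\<dots> = ennreal \<epsilon>" using \<epsilon> by (intro ennreal_mult_divide_cancel) (auto simp: add_nonneg_pos)
    finally show ?thesis using test_functions_cmult[OF \<phi>(1)] by (intro bexI[of _ "\<lambda>x. c * \<phi> x"])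
  qed
  ultimately show ?thesis by (simp add: W0_iff)
qed

lemma W0_diff: "u \<in> W0 \<Longrightarrow> v \<in> W0 \<Longrightarrow> (\<lambda>x. u x - v x) \<in> W0"
  using W0_add[OF _ W0_cmult[of v "-1"]] by simp

lemma W0_closed:
  assumes [measurable]: "u \<in> borel_measurable borel"
    and ap: "\<And>\<epsilon>. 0 < \<epsilon> \<Longrightarrow> \<exists>w\<in>W0. snorm (\<lambda>x. u x - w x) < ennreal \<epsilon>"
  shows "u \<in> W0"
proof -
  have "\<exists>\<phi>\<in>test_functions. snorm (\<lambda>x. u x - \<phi> x) < ennreal \<epsilon>" if \<epsilon>: "0 < \<epsilon>" for \<epsilon>
  proof -
    let ?e = "\<epsilon> / (2 * 2 powr p)"
    have e: "0 < ?e" using \<epsilon> by simp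
    obtain w where w: "w \<in> W0" "snorm (\<lambda>x. u x - w x) < ennreal ?e" using ap[OF e] by blast
    obtain \<psi> where \<psi>: "\<psi> \<in> test_functions" "snorm (\<lambda>x. w x - \<psi> x) < ennreal ?e" by (rule W0_approx[OF w(1) e])
    note [measurable] = W0_measurable[OF w(1)] test_functions_measurable[OF \<psi>(1)]
    have "snorm (\<lambda>x. u x - \<psi> x) = snorm (\<lambda>x. (u x - w x) + (w x - \<psi> x))" by simp
    also have "\<dots> \<le> ennreal (2 powr p) * (snorm (\<lambda>x. u x - w x) + snorm (\<lambda>x. w x - \<psi> x))"
      by (rule snorm_add_le) auto
    also have "\<dots> < ennreal \<epsilon>" using \<epsilon> w \<psi> by (intro ennreal_small_mult) auto
    finally show ?thesis using \<psi>(1) by blast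
  qed
  moreover have "snorm u < \<infinity>"
  proof -
    obtain w where w: "w \<in> W0" "snorm (\<lambda>x. u x - w x) < ennreal 1" using ap[of 1] by auto
    note [measurable] = W0_measurable[OF w(1)]
    have "snorm u = snorm (\<lambda>x. (u x - w x) + w x)" by simp
    also have "\<dots> \<le> ennreal (2 powr p) * (snorm (\<lambda>x. u x - w x) + snorm w)" by (rule snorm_add_le) auto
    also have "\<dots> < \<infinity>" using w(2) W0_snorm[OF w(1)] less_trans[OF w(2) ennreal_less_top]
      by (auto simp: ennreal_mult_less_top)
    finally show ?thesis .
  qed
  ultimately show ?thesis by (simp add: W0_iff)
qed

lemma gag_left_mult:
  assumes [measurable]: "u \<in> borel_measurable borel"
  shows "gag (\<lambda>x. u (z \<otimes> x)) = gag u"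
proof -
  have "gag_at (\<lambda>x. u (z \<otimes> x)) x = gag_at u (z \<otimes> x)" for x
    unfolding gag_at_def
    using nn_integral_left_mult[of "\<lambda>y. ennreal (\<bar>u (z \<otimes> x) - u y\<bar> powr p / qdist (z \<otimes> x) y powr (Q + p * s))" z]
    by (simp add: qdist_left_mult)
  then have "gag (\<lambda>x. u (z \<otimes> x)) = (\<integral>\<^sup>+x. gag_at u (z \<otimes> x) \<partial>lborel)"
    by (simp flip: nn_integral_gag_at)
  also have "\<dots> = gag u"
    by (subst nn_integral_left_mult) (auto simp: nn_integral_gag_at)
  finally show ?thesis .
qed

lemma snorm_left_mult:
  assumes [measurable]: "u \<in> borel_measurable borel"
  shows "snorm (\<lambda>x. u (z \<otimes> x)) = snorm u"
  unfolding snorm_def gag_left_mult[OF assms]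
  using nn_integral_left_mult[of "\<lambda>x. ennreal (\<bar>u x\<bar> powr p)" z] by simp

lemma W0_left_mult:
  assumes u: "u \<in> W0"
  shows "(\<lambda>x. u (z \<otimes> x)) \<in> W0"
proof -
  note [measurable] = W0_measurable[OF u]
  have "\<exists>\<phi>\<in>test_functions. snorm (\<lambda>x. u (z \<otimes> x) - \<phi> x) < ennreal \<epsilon>" if \<epsilon>: "0 < \<epsilon>" for \<epsilon>
  proof -
    obtain \<phi> where \<phi>: "\<phi> \<in> test_functions" "snorm (\<lambda>x. u x - \<phi> x) < ennreal \<epsilon>" by (rule W0_approx[OF u \<epsilon>])
    note [measurable] = test_functions_measurable[OF \<phi>(1)]
    have "(\<lambda>x. \<phi> (z \<otimes> x)) \<in> test_functions"
      by (rule test_functions_compose[OF \<phi>(1) smooth_left_mult left_mult_continuous[of "inv z"]]) (rule left_mult_inverse)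
    moreover have "snorm (\<lambda>x. u (z \<otimes> x) - \<phi> (z \<otimes> x)) = snorm (\<lambda>x. u x - \<phi> x)"
      by (rule snorm_left_mult[of "\<lambda>x. u x - \<phi> x"]) auto
    ultimately show ?thesis using \<phi>(2) by (intro bexI[of _ "\<lambda>x. \<phi> (z \<otimes> x)"]) auto
  qed
  then show ?thesis using W0_snorm[OF u] by (simp add: W0_iff snorm_left_mult)
qed

lemma nn_integral_dilation_powr:
  assumes l: "0 < l" and [measurable]: "f \<in> borel_measurable borel"
  shows "(\<integral>\<^sup>+x. f (dilation deg l x) \<partial>lborel) = ennreal (l powr (- Q)) * (\<integral>\<^sup>+x. f x \<partial>lborel)"
  using nn_integral_dilation[OF l strata assms(2)] l by (simp add: Q_def powr_minus_divide powr_realpow)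

lemma gag_dilation:
  assumes l: "0 < l" and [measurable]: "u \<in> borel_measurable borel"
  shows "gag (\<lambda>x. u (dilation deg l x)) = ennreal (l powr (p * s - Q)) * gag u"
proof -
  let ?D = "dilation deg l"
  have "gag_at (\<lambda>x. u (?D x)) x = ennreal (l powr (p * s)) * gag_at u (?D x)" for x
  proof -
    have "gag_at (\<lambda>x. u (?D x)) x = (\<integral>\<^sup>+y. ennreal (l powr (Q + p * s)) *
        ennreal (\<bar>u (?D x) - u (?D y)\<bar> powr p / qdist (?D x) (?D y) powr (Q + p * s)) \<partial>lborel)"
      unfolding gag_at_def
    proof (intro nn_integral_cong)
      fix y
      have "qdist (?D x) (?D y) powr (Q + p * s) = l powr (Q + p * s) * qdist x y powr (Q + p * s)"
        using l \<delta>_nonneg[of x y] by (simp add: qdist_dilation powr_mult)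
      then show "ennreal (\<bar>u (?D x) - u (?D y)\<bar> powr p / qdist x y powr (Q + p * s))
        = ennreal (l powr (Q + p * s)) * ennreal (\<bar>u (?D x) - u (?D y)\<bar> powr p / qdist (?D x) (?D y) powr (Q + p * s))"
        using l by (simp flip: ennreal_mult)
    qed
    also have "\<dots> = ennreal (l powr (Q + p * s)) *
        (\<integral>\<^sup>+y. ennreal (\<bar>u (?D x) - u (?D y)\<bar> powr p / qdist (?D x) (?D y) powr (Q + p * s)) \<partial>lborel)"
      by (rule nn_integral_cmult) measurable
    also have "\<dots> = ennreal (l powr (Q + p * s)) * (ennreal (l powr (- Q)) * gag_at u (?D x))"
      unfolding gag_at_def
      by (subst nn_integral_dilation_powr[OF l, of "\<lambda>y. ennreal (\<bar>u (?D x) - u y\<bar> powr p / qdist (?D x) y powr (Q + p * s))"]) auto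
    also have "\<dots> = ennreal (l powr (Q + p * s) * l powr (- Q)) * gag_at u (?D x)"
      by (simp add: mult.assoc ennreal_mult)
    also have "l powr (Q + p * s) * l powr (- Q) = l powr (p * s)" by (simp flip: powr_add)
    finally show ?thesis .
  qed
  then have "gag (\<lambda>x. u (?D x)) = (\<integral>\<^sup>+x. ennreal (l powr (p * s)) * gag_at u (?D x) \<partial>lborel)"
    by (simp flip: nn_integral_gag_at)
  also have "\<dots> = ennreal (l powr (p * s)) * (\<integral>\<^sup>+x. gag_at u (?D x) \<partial>lborel)"
    by (rule nn_integral_cmult) measurable
  also have "\<dots> = ennreal (l powr (p * s)) * (ennreal (l powr (- Q)) * gag u)"
    by (simp add: nn_integral_dilation_powr[OF l] nn_integral_gag_at)
  also have "\<dots> = ennreal (l powr (p * s) * l powr (- Q)) * gag u" by (simp add: mult.assoc ennreal_mult)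
  also have "l powr (p * s) * l powr (- Q) = l powr (p * s - Q)" by (simp flip: powr_add)
  finally show ?thesis .
qed

lemma snorm_dilation_le:
  assumes l: "0 < l" and [measurable]: "u \<in> borel_measurable borel"
  shows "snorm (\<lambda>x. u (dilation deg l x)) \<le> ennreal (l powr (- Q) + l powr (p * s - Q)) * snorm u"
proof -
  have "snorm (\<lambda>x. u (dilation deg l x)) = ennreal (l powr (- Q)) * (\<integral>\<^sup>+x. ennreal (\<bar>u x\<bar> powr p) \<partial>lborel)
      + ennreal (l powr (p * s - Q)) * gag u"
    unfolding snorm_def gag_dilation[OF assms]
    using nn_integral_dilation_powr[OF l, of "\<lambda>x. ennreal (\<bar>u x\<bar> powr p)"] by simp
  also have "\<dots> \<le> ennreal (l powr (- Q) + l powr (p * s - Q)) * (\<integral>\<^sup>+x. ennreal (\<bar>u x\<bar> powr p) \<partial>lborel)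
      + ennreal (l powr (- Q) + l powr (p * s - Q)) * gag u"
    by (intro add_mono mult_right_mono ennreal_leI) auto
  finally show ?thesis unfolding snorm_def by (simp add: distrib_left)
qed

lemma W0_dilation:
  assumes u: "u \<in> W0" and l: "0 < l"
  shows "(\<lambda>x. u (dilation deg l x)) \<in> W0"
proof -
  note [measurable] = W0_measurable[OF u]
  let ?c = "l powr (- Q) + l powr (p * s - Q)"
  have c: "0 < ?c" using l by (simp add: add_pos_pos)
  have "\<exists>\<phi>\<in>test_functions. snorm (\<lambda>x. u (dilation deg l x) - \<phi> x) < ennreal \<epsilon>" if \<epsilon>: "0 < \<epsilon>" for \<epsilon>
  proof -
    have "0 < \<epsilon> / ?c" using \<epsilon> c by simp
    then obtain \<phi> where \<phi>: "\<phi> \<in> test_functions" "snorm (\<lambda>x. u x - \<phi> x) < ennreal (\<epsilon> / ?c)" by (rule W0_approx[OF u])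
    note [measurable] = test_functions_measurable[OF \<phi>(1)]
    have "(\<lambda>x. \<phi> (dilation deg l x)) \<in> test_functions"
      by (rule test_functions_compose[OF \<phi>(1) smooth_bounded_linear[OF bounded_linear_dilation]
            linear_continuous_on[OF bounded_linear_dilation]]) (rule dilation_inverse(2)[OF l])
    moreover have "snorm (\<lambda>x. u (dilation deg l x) - \<phi> (dilation deg l x)) \<le> ennreal ?c * snorm (\<lambda>x. u x - \<phi> x)"
      by (rule snorm_dilation_le[OF l, of "\<lambda>x. u x - \<phi> x"]) auto
    moreover have "ennreal ?c * snorm (\<lambda>x. u x - \<phi> x) < ennreal ?c * ennreal (\<epsilon> / ?c)"
      using \<phi>(2) c by (intro ennreal_mult_strict_left_mono ennreal_less_zero_iff[THEN iffD2] ennreal_less_top)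
    moreover have "ennreal ?c * ennreal (\<epsilon> / ?c) = ennreal \<epsilon>" using \<epsilon> c by (intro ennreal_mult_divide_cancel) auto
    ultimately show ?thesis by (intro bexI[of _ "\<lambda>x. \<phi> (dilation deg l x)"]) auto
  qed
  moreover have "snorm (\<lambda>x. u (dilation deg l x)) < \<infinity>"
    by (rule le_less_trans[OF snorm_dilation_le[OF l W0_measurable[OF u]]])
      (use W0_snorm[OF u] in \<open>simp add: ennreal_mult_less_top\<close>)
  ultimately show ?thesis by (simp add: W0_iff)
qed

lemma test_function_lipschitz:
  assumes \<phi>: "smooth \<phi>" and S: "compact S"
  obtains L where "0 \<le> L" "\<And>x y. x \<in> S \<Longrightarrow> qdist x y < 1 \<Longrightarrow> \<bar>\<phi> x - \<phi> y\<bar> \<le> L * qdist x y"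
proof -
  obtain R where R: "0 < R" "\<And>x. \<nu> x \<le> 1 \<Longrightarrow> norm x \<le> R * \<nu> x" using norm_le_\<nu> by blast
  define \<psi> where "\<psi> = (\<lambda>z. \<phi> ((\<lambda>(x, y). x \<otimes> y) z))"
  have \<psi>: "smooth \<psi>" unfolding \<psi>_def by (rule smooth_compose[OF \<phi> smooth_mult])
  let ?d = "\<lambda>z v. frechet_derivative \<psi> (at z) (0, v)"
  have "\<exists>M\<ge>0. \<forall>z\<in>S \<times> cball 0 R. \<bar>?d z (axis i 1)\<bar> \<le> M" for i
  proof -
    have "compact ((\<lambda>z. ?d z (axis i 1)) ` (S \<times> cball 0 R))"
      by (intro compact_continuous_image continuous_on_subset[OF smooth_continuous_derivative[OF \<psi>]]
          compact_Times S compact_cball) auto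
    then have "bounded ((\<lambda>z. ?d z (axis i 1)) ` (S \<times> cball 0 R))" by (rule compact_imp_bounded)
    then obtain M where "0 < M" "\<forall>x\<in>(\<lambda>z. ?d z (axis i 1)) ` (S \<times> cball 0 R). norm x \<le> M"
      using bounded_pos by blast
    then show ?thesis by (intro exI[of _ M]) auto
  qed
  then obtain M where M: "\<And>i. 0 \<le> M i" "\<And>i z. z \<in> S \<times> cball 0 R \<Longrightarrow> \<bar>?d z (axis i 1)\<bar> \<le> M i" by metis
  define B where "B = (\<Sum>i\<in>UNIV. M i)"
  have B: "0 \<le> B" unfolding B_def by (intro sum_nonneg M)
  have lin: "linear (?d z)" for z
  proof -
    have "linear (frechet_derivative \<psi> (at z))" by (rule has_derivative_linear[OF smooth_has_derivative[OF \<psi>]])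
    moreover have "linear (\<lambda>v::real^'n. (0 :: real^'n, v))" by (rule linearI) auto
    ultimately show ?thesis using linear_compose by (force simp: o_def)
  qed
  have dB: "\<bar>?d z v\<bar> \<le> B * norm v" if z: "z \<in> S \<times> cball 0 R" for z v
  proof -
    have "v = (\<Sum>i\<in>UNIV. v $ i *\<^sub>R axis i 1)" by (simp add: vec_eq_iff axis_def if_distrib cong: if_cong)
    then have "?d z v = (\<Sum>i\<in>UNIV. v $ i * ?d z (axis i 1))"
      using linear_sum[OF lin[of z], of "\<lambda>i. v $ i *\<^sub>R axis i 1" UNIV] by (simp add: linear_cmul[OF lin])
    then have "\<bar>?d z v\<bar> \<le> (\<Sum>i\<in>UNIV. \<bar>v $ i * ?d z (axis i 1)\<bar>)" by (simp only: sum_abs)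
    also have "\<dots> \<le> (\<Sum>i\<in>UNIV. norm v * M i)"
      unfolding abs_mult using component_le_norm_cart[of v] M(2)[OF z] by (intro sum_mono mult_mono) auto
    finally show ?thesis by (simp add: B_def sum_distrib_left mult.commute)
  qed
  have "\<bar>\<phi> x - \<phi> y\<bar> \<le> B * R * qdist x y" if x: "x \<in> S" and d: "qdist x y < 1" for x y
  proof -
    define h where "h = inv x \<otimes> y"
    have \<nu>h: "\<nu> h = qdist x y" unfolding h_def using qdist_sym[of x y] by (simp add: qdist_def)
    have nh: "norm h \<le> R * qdist x y" using R(2)[of h] d \<nu>h by simp
    also have "R * qdist x y \<le> R * 1" using d R(1) by (intro mult_left_mono) auto
    finally have hR: "norm h \<le> R" by simp
    have y: "y = x \<otimes> h" by (simp add: h_def left_mult_inverse)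
    have der: "((\<lambda>t. \<psi> (x, t)) has_derivative ?d (x, t)) (at t within cball 0 R)" for t
    proof (rule has_derivative_at_withinI)
      have "((\<lambda>t. (x, t)) has_derivative (\<lambda>v. (0, v))) (at t)"
        by (intro has_derivative_Pair has_derivative_const has_derivative_ident)
      from has_derivative_compose[OF this smooth_has_derivative[OF \<psi>]]
      show "((\<lambda>t. \<psi> (x, t)) has_derivative ?d (x, t)) (at t)" by simp
    qed
    have "norm (\<psi> (x, h) - \<psi> (x, 0)) \<le> B * norm (h - 0)"
    proof (rule differentiable_bound[OF convex_cball der])
      show "onorm (?d (x, t)) \<le> B" if "t \<in> cball 0 R" for t
        using dB[of "(x, t)"] x that by (intro onorm_le) auto
    qed (use hR R(1) in auto)
    then have "\<bar>\<phi> y - \<phi> x\<bar> \<le> B * norm h" by (simp add: \<psi>_def y)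
    also have "\<dots> \<le> B * (R * qdist x y)" using nh B by (rule mult_left_mono)
    finally show ?thesis by (simp add: abs_minus_commute mult.assoc)
  qed
  then show thesis using B R(1) by (intro that[of "B * R"]) auto
qed

lemma ex_nonzero_W0: "\<exists>u\<in>W0. nonzero u"
proof -
  define \<phi> :: "real^'n \<Rightarrow> real" where "\<phi> = (\<lambda>x. exp_bump 0 (1 - x \<bullet> x))"
  have t: "\<phi> \<in> test_functions" unfolding \<phi>_def by (rule bump_in_test_functions)
  then have sm: "smooth \<phi>" by (simp add: test_functions_def)
  note [measurable] = test_functions_measurable[OF t]
  let ?S = "cball (0 :: real^'n) 1"
  have le1: "\<bar>\<phi> x\<bar> \<le> 1" for x by (simp add: \<phi>_def exp_bump_def)
  have supp: "\<phi> x = 0" if "x \<notin> ?S" for x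
  proof -
    have "1 < norm x" using that by simp
    then have "1 < norm x * norm x" by (intro less_1_mult)
    then show ?thesis by (simp add: \<phi>_def exp_bump_def dot_square_norm power2_eq_square)
  qed
  have fin: "emeasure lborel ?S < \<infinity>" by (intro emeasure_bounded_finite bounded_cball)
  obtain L where L: "0 \<le> L" "\<And>x y. x \<in> ?S \<Longrightarrow> qdist x y < 1 \<Longrightarrow> \<bar>\<phi> x - \<phi> y\<bar> \<le> L * qdist x y"
    using test_function_lipschitz[OF sm compact_cball] by blast
  have "gag \<phi> < \<infinity>"
    by (rule gag_finite_of_lipschitz[OF _ le1 _ fin supp L(2) L(1) s_lt_1]) auto
  moreover have "(\<integral>\<^sup>+x. ennreal (\<bar>\<phi> x\<bar> powr p) \<partial>lborel) \<le> (\<integral>\<^sup>+x. indicator ?S x \<partial>lborel)"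
  proof (intro nn_integral_mono)
    fix x
    have "\<bar>\<phi> x\<bar> powr p \<le> 1 powr p" using le1 p_pos by (intro powr_mono2) auto
    then show "ennreal (\<bar>\<phi> x\<bar> powr p) \<le> indicator ?S x"
      using supp[of x] by (auto simp: indicator_def ennreal_le_1)
  qed
  ultimately have "snorm \<phi> < \<infinity>" using fin by (simp add: snorm_def le_less_trans)
  moreover have "nonzero \<phi>"
  proof -
    have "\<not> (AE x in lborel. \<phi> x = 0)"
    proof
      assume "AE x in lborel. \<phi> x = 0"
      then have "AE x in lborel. x \<notin> ball (0 :: real^'n) 1"
      proof eventually_elim
        case (elim x)
        show ?case
        proof
          assume "x \<in> ball 0 1"
          then have "norm x * norm x < 1" using mult_left_le_one_le[of "norm x" "norm x"] by (simp add: mult_less_cancel_left)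
          then show False using elim by (simp add: \<phi>_def exp_bump_def dot_square_norm power2_eq_square)
        qed
      qed
      then have "ball (0 :: real^'n) 1 \<in> null_sets lborel" by (subst AE_iff_null_sets) auto
      then show False using open_not_null_sets[OF open_ball, of "0 :: real^'n" 1] by simp
    qed
    then show ?thesis by (simp add: nonzero_def)
  qed
  ultimately show ?thesis using t snorm_zero
    by (intro bexI[of _ \<phi>]) (auto simp: W0_iff intro!: bexI[of _ \<phi>])
qed

end

section \<open>Minimisers of the Sobolev quotient\<close>

inductive_set midpoint_hull :: "('a \<Rightarrow> real) set \<Rightarrow> ('a \<Rightarrow> real) set" for U where
  base: "u \<in> U \<Longrightarrow> u \<in> midpoint_hull U"
| mid: "u \<in> midpoint_hull U \<Longrightarrow> v \<in> midpoint_hull U \<Longrightarrow> (\<lambda>x. (u x + v x) / 2) \<in> midpoint_hull U"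

lemma midpoint_hull_mono:
  assumes "U \<subseteq> V"
  shows "midpoint_hull U \<subseteq> midpoint_hull V"
proof
  fix w assume "w \<in> midpoint_hull U"
  then show "w \<in> midpoint_hull V"
    by induction (use assms in \<open>auto intro: midpoint_hull.intros\<close>)
qed

lemma midpoint_hull_close:
  assumes "w \<in> midpoint_hull U" "\<And>u. u \<in> U \<Longrightarrow> \<bar>u x - c\<bar> \<le> e"
  shows "\<bar>w x - c\<bar> \<le> e"
  using assms(1)
proof induction
  case (mid u v)
  then show ?case by (simp add: abs_le_iff field_simps)
qed (rule assms(2))

lemma AE_pair_fst_snd:
  fixes P :: "'a::euclidean_space \<Rightarrow> bool"
  assumes "AE x in lborel. P x"
  shows "AE z in (lborel :: 'a measure) \<Otimes>\<^sub>M (lborel :: 'a measure). P (fst z) \<and> P (snd z)"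
proof -
  obtain N where N: "N \<in> null_sets lborel" "{x. \<not> P x} \<subseteq> N"
    using assms by (auto simp: eventually_ae_filter)
  have [measurable]: "N \<in> sets lborel" using N(1) by auto
  have "N \<times> UNIV \<in> null_sets ((lborel :: 'a measure) \<Otimes>\<^sub>M (lborel :: 'a measure))"
    using N(1) lborel.emeasure_pair_measure_Times[of N "lborel :: 'a measure" UNIV] by auto
  moreover have "UNIV \<times> N \<in> null_sets ((lborel :: 'a measure) \<Otimes>\<^sub>M (lborel :: 'a measure))"
    using N(1) lborel.emeasure_pair_measure_Times[of UNIV "lborel :: 'a measure" N] by auto
  ultimately have "N \<times> UNIV \<union> UNIV \<times> N \<in> null_sets ((lborel :: 'a measure) \<Otimes>\<^sub>M (lborel :: 'a measure))"
    by (rule null_sets.Un)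
  then show ?thesis by (rule AE_I') (use N(2) in force)
qed

lemma powr_add_gt_1:
  fixes t \<theta> :: real
  assumes "0 < t" "t < 1" "0 < \<theta>" "\<theta> < 1"
  shows "1 < t powr \<theta> + (1 - t) powr \<theta>"
proof -
  have "t powr 1 < t powr \<theta>" "(1 - t) powr 1 < (1 - t) powr \<theta>"
    using assms by (intro powr_less_mono'; simp)+
  then show ?thesis using assms by simp
qed

context fractional_sobolev
begin

definition seminorm_pow :: "(real^'n \<Rightarrow> real) \<Rightarrow> real" where
  "seminorm_pow u = (\<integral>z. \<bar>incr u z\<bar> powr p \<partial>kmeas)"

definition mass :: "real \<Rightarrow> (real^'n \<Rightarrow> real) \<Rightarrow> real" where
  "mass r u = (\<integral>x. \<bar>u x\<bar> powr r \<partial>lborel)"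

definition norm_pow :: "(real^'n \<Rightarrow> real) \<Rightarrow> real" where
  "norm_pow u = seminorm_pow u + mass p u"

lemma mass_nonneg: "0 \<le> mass r u" and seminorm_pow_nonneg: "0 \<le> seminorm_pow u"
  by (simp_all add: mass_def seminorm_pow_def)

lemma norm_pow_nonneg: "0 \<le> norm_pow u"
  by (simp add: norm_pow_def mass_nonneg seminorm_pow_nonneg)

lemma finite_snorm_integrable:
  assumes [measurable]: "u \<in> borel_measurable borel" and fin: "snorm u < \<infinity>"
  shows "integrable lborel (\<lambda>x. \<bar>u x\<bar> powr p)" "integrable kmeas (\<lambda>z. \<bar>incr u z\<bar> powr p)"
  using fin by (auto simp: integrable_iff_nn_integral_finite snorm_def gag_eq_kmeas)

lemma W0_integrable:
  assumes "u \<in> W0"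
  shows "integrable lborel (\<lambda>x. \<bar>u x\<bar> powr p)" "integrable kmeas (\<lambda>z. \<bar>incr u z\<bar> powr p)"
  using finite_snorm_integrable[OF W0_measurable[OF assms] W0_snorm[OF assms]] by auto

lemma gag_eq_seminorm_pow:
  assumes "u \<in> W0"
  shows "gag u = ennreal (seminorm_pow u)"
  using gag_eq_kmeas[OF W0_measurable[OF assms]] nn_integral_eq_integral[OF W0_integrable(2)[OF assms]]
  by (simp add: seminorm_pow_def)

lemma nn_integral_eq_mass:
  assumes "integrable lborel (\<lambda>x. \<bar>u x\<bar> powr r)"
  shows "(\<integral>\<^sup>+x. ennreal (\<bar>u x\<bar> powr r) \<partial>lborel) = ennreal (mass r u)"
  using nn_integral_eq_integral[OF assms] by (simp add: mass_def)

lemma snorm_eq_norm_pow: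
  assumes "u \<in> W0"
  shows "snorm u = ennreal (norm_pow u)"
  unfolding snorm_def norm_pow_def gag_eq_seminorm_pow[OF assms] nn_integral_eq_mass[OF W0_integrable(1)[OF assms]]
  by (simp add: mass_nonneg seminorm_pow_nonneg add.commute flip: ennreal_plus)

lemma norm_pow_cmult:
  assumes "u \<in> W0"
  shows "norm_pow (\<lambda>x. c * u x) = \<bar>c\<bar> powr p * norm_pow u"
proof -
  have "ennreal (norm_pow (\<lambda>x. c * u x)) = ennreal (\<bar>c\<bar> powr p * norm_pow u)"
    using snorm_cmult[OF W0_measurable[OF assms], of c]
    by (simp add: snorm_eq_norm_pow assms W0_cmult ennreal_mult norm_pow_nonneg)
  then show ?thesis by (simp add: norm_pow_nonneg)
qed

lemma mass_cmult: "mass r (\<lambda>x. c * u x) = \<bar>c\<bar> powr r * mass r u"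
  by (simp add: mass_def abs_mult powr_mult)

lemma incr_AE_tendsto:
  assumes "AE x in lborel. (\<lambda>n. f n x) \<longlonglongrightarrow> g x"
  shows "AE z in kmeas. (\<lambda>n. incr (f n) z) \<longlonglongrightarrow> incr g z"
proof -
  have "AE z in lborel \<Otimes>\<^sub>M lborel. (\<lambda>n. incr (f n) z) \<longlonglongrightarrow> incr g z"
    using AE_pair_fst_snd[OF assms] by eventually_elim (auto simp: incr_def intro: tendsto_diff)
  then show ?thesis unfolding kmeas_def by (subst AE_density) auto
qed

lemma snorm_fatou:
  assumes f[measurable]: "\<And>n. f n \<in> borel_measurable borel" and g[measurable]: "g \<in> borel_measurable borel"
    and lim: "AE x in lborel. (\<lambda>n. f n x) \<longlonglongrightarrow> g x"
    and le: "\<And>n. snorm (f n) \<le> ennreal e" and e: "0 \<le> e"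
  shows "snorm g \<le> ennreal (2 * e)"
proof -
  have fin: "snorm (f n) < \<infinity>" for n using le[of n] by (simp add: le_less_trans)
  have int: "integrable lborel (\<lambda>x. \<bar>f n x\<bar> powr p)" "integrable kmeas (\<lambda>z. \<bar>incr (f n) z\<bar> powr p)" for n
    using finite_snorm_integrable[OF f fin] by auto
  have b1: "(\<integral>x. \<bar>f n x\<bar> powr p \<partial>lborel) \<le> e" for n
    using snorm_leD(2)[OF le[of n]] e by (simp add: nn_integral_eq_integral[OF int(1)])
  have b2: "(\<integral>z. \<bar>incr (f n) z\<bar> powr p \<partial>kmeas) \<le> e" for n
    using snorm_leD(1)[OF le[of n]] e by (simp add: gag_eq_kmeas nn_integral_eq_integral[OF int(2)])
  have g1: "(\<integral>\<^sup>+x. ennreal (\<bar>g x\<bar> powr p) \<partial>lborel) \<le> ennreal e"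
    using brezis_lieb_integrable[OF p_pos _ _ lim int(1) b1] brezis_lieb_le[OF p_pos _ _ lim int(1) b1]
    by (simp add: nn_integral_eq_integral ennreal_leI)
  have g2: "gag g \<le> ennreal e"
    using brezis_lieb_integrable[OF p_pos _ _ incr_AE_tendsto[OF lim] int(2) b2]
      brezis_lieb_le[OF p_pos _ _ incr_AE_tendsto[OF lim] int(2) b2]
    by (simp add: gag_eq_kmeas nn_integral_eq_integral ennreal_leI)
  show ?thesis unfolding snorm_def using add_mono[OF g1 g2] e by (simp flip: ennreal_plus)
qed

text \<open>Mazur's lemma without duality: near-minimisers of the norm over the convex hulls of the tails
  form a Cauchy sequence by uniform convexity, and they converge pointwise to the same limit.\<close>

lemma W0_weakly_closed:
  assumes u: "\<And>n. u n \<in> W0" and bound: "\<And>n. norm_pow (u n) \<le> R"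
    and g[measurable]: "g \<in> borel_measurable borel"
    and lim: "AE x in lborel. (\<lambda>n. u n x) \<longlonglongrightarrow> g x"
  shows "g \<in> W0"
proof -
  define H where "H n = midpoint_hull (u ` {n..})" for n
  have H_W0: "w \<in> W0" if "w \<in> H n" for w n
    using that unfolding H_def
  proof induction
    case (mid a b)
    have "(\<lambda>x. (1 / 2) * (a x + b x)) \<in> W0" by (intro W0_cmult W0_add mid.IH)
    then show ?case by simp
  qed (use u in auto)
  have H_mono: "H m \<subseteq> H n" if "n \<le> m" for m n
    unfolding H_def using that by (intro midpoint_hull_mono) auto
  have u_H: "u n \<in> H n" for n unfolding H_def by (intro midpoint_hull.base) auto
  define d where "d n = Inf (norm_pow ` H n)" for n
  have bdd: "bdd_below (norm_pow ` H n)" for n using norm_pow_nonneg by (intro bdd_belowI2[of _ 0])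
  have d_le: "d n \<le> norm_pow w" if "w \<in> H n" for w n
    unfolding d_def using that by (intro cInf_lower bdd) auto
  have d_mono: "d n \<le> d m" if "n \<le> m" for m n
    unfolding d_def using H_mono[OF that] u_H[of m] bdd by (intro cInf_superset_mono) auto
  have d_R: "d n \<le> R" for n using d_le[OF u_H] bound by (rule order_trans)
  obtain D where D: "d \<longlonglongrightarrow> D"
  proof -
    have "incseq d" using d_mono by (simp add: incseq_def)
    then show thesis using incseq_convergent[of d R] d_R that by blast
  qed
  have d_D: "d n \<le> D" for n using d_mono D by (intro incseq_le) (auto simp: incseq_def)
  have D_R: "D \<le> R" using d_R D by (intro LIMSEQ_le_const2) auto
  have "\<exists>w\<in>H n. norm_pow w < d n + 1 / real (Suc n)" for n
    using cInf_lessD[of "norm_pow ` H n" "d n + 1 / real (Suc n)"] u_H[of n] by (auto simp: d_def)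
  then obtain v where v: "\<And>n. v n \<in> H n" "\<And>n. norm_pow (v n) < d n + 1 / real (Suc n)" by metis
  have v_W0: "v n \<in> W0" for n using v(1) H_W0 by blast
  note [measurable] = W0_measurable[OF v_W0]
  have v_le: "norm_pow (v n) \<le> D + 1 / real (Suc n)" for n using v(2)[of n] d_D[of n] by linarith
  have v_R: "norm_pow (v n) \<le> R + 1" for n
  proof -
    have "1 / real (Suc n) \<le> 1" by simp
    then show ?thesis using v_le[of n] D_R by linarith
  qed
  have R0: "0 \<le> R" using norm_pow_nonneg[of "u 0"] bound[of 0] by linarith
  have cauchy: "\<exists>N. \<forall>m\<ge>N. snorm (\<lambda>x. v N x - v m x) \<le> ennreal e" if e: "0 < e" for e
  proof -
    define \<epsilon> where "\<epsilon> = e / (4 * (R + 1))"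
    have \<epsilon>: "0 < \<epsilon>" "\<epsilon> * (2 * (R + 1)) = e / 2" using e R0 by (auto simp: \<epsilon>_def field_simps)
    obtain C where C: "0 \<le> C" "\<And>u v. u \<in> borel_measurable borel \<Longrightarrow> v \<in> borel_measurable borel \<Longrightarrow>
      snorm (\<lambda>x. u x - v x) + ennreal C * snorm (\<lambda>x. (u x + v x) / 2) \<le> ennreal (\<epsilon> + C / 2) * (snorm u + snorm v)"
      using uniform_convexity[OF \<epsilon>(1)] by blast
    have "(\<lambda>n. C * ((D - d n) + 1 / real (Suc n))) \<longlonglongrightarrow> C * ((D - D) + 0)"
      using LIMSEQ_inverse_real_of_nat by (intro tendsto_intros D) (simp add: inverse_eq_divide)
    then have "\<forall>\<^sub>F n in sequentially. C * ((D - d n) + 1 / real (Suc n)) < e / 2"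
      using e by (intro order_tendstoD(2)) auto
    then obtain N where N: "C * ((D - d N) + 1 / real (Suc N)) < e / 2"
      using eventually_happens'[OF sequentially_bot] by blast
    have "snorm (\<lambda>x. v N x - v m x) \<le> ennreal e" if m: "N \<le> m" for m
    proof -
      let ?mid = "\<lambda>x. (v N x + v m x) / 2"
      have "v m \<in> H N" using v(1)[of m] H_mono[OF m] by blast
      then have mid: "?mid \<in> H N" unfolding H_def using v(1)[of N] by (intro midpoint_hull.mid) (auto simp: H_def)
      have dW: "(\<lambda>x. v N x - v m x) \<in> W0" by (intro W0_diff v_W0)
      have "ennreal (norm_pow (\<lambda>x. v N x - v m x) + C * norm_pow ?mid)
        \<le> ennreal ((\<epsilon> + C / 2) * (norm_pow (v N) + norm_pow (v m)))"
        using C(2)[OF W0_measurable[OF v_W0[of N]] W0_measurable[OF v_W0[of m]]] C(1) \<epsilon>(1)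
        by (simp add: snorm_eq_norm_pow v_W0 dW H_W0[OF mid] ennreal_mult ennreal_plus norm_pow_nonneg del: ennreal_plus_if)
      then have "norm_pow (\<lambda>x. v N x - v m x) + C * norm_pow ?mid \<le> (\<epsilon> + C / 2) * (norm_pow (v N) + norm_pow (v m))"
        using C(1) \<epsilon>(1) by (subst (asm) ennreal_le_iff) (auto simp: norm_pow_nonneg)
      moreover have "C * d N \<le> C * norm_pow ?mid" using d_le[OF mid] C(1) by (rule mult_left_mono)
      moreover have "\<epsilon> * (norm_pow (v N) + norm_pow (v m)) \<le> \<epsilon> * (2 * (R + 1))"
        using v_R[of N] v_R[of m] \<epsilon>(1) by (intro mult_left_mono) auto
      moreover have "C / 2 * (norm_pow (v N) + norm_pow (v m)) \<le> C / 2 * (2 * (D + 1 / real (Suc N)))"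
      proof (intro mult_left_mono)
        have "1 / real (Suc m) \<le> 1 / real (Suc N)" using m by (simp add: field_simps)
        then have "norm_pow (v m) \<le> D + 1 / real (Suc N)"
          by (rule order_trans[OF v_le add_left_mono])
        then show "norm_pow (v N) + norm_pow (v m) \<le> 2 * (D + 1 / real (Suc N))"
          unfolding mult_2 by (rule add_mono[OF v_le])
      qed (use C(1) in auto)
      moreover have "(\<epsilon> + C / 2) * (norm_pow (v N) + norm_pow (v m))
          = \<epsilon> * (norm_pow (v N) + norm_pow (v m)) + C / 2 * (norm_pow (v N) + norm_pow (v m))"
        by (rule distrib_right)
      moreover have "C / 2 * (2 * (D + 1 / real (Suc N))) - C * d N = C * ((D - d N) + 1 / real (Suc N))"
        by (simp add: algebra_simps)
      ultimately have "norm_pow (\<lambda>x. v N x - v m x) \<le> e" using N \<epsilon>(2) by linarith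
      then show ?thesis by (simp add: snorm_eq_norm_pow[OF dW] ennreal_leI)
    qed
    then show ?thesis by blast
  qed
  have v_lim: "AE x in lborel. (\<lambda>n. v n x) \<longlonglongrightarrow> g x"
    using lim
  proof eventually_elim
    case (elim x)
    show ?case
    proof (rule LIMSEQ_I)
      fix e :: real assume e: "0 < e"
      then obtain N where N: "\<And>n. N \<le> n \<Longrightarrow> norm (u n x - g x) < e / 2"
        using LIMSEQ_D[OF elim half_gt_zero[OF e]] by blast
      have "norm (v n x - g x) < e" if "N \<le> n" for n
      proof -
        have "v n \<in> midpoint_hull (u ` {N..})" using v(1)[of n] H_mono[OF that] by (auto simp: H_def)
        then have "\<bar>v n x - g x\<bar> \<le> e / 2"
          by (rule midpoint_hull_close) (use N in \<open>auto intro: less_imp_le\<close>)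
        then show ?thesis using e by simp
      qed
      then show "\<exists>N. \<forall>n\<ge>N. norm (v n x - g x) < e" by blast
    qed
  qed
  show ?thesis
  proof (rule W0_closed)
    fix \<epsilon> :: real assume \<epsilon>: "0 < \<epsilon>"
    then obtain N where N: "\<forall>m\<ge>N. snorm (\<lambda>x. v N x - v m x) \<le> ennreal (\<epsilon> / 4)" using cauchy[of "\<epsilon> / 4"] by auto
    have "snorm (\<lambda>x. v N x - g x) \<le> ennreal (2 * (\<epsilon> / 4))"
    proof (rule snorm_fatou[where f = "\<lambda>m x. v N x - v (m + N) x"])
      show "AE x in lborel. (\<lambda>m. v N x - v (m + N) x) \<longlonglongrightarrow> v N x - g x"
        using v_lim by eventually_elim (intro tendsto_diff tendsto_const LIMSEQ_ignore_initial_segment)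
      show "snorm (\<lambda>x. v N x - v (m + N) x) \<le> ennreal (\<epsilon> / 4)" for m using N by simp
    qed (use \<epsilon> in auto)
    moreover have "snorm (\<lambda>x. g x - v N x) = snorm (\<lambda>x. v N x - g x)"
      using snorm_cmult[of "\<lambda>x. v N x - g x" "-1"] by simp
    moreover have "ennreal (2 * (\<epsilon> / 4)) < ennreal \<epsilon>" using \<epsilon> by (intro ennreal_lessI) auto
    ultimately show "\<exists>w\<in>W0. snorm (\<lambda>x. g x - w x) < ennreal \<epsilon>"
      by (intro bexI[of _ "v N"]) (auto simp: v_W0)
  qed simp
qed

end

locale subcritical = fractional_sobolev G k deg \<nu> Q s p
  for G :: "(real^'n) monoid" (structure) and k :: nat and deg :: "'n \<Rightarrow> nat"
    and \<nu> :: "real^'n \<Rightarrow> real" and Q s p :: real +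
  fixes q :: real
  assumes p_less_q: "p < q" and q_subcritical: "q < Q * p / (Q - p * s)"
begin

lemma q_pos: "0 < q" and q_gt_1: "1 < q"
  using p_less_q p_gt by auto

lemma mass_q_bound:
  assumes "0 \<le> R"
  obtains A where "0 \<le> A" "\<And>u. u \<in> W0 \<Longrightarrow> norm_pow u \<le> R \<Longrightarrow> integrable lborel (\<lambda>x. \<bar>u x\<bar> powr q) \<and> mass q u \<le> A"
proof -
  have "subcritical_bound q" using p_less_q q_subcritical by (intro subcritical_embedding) auto
  with assms obtain A where A: "0 \<le> A" "\<forall>u\<in>borel_measurable borel. snorm u \<le> ennreal R \<longrightarrow>
     (\<integral>\<^sup>+x. ennreal (\<bar>u x\<bar> powr q) \<partial>lborel) \<le> ennreal A"
    unfolding subcritical_bound_def by blast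
  have "integrable lborel (\<lambda>x. \<bar>u x\<bar> powr q) \<and> mass q u \<le> A" if u: "u \<in> W0" and le: "norm_pow u \<le> R" for u
  proof -
    note [measurable] = W0_measurable[OF u]
    have nn: "(\<integral>\<^sup>+x. ennreal (\<bar>u x\<bar> powr q) \<partial>lborel) \<le> ennreal A"
      using A(2) W0_measurable[OF u] snorm_eq_norm_pow[OF u] le by (auto simp: ennreal_leI)
    then have int: "integrable lborel (\<lambda>x. \<bar>u x\<bar> powr q)"
      by (subst integrable_iff_nn_integral_finite) (auto simp: le_less_trans)
    with nn A(1) show ?thesis by (simp add: nn_integral_eq_mass)
  qed
  with A(1) show thesis by (rule that)
qed

lemma W0_integrable_q:
  assumes "u \<in> W0"
  shows "integrable lborel (\<lambda>x. \<bar>u x\<bar> powr q)"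
  using mass_q_bound[OF norm_pow_nonneg[of u]] assms by (metis order_refl)

lemma nonzero_mass_pos:
  assumes int: "integrable lborel (\<lambda>x. \<bar>u x\<bar> powr r)" and nz: "nonzero u"
  shows "0 < mass r u"
proof (rule ccontr)
  assume "\<not> 0 < mass r u"
  then have "mass r u = 0" using mass_nonneg[of r u] by simp
  then have "AE x in lborel. \<bar>u x\<bar> powr r = 0"
    using int by (simp add: mass_def integral_nonneg_eq_0_iff_AE)
  then have "AE x in lborel. u x = 0" by eventually_elim simp
  with nz show False by (simp add: nonzero_def)
qed

lemma nonzero_of_mass:
  assumes [measurable]: "u \<in> borel_measurable borel" and ne: "mass r u \<noteq> 0"
  shows "nonzero u"
  unfolding nonzero_def
proof
  assume "AE x in lborel. u x = 0"
  then have "mass r u = (\<integral>x. 0 \<partial>(lborel :: (real^'n) measure))"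
    unfolding mass_def by (intro integral_cong_AE) (auto elim: eventually_mono)
  with ne show False by simp
qed

definition sphere_q :: "(real^'n \<Rightarrow> real) set" where
  "sphere_q = {u \<in> W0. mass q u = 1}"

definition best_quotient :: real where
  "best_quotient = Inf (norm_pow ` sphere_q)"

lemma normalise_mass:
  assumes u: "u \<in> W0" and X: "0 < mass q u"
  shows "(\<lambda>x. mass q u powr (- 1 / q) * u x) \<in> sphere_q"
    "norm_pow (\<lambda>x. mass q u powr (- 1 / q) * u x) = mass q u powr (- (p / q)) * norm_pow u"
proof -
  let ?c = "mass q u powr (- 1 / q)"
  have "?c powr q = mass q u powr (- 1)" "?c powr p = mass q u powr (- (p / q))"
    using q_pos by (simp_all add: powr_powr)
  moreover have "mass q u powr (- 1) * mass q u = 1" using X by (simp add: powr_minus)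
  ultimately show "(\<lambda>x. ?c * u x) \<in> sphere_q" "norm_pow (\<lambda>x. ?c * u x) = mass q u powr (- (p / q)) * norm_pow u"
    by (simp_all only: sphere_q_def mem_Collect_eq W0_cmult[OF u] mass_cmult norm_pow_cmult[OF u]
        abs_of_nonneg powr_ge_zero simp_thms)
qed

lemma sphere_q_nonempty: "sphere_q \<noteq> {}"
proof -
  obtain u where u: "u \<in> W0" "nonzero u" using ex_nonzero_W0 by blast
  have "0 < mass q u" by (rule nonzero_mass_pos[OF W0_integrable_q[OF u(1)] u(2)])
  from normalise_mass(1)[OF u(1) this] show ?thesis by blast
qed

lemma best_quotient_le: "u \<in> sphere_q \<Longrightarrow> best_quotient \<le> norm_pow u"
  unfolding best_quotient_def using norm_pow_nonneg by (intro cInf_lower bdd_belowI2[of _ 0]) auto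

lemma sobolev_inequality:
  assumes u: "u \<in> W0"
  shows "best_quotient * mass q u powr (p / q) \<le> norm_pow u"
proof (cases "mass q u = 0")
  case False
  then have X: "0 < mass q u" using mass_nonneg[of q u] by simp
  have "best_quotient \<le> mass q u powr (- (p / q)) * norm_pow u"
    using best_quotient_le[OF normalise_mass(1)[OF u X]] normalise_mass(2)[OF u X] by simp
  then show ?thesis using X by (simp add: powr_minus field_simps)
qed (use norm_pow_nonneg in simp)

lemma best_quotient_pos: "0 < best_quotient"
proof -
  obtain A where A: "0 \<le> A" "\<And>u. u \<in> W0 \<Longrightarrow> norm_pow u \<le> 1 \<Longrightarrow> integrable lborel (\<lambda>x. \<bar>u x\<bar> powr q) \<and> mass q u \<le> A"
    using mass_q_bound[of 1] by auto
  have "(A + 1) powr (- (p / q)) \<le> norm_pow u" if u: "u \<in> sphere_q" for u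
  proof -
    have uW: "u \<in> W0" and X: "mass q u = 1" using u by (auto simp: sphere_q_def)
    have "nonzero u" using X W0_measurable[OF uW] by (intro nonzero_of_mass[of _ q]) auto
    then have "0 < mass p u" by (rule nonzero_mass_pos[OF W0_integrable(1)[OF uW]])
    then have F: "0 < norm_pow u" using seminorm_pow_nonneg[of u] by (simp add: norm_pow_def)
    let ?c = "norm_pow u powr (- 1 / p)"
    have c: "?c powr p = norm_pow u powr (- 1)" using p_pos by (simp add: powr_powr)
    have "norm_pow (\<lambda>x. ?c * u x) = ?c powr p * norm_pow u"
      by (simp only: norm_pow_cmult[OF uW] abs_of_nonneg powr_ge_zero)
    also have "\<dots> = 1" unfolding c using F by (simp add: powr_minus)
    finally have "norm_pow (\<lambda>x. ?c * u x) = 1" .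
    then have "mass q (\<lambda>x. ?c * u x) \<le> A" using A(2)[OF W0_cmult[OF uW, of ?c]] by simp
    then have "norm_pow u powr (- (q / p)) \<le> A" using X by (simp add: mass_cmult powr_powr)
    then have "norm_pow u powr (- (q / p)) \<le> A + 1" by simp
    then have "(A + 1) powr (- (p / q)) \<le> (norm_pow u powr (- (q / p))) powr (- (p / q))"
      using F p_pos q_pos by (intro powr_mono2') auto
    also have "\<dots> = norm_pow u" using F p_pos q_pos by (simp add: powr_powr)
    finally show ?thesis .
  qed
  then have "(A + 1) powr (- (p / q)) \<le> best_quotient"
    unfolding best_quotient_def using sphere_q_nonempty by (intro cInf_greatest) auto
  moreover have "0 < (A + 1) powr (- (p / q))" using A(1) by simp
  ultimately show ?thesis by linarith
qed

lemma mass_left_mult: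
  assumes "u \<in> borel_measurable borel"
  shows "mass r (\<lambda>x. u (z \<otimes> x)) = mass r u"
  unfolding mass_def
  using assms by (subst (2) lborel_distr_left_mult[of z, symmetric]) (simp add: integral_distr)

lemma norm_pow_left_mult:
  assumes u: "u \<in> W0"
  shows "norm_pow (\<lambda>x. u (z \<otimes> x)) = norm_pow u"
proof -
  have "ennreal (norm_pow (\<lambda>x. u (z \<otimes> x))) = ennreal (norm_pow u)"
    using snorm_left_mult[OF W0_measurable[OF u], of z]
    by (simp add: snorm_eq_norm_pow[OF u] snorm_eq_norm_pow[OF W0_left_mult[OF u]])
  then show ?thesis by (simp add: norm_pow_nonneg)
qed

lemma limit_nonzero:
  fixes u :: "nat \<Rightarrow> real^'n \<Rightarrow> real"
  assumes u: "\<And>n. u n \<in> sphere_q" and \<eta>: "0 < \<eta>"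
    and conc: "\<And>n. ennreal \<eta> < (\<integral>\<^sup>+y\<in>{y. qdist 0 y < 1}. ennreal (\<bar>u n y\<bar> powr p) \<partial>lborel)"
    and lim: "AE x in lborel. (\<lambda>n. u n x) \<longlonglongrightarrow> v x"
  shows "nonzero v"
  unfolding nonzero_def
proof
  assume v0: "AE x in lborel. v x = 0"
  have uW: "u n \<in> W0" and X: "mass q (u n) = 1" for n using u[of n] by (auto simp: sphere_q_def)
  note [measurable] = W0_measurable[OF uW]
  let ?B = "{y. qdist 0 y < 1}"
  have [measurable]: "?B \<in> sets borel" using open_kernel_ball by simp
  define L where "L = (\<eta> / 2) powr (1 / (p - q))"
  have L: "0 < L" "L powr (p - q) = \<eta> / 2" using \<eta> p_less_q by (auto simp: L_def powr_powr)
  let ?m = "\<lambda>n y. indicator ?B y * min \<bar>u n y\<bar> L powr p"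
  have bint: "integrable lborel (\<lambda>y. indicator ?B y * L powr p)" by (rule integrable_ball_const(1)) simp
  have mint: "integrable lborel (?m n)" for n
  proof (rule Bochner_Integration.integrable_bound[OF bint])
    show "AE y in lborel. norm (?m n y) \<le> norm (indicator ?B y * L powr p)"
      using L(1) p_pos by (auto split: split_indicator intro!: powr_mono2)
  qed simp
  have "(\<lambda>n. \<integral>y. ?m n y \<partial>lborel) \<longlonglongrightarrow> (\<integral>y. 0 \<partial>(lborel :: (real^'n) measure))"
  proof (rule integral_dominated_convergence[OF _ _ bint])
    show "AE y in lborel. (\<lambda>n. ?m n y) \<longlonglongrightarrow> 0"
      using lim v0
    proof eventually_elim
      case (elim y)
      have "(\<lambda>n. min \<bar>u n y\<bar> L) \<longlonglongrightarrow> min \<bar>v y\<bar> L"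
        by (intro tendsto_min tendsto_rabs tendsto_const elim(1))
      then have "(\<lambda>n. min \<bar>u n y\<bar> L) \<longlonglongrightarrow> 0" using elim(2) L(1) by simp
      then have "(\<lambda>n. min \<bar>u n y\<bar> L powr p) \<longlonglongrightarrow> 0"
        using L(1) p_pos by (intro tendsto_zero_powrI[where b = p]) auto
      then show ?case by (intro tendsto_mult_right_zero)
    qed
    show "AE y in lborel. norm (?m n y) \<le> indicator ?B y * L powr p" for n
      using L(1) p_pos by (auto split: split_indicator intro!: powr_mono2)
  qed auto
  then have "(\<lambda>n. \<integral>y. ?m n y \<partial>lborel) \<longlonglongrightarrow> 0" by simp
  then have "\<forall>\<^sub>F n in sequentially. (\<integral>y. ?m n y \<partial>lborel) < \<eta> / 2"
    using \<eta> by (intro order_tendstoD(2)) auto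
  then obtain n where n: "(\<integral>y. ?m n y \<partial>lborel) < \<eta> / 2"
    using eventually_happens'[OF sequentially_bot] by blast
  have "(\<integral>\<^sup>+y\<in>?B. ennreal (\<bar>u n y\<bar> powr p) \<partial>lborel)
      \<le> (\<integral>\<^sup>+y. ennreal (?m n y + L powr (p - q) * \<bar>u n y\<bar> powr q) \<partial>lborel)"
  proof (intro nn_integral_mono)
    fix y
    have "\<bar>u n y\<bar> powr p \<le> min \<bar>u n y\<bar> L powr p + L powr (p - q) * \<bar>u n y\<bar> powr q"
    proof (cases "\<bar>u n y\<bar> \<le> L")
      case False
      then have "\<bar>u n y\<bar> powr p \<le> L powr p + L powr (p - q) * \<bar>u n y\<bar> powr q"
        using powr_le_threshold[of "\<bar>u n y\<bar>" L p q] L(1) p_pos p_less_q by simp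
      then show ?thesis using False by simp
    qed simp
    then show "ennreal (\<bar>u n y\<bar> powr p) * indicator ?B y
        \<le> ennreal (?m n y + L powr (p - q) * \<bar>u n y\<bar> powr q)"
      by (cases "y \<in> ?B") (simp_all add: ennreal_leI del: ennreal_plus)
  qed
  also have "\<dots> = ennreal ((\<integral>y. ?m n y \<partial>lborel) + L powr (p - q) * mass q (u n))"
    using mint[of n] W0_integrable_q[OF uW[of n]]
    by (subst nn_integral_eq_integral) (auto simp: mass_def)
  also have "\<dots> \<le> ennreal \<eta>" using n L(2) X[of n] by (intro ennreal_leI) simp
  finally show False using conc[of n] by simp
qed

lemma minimiser_exists: "\<exists>u\<in>sphere_q. norm_pow u = best_quotient"
proof -
  let ?S = best_quotient
  have "\<exists>w\<in>sphere_q. norm_pow w < ?S + 1 / real (Suc n)" for n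
    using cInf_lessD[of "norm_pow ` sphere_q" "?S + 1 / real (Suc n)"] sphere_q_nonempty
    by (auto simp: best_quotient_def)
  then obtain w where w: "\<And>n. w n \<in> sphere_q" "\<And>n. norm_pow (w n) < ?S + 1 / real (Suc n)" by metis
  have wW: "w n \<in> W0" and wX: "mass q (w n) = 1" for n using w(1)[of n] by (auto simp: sphere_q_def)
  note [measurable] = W0_measurable[OF wW]
  have wR: "norm_pow (w n) \<le> ?S + 1" for n
  proof -
    have "1 / real (Suc n) \<le> 1" by simp
    then show ?thesis using w(2)[of n] by linarith
  qed
  have R: "0 \<le> ?S + 1" using best_quotient_pos by simp
  obtain \<eta> where \<eta>: "0 < \<eta>" "\<And>u. u \<in> borel_measurable borel \<Longrightarrow> snorm u \<le> ennreal (?S + 1) \<Longrightarrow>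
    (\<And>x. (\<integral>\<^sup>+y\<in>{y. qdist x y < 1}. ennreal (\<bar>u y\<bar> powr p) \<partial>lborel) \<le> ennreal \<eta>) \<Longrightarrow>
    (\<integral>\<^sup>+x. ennreal (\<bar>u x\<bar> powr q) \<partial>lborel) < 1"
    using non_vanishing[OF p_less_q q_subcritical R] by blast
  have "\<exists>x. ennreal \<eta> < (\<integral>\<^sup>+y\<in>{y. qdist x y < 1}. ennreal (\<bar>w n y\<bar> powr p) \<partial>lborel)" for n
  proof (rule ccontr)
    assume "\<nexists>x. ennreal \<eta> < (\<integral>\<^sup>+y\<in>{y. qdist x y < 1}. ennreal (\<bar>w n y\<bar> powr p) \<partial>lborel)"
    then have "(\<integral>\<^sup>+x. ennreal (\<bar>w n x\<bar> powr q) \<partial>lborel) < 1"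
      using wR[of n] by (intro \<eta>(2)) (auto simp: snorm_eq_norm_pow[OF wW] ennreal_leI not_less)
    then show False using wX[of n] by (simp add: nn_integral_eq_mass[OF W0_integrable_q[OF wW]])
  qed
  then obtain z where z: "\<And>n. ennreal \<eta> < (\<integral>\<^sup>+y\<in>{y. qdist (z n) y < 1}. ennreal (\<bar>w n y\<bar> powr p) \<partial>lborel)" by metis
  define u where "u n x = w n (z n \<otimes> x)" for n x
  have uW: "u n \<in> W0" for n unfolding u_def by (rule W0_left_mult[OF wW])
  have uX: "mass q (u n) = 1" for n unfolding u_def by (simp add: mass_left_mult W0_measurable[OF wW] wX)
  have uF: "norm_pow (u n) = norm_pow (w n)" for n unfolding u_def by (rule norm_pow_left_mult[OF wW])
  have conc: "ennreal \<eta> < (\<integral>\<^sup>+y\<in>{y. qdist 0 y < 1}. ennreal (\<bar>u n y\<bar> powr p) \<partial>lborel)" for n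
  proof -
    have [measurable]: "{y. qdist (z n) y < 1} \<in> sets borel" using open_kernel_ball by simp
    have "qdist (z n) (z n \<otimes> y) = qdist 0 y" for y using qdist_left_mult[of "z n" 0 y] by simp
    then have "(\<integral>\<^sup>+y\<in>{y. qdist 0 y < 1}. ennreal (\<bar>u n y\<bar> powr p) \<partial>lborel)
        = (\<integral>\<^sup>+y. (ennreal (\<bar>w n (z n \<otimes> y)\<bar> powr p) * indicator {y. qdist (z n) y < 1} (z n \<otimes> y)) \<partial>lborel)"
      by (intro nn_integral_cong) (simp add: u_def indicator_def)
    also have "\<dots> = (\<integral>\<^sup>+y\<in>{y. qdist (z n) y < 1}. ennreal (\<bar>w n y\<bar> powr p) \<partial>lborel)"
      by (rule nn_integral_left_mult[of "\<lambda>y. ennreal (\<bar>w n y\<bar> powr p) * indicator {y. qdist (z n) y < 1} y"]) measurable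
    finally show ?thesis using z[of n] by simp
  qed
  have uS: "snorm (u n) \<le> ennreal (?S + 1)" for n using wR[of n] by (simp add: snorm_eq_norm_pow[OF uW] uF ennreal_leI)
  obtain r v where r: "strict_mono (r :: nat \<Rightarrow> nat)" and v[measurable]: "v \<in> borel_measurable borel"
    and lim: "AE x in lborel. (\<lambda>n. u (r n) x) \<longlonglongrightarrow> v x"
  proof (rule compactness[OF W0_measurable[OF uW] uS R])
    fix r v assume "strict_mono (r :: nat \<Rightarrow> nat)" "v \<in> borel_measurable borel"
      "AE x in lborel. (\<lambda>n. u (r n) x) \<longlonglongrightarrow> v x"
    then show thesis by (rule that)
  qed
  define f where "f n = u (r n)" for n
  have fW: "f n \<in> W0" and fX: "mass q (f n) = 1" for n by (auto simp: f_def uW uX)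
  note [measurable] = W0_measurable[OF fW]
  have fF: "norm_pow (f n) \<le> ?S + 1" for n using wR[of "r n"] by (simp add: f_def uF)
  have flim: "AE x in lborel. (\<lambda>n. f n x) \<longlonglongrightarrow> v x" using lim by (simp add: f_def)
  have Ftend: "(\<lambda>n. norm_pow (f n)) \<longlonglongrightarrow> ?S"
  proof (rule tendsto_sandwich)
    show "\<forall>\<^sub>F n in sequentially. ?S \<le> norm_pow (f n)"
      using fW fX by (intro always_eventually allI best_quotient_le) (simp add: sphere_q_def)
    show "\<forall>\<^sub>F n in sequentially. norm_pow (f n) \<le> ?S + 1 / real (Suc n)"
    proof (intro always_eventually allI)
      fix n
      have "n \<le> r n" using r by (rule seq_suble)
      then have "1 / real (Suc (r n)) \<le> 1 / real (Suc n)" by (simp add: field_simps)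
      then show "norm_pow (f n) \<le> ?S + 1 / real (Suc n)" using w(2)[of "r n"] by (simp add: f_def uF)
    qed
    have "(\<lambda>n. ?S + 1 / real (Suc n)) \<longlonglongrightarrow> ?S + 0"
      using LIMSEQ_inverse_real_of_nat by (intro tendsto_intros) (simp add: inverse_eq_divide)
    then show "(\<lambda>n. ?S + 1 / real (Suc n)) \<longlonglongrightarrow> ?S" by simp
  qed simp
  have vW: "v \<in> W0" by (rule W0_weakly_closed[OF fW fF v flim])
  have vnz: "nonzero v"
    by (rule limit_nonzero[OF _ \<eta>(1) _ flim]) (use fW fX conc in \<open>auto simp: sphere_q_def f_def\<close>)
  define t where "t = mass q v"
  have tpos: "0 < t" unfolding t_def by (rule nonzero_mass_pos[OF W0_integrable_q[OF vW] vnz])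
  have mp: "mass p (f n) \<le> ?S + 1" and sp: "seminorm_pow (f n) \<le> ?S + 1" for n
    using fF[of n] mass_nonneg[of p "f n"] seminorm_pow_nonneg[of "f n"] by (auto simp: norm_pow_def)
  have fm: "f n \<in> borel_measurable lborel" and vm: "v \<in> borel_measurable lborel" for n by auto
  have fm': "incr (f n) \<in> borel_measurable kmeas" and vm': "incr v \<in> borel_measurable kmeas" for n by auto
  have bq: "(\<integral>x. \<bar>f n x\<bar> powr q \<partial>lborel) \<le> 1" for n using fX[of n] by (simp add: mass_def)
  have t1: "t \<le> 1"
    unfolding t_def mass_def by (rule brezis_lieb_le[OF q_pos fm vm flim W0_integrable_q[OF fW] bq])
  have BLq: "(\<lambda>n. mass q (f n) - mass q (\<lambda>x. f n x - v x)) \<longlonglongrightarrow> t"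
    unfolding t_def mass_def by (rule brezis_lieb_tendsto[OF q_pos fm vm flim W0_integrable_q[OF fW] bq])
  have BLp: "(\<lambda>n. mass p (f n) - mass p (\<lambda>x. f n x - v x)) \<longlonglongrightarrow> mass p v"
    unfolding mass_def
    by (rule brezis_lieb_tendsto[OF p_pos fm vm flim W0_integrable(1)[OF fW] mp[unfolded mass_def]])
  have inc: "incr (\<lambda>x. f n x - v x) = (\<lambda>z. incr (f n) z - incr v z)" for n by (auto simp: incr_def)
  have BLs: "(\<lambda>n. seminorm_pow (f n) - seminorm_pow (\<lambda>x. f n x - v x)) \<longlonglongrightarrow> seminorm_pow v"
    unfolding seminorm_pow_def inc
    by (rule brezis_lieb_tendsto[OF p_pos fm' vm' incr_AE_tendsto[OF flim] W0_integrable(2)[OF fW] sp[unfolded seminorm_pow_def]])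
  have "(\<lambda>n. norm_pow (f n) - ((mass p (f n) - mass p (\<lambda>x. f n x - v x))
      + (seminorm_pow (f n) - seminorm_pow (\<lambda>x. f n x - v x)))) \<longlonglongrightarrow> ?S - (mass p v + seminorm_pow v)"
    by (intro tendsto_diff tendsto_add Ftend BLp BLs)
  then have dF: "(\<lambda>n. norm_pow (\<lambda>x. f n x - v x)) \<longlonglongrightarrow> ?S - norm_pow v"
    by (simp add: norm_pow_def algebra_simps)
  have "(\<lambda>n. 1 - (mass q (f n) - mass q (\<lambda>x. f n x - v x))) \<longlonglongrightarrow> 1 - t"
    by (intro tendsto_diff tendsto_const BLq)
  then have dX: "(\<lambda>n. mass q (\<lambda>x. f n x - v x)) \<longlonglongrightarrow> 1 - t" by (simp add: fX)
  have "(\<lambda>n. ?S * mass q (\<lambda>x. f n x - v x) powr (p / q)) \<longlonglongrightarrow> ?S * (1 - t) powr (p / q)"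
    using p_pos q_pos by (intro tendsto_mult tendsto_const tendsto_powr'[OF dX tendsto_const]) (auto simp: mass_nonneg)
  from LIMSEQ_le[OF this dF] have "?S * (1 - t) powr (p / q) \<le> ?S - norm_pow v"
    using sobolev_inequality[OF W0_diff[OF fW vW]] by blast
  moreover have "?S * t powr (p / q) \<le> norm_pow v" unfolding t_def by (rule sobolev_inequality[OF vW])
  ultimately have "?S * (t powr (p / q) + (1 - t) powr (p / q)) \<le> ?S * 1" by (simp add: distrib_left)
  then have "t powr (p / q) + (1 - t) powr (p / q) \<le> 1" using best_quotient_pos by simp
  then have "t = 1" using powr_add_gt_1[of t "p / q"] tpos t1 p_pos p_less_q by force
  then have vS: "v \<in> sphere_q" using vW by (simp add: sphere_q_def t_def)
  have "0 \<le> ?S - norm_pow v" using dF by (rule LIMSEQ_le_const) (auto simp: norm_pow_nonneg)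
  then have "norm_pow v = ?S" using best_quotient_le[OF vS] by simp
  with vS show ?thesis by blast
qed

definition pairing :: "(real^'n \<Rightarrow> real) \<Rightarrow> (real^'n \<Rightarrow> real) \<Rightarrow> real" where
  "pairing u \<psi> = (\<integral>z. \<bar>incr u z\<bar> powr (p - 2) * incr u z * incr \<psi> z \<partial>kmeas)
     + (\<integral>x. \<bar>u x\<bar> powr (p - 2) * u x * \<psi> x \<partial>lborel)"

definition pairing_q :: "(real^'n \<Rightarrow> real) \<Rightarrow> (real^'n \<Rightarrow> real) \<Rightarrow> real" where
  "pairing_q u \<psi> = (\<integral>x. \<bar>u x\<bar> powr (q - 2) * u x * \<psi> x \<partial>lborel)"

lemma euler_lagrange:
  assumes u: "u \<in> sphere_q" and min: "norm_pow u = best_quotient" and \<psi>: "\<psi> \<in> W0"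
  shows "pairing u \<psi> = best_quotient * pairing_q u \<psi>"
proof -
  let ?S = best_quotient
  have uW: "u \<in> W0" and uX: "mass q u = 1" using u by (auto simp: sphere_q_def)
  note [measurable] = W0_measurable[OF uW] W0_measurable[OF \<psi>]
  let ?g = "\<lambda>t x. u x + t * \<psi> x"
  have inc: "incr (?g t) z = incr u z + t * incr \<psi> z" for t z by (simp add: incr_def algebra_simps)
  have d1: "((\<lambda>t. mass p (?g t)) has_real_derivative p * (\<integral>x. \<bar>u x\<bar> powr (p - 2) * u x * \<psi> x \<partial>lborel)) (at 0)"
    unfolding mass_def by (intro has_real_derivative_integral_abs_powr p_gt W0_integrable uW \<psi>) auto
  have d2: "((\<lambda>t. seminorm_pow (?g t)) has_real_derivative
      p * (\<integral>z. \<bar>incr u z\<bar> powr (p - 2) * incr u z * incr \<psi> z \<partial>kmeas)) (at 0)"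
    unfolding seminorm_pow_def inc
    by (intro has_real_derivative_integral_abs_powr p_gt W0_integrable uW \<psi>) auto
  have d3: "((\<lambda>t. mass q (?g t)) has_real_derivative q * pairing_q u \<psi>) (at 0)"
    unfolding mass_def pairing_q_def
    by (intro has_real_derivative_integral_abs_powr q_gt_1 W0_integrable_q uW \<psi>) auto
  have X0: "mass q (?g 0) = 1" using uX by simp
  have d4: "((\<lambda>t. mass q (?g t) powr (p / q)) has_real_derivative p * pairing_q u \<psi>) (at 0)"
    using DERIV_fun_powr[OF d3, of "p / q"] X0 q_pos by simp
  have "((\<lambda>t. (seminorm_pow (?g t) + mass p (?g t)) - ?S * mass q (?g t) powr (p / q)) has_real_derivative
      (p * (\<integral>z. \<bar>incr u z\<bar> powr (p - 2) * incr u z * incr \<psi> z \<partial>kmeas)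
        + p * (\<integral>x. \<bar>u x\<bar> powr (p - 2) * u x * \<psi> x \<partial>lborel)) - ?S * (p * pairing_q u \<psi>)) (at 0)"
    by (intro DERIV_diff DERIV_add d1 d2 DERIV_cmult d4)
  then have der: "((\<lambda>t. norm_pow (?g t) - ?S * mass q (?g t) powr (p / q)) has_real_derivative
      p * (pairing u \<psi> - ?S * pairing_q u \<psi>)) (at 0)"
    by (simp add: norm_pow_def pairing_def algebra_simps)
  have ge: "norm_pow (?g 0) - ?S * mass q (?g 0) powr (p / q) \<le> norm_pow (?g t) - ?S * mass q (?g t) powr (p / q)" for t
  proof -
    have "?g t \<in> W0" by (intro W0_add W0_cmult uW \<psi>)
    from sobolev_inequality[OF this] show ?thesis using X0 min by simp
  qed
  have "p * (pairing u \<psi> - ?S * pairing_q u \<psi>) = 0"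
    by (rule DERIV_local_min[OF der zero_less_one]) (use ge in blast)
  then show ?thesis using p_pos by simp
qed

end

section \<open>Ground states and the Gagliardo-Nirenberg constant\<close>

lemma abs_powr_times_square:
  fixes t r :: real
  assumes "1 < r"
  shows "\<bar>t\<bar> powr (r - 2) * t * t = \<bar>t\<bar> powr r"
proof (cases "t = 0")
  case False
  have "\<bar>t\<bar> powr ((r - 2) + 2) = \<bar>t\<bar> powr (r - 2) * \<bar>t\<bar> powr 2" by (rule powr_add)
  then show ?thesis using False by (simp add: power2_eq_square)
qed (use assms in simp)

lemma extended_integral_le:
  assumes [measurable]: "f \<in> borel_measurable borel" and h: "integrable lborel h" and le: "\<And>x. f x \<le> h x"
  shows "extended_integral f \<le> ereal (\<integral>x. h x \<partial>lborel)"
proof -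
  let ?P = "\<integral>\<^sup>+x. ennreal (f x) \<partial>lborel" and ?N = "\<integral>\<^sup>+x. ennreal (- f x) \<partial>lborel"
  have "?P \<le> (\<integral>\<^sup>+x. ennreal \<bar>h x\<bar> \<partial>lborel)"
    using le by (intro nn_integral_mono ennreal_leI) (metis abs_ge_self order_trans)
  also have "\<dots> < \<infinity>" using h by (simp add: integrable_iff_bounded)
  finally have P: "?P < \<infinity>" .
  then obtain a where a: "0 \<le> a" "?P = ennreal a" by (cases ?P) auto
  show ?thesis
  proof (cases "?N = \<infinity>")
    case True
    have "extended_integral f = - \<infinity>"
      unfolding extended_integral_def True a(2) using a(1) by (simp add: enn2ereal_ennreal)
    then show ?thesis by simp
  next
    case False
    then have N: "?N < \<infinity>" by (simp add: top.not_eq_extremum)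
    have f: "integrable lborel f"
      using P N by (auto simp: real_integrable_def)
    obtain b where b: "0 \<le> b" "?N = ennreal b" using N by (cases ?N) auto
    have "extended_integral f = ereal (a - b)"
      unfolding extended_integral_def a(2) b(2) using a(1) b(1) by (simp add: enn2ereal_ennreal)
    also have "a - b = (\<integral>x. f x \<partial>lborel)"
      using real_lebesgue_integral_def[OF f] a b by simp
    also have "ereal (\<integral>x. f x \<partial>lborel) \<le> ereal (\<integral>x. h x \<partial>lborel)"
      using f h le by (simp add: integral_mono)
    finally show ?thesis .
  qed
qed

context subcritical
begin

lemma energy_eq:
  assumes "u \<in> W0"
  shows "energy G \<nu> Q s p q u = norm_pow u / p - mass q u / q"
  unfolding energy_def gagliardo_pow_eq gag_eq_seminorm_pow[OF assms]
  by (simp add: seminorm_pow_nonneg norm_pow_def mass_def add_divide_distrib)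

lemma nehari_functional_eq:
  assumes "u \<in> W0"
  shows "nehari_functional G \<nu> Q s p q u = norm_pow u - mass q u"
  unfolding nehari_functional_def gagliardo_pow_eq gag_eq_seminorm_pow[OF assms]
  using W0_integrable(1)[OF assms] W0_integrable_q[OF assms]
  by (simp add: seminorm_pow_nonneg norm_pow_def mass_def)

lemma energy_deriv_eq:
  assumes u: "u \<in> W0" and \<psi>: "\<psi> \<in> W0"
  shows "energy_deriv G \<nu> Q s p q u \<psi> = pairing u \<psi> - pairing_q u \<psi>"
proof -
  note [measurable] = W0_measurable[OF u] W0_measurable[OF \<psi>]
  have m: "(\<lambda>z. \<bar>incr u z\<bar> powr (p - 2) * incr u z * incr \<psi> z) \<in> borel_measurable (borel \<Otimes>\<^sub>M borel)"
    unfolding incr_def by measurable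
  have 1: "(\<integral>(x, y). \<bar>u x - u y\<bar> powr (p - 2) * (u x - u y) * (\<psi> x - \<psi> y)
      / \<nu> (inv y \<otimes> x) powr (Q + p * s) \<partial>(lborel \<Otimes>\<^sub>M lborel))
      = (\<integral>z. \<bar>incr u z\<bar> powr (p - 2) * incr u z * incr \<psi> z \<partial>kmeas)"
    unfolding integral_kmeas[OF m] by (simp add: incr_def qdist_def case_prod_unfold)
  have 2: "(\<integral>x. \<bar>u x\<bar> powr (p - 2) * u x * \<psi> x - \<bar>u x\<bar> powr (q - 2) * u x * \<psi> x \<partial>lborel)
      = (\<integral>x. \<bar>u x\<bar> powr (p - 2) * u x * \<psi> x \<partial>lborel) - pairing_q u \<psi>"
    unfolding pairing_q_def
    by (intro Bochner_Integration.integral_diff integrable_powr_pairing p_gt q_gt_1 W0_integrable W0_integrable_q u \<psi>) auto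
  show ?thesis unfolding energy_deriv_def 1 2 pairing_def by simp
qed

lemma pairing_self: "pairing u u = norm_pow u" and pairing_q_self: "pairing_q u u = mass q u"
  unfolding pairing_def pairing_q_def norm_pow_def seminorm_pow_def mass_def
    abs_powr_times_square[OF p_gt] abs_powr_times_square[OF q_gt_1] by simp_all

definition ground_energy :: real where
  "ground_energy = (1 / p - 1 / q) * best_quotient powr (q / (q - p))"

lemma nehari_energy:
  assumes "u \<in> nehari_set G \<nu> Q s p q"
  shows "u \<in> W0" "ground_energy \<le> energy G \<nu> Q s p q u"
proof -
  show u: "u \<in> W0" using assms by (simp add: nehari_set_def)
  have nz: "nonzero u" and eq: "norm_pow u = mass q u"
    using assms nehari_functional_eq[OF u] by (auto simp: nehari_set_def)
  have X: "0 < mass q u" by (rule nonzero_mass_pos[OF W0_integrable_q[OF u] nz])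
  let ?S = best_quotient
  have "?S * mass q u powr (p / q) \<le> mass q u powr 1"
    using sobolev_inequality[OF u] X by (simp add: eq)
  then have "?S \<le> mass q u powr (1 - p / q)"
    using X by (simp add: powr_diff field_simps)
  then have "?S powr (q / (q - p)) \<le> (mass q u powr (1 - p / q)) powr (q / (q - p))"
    using best_quotient_pos p_less_q q_pos by (intro powr_mono2) auto
  also have "\<dots> = mass q u"
  proof -
    have e: "(1 - p / q) * (q / (q - p)) = 1" using p_less_q q_pos by (simp add: field_simps)
    show ?thesis unfolding powr_powr e using X by simp
  qed
  finally have "?S powr (q / (q - p)) \<le> mass q u" .
  moreover have "0 \<le> 1 / p - 1 / q" using p_pos p_less_q by (simp add: field_simps)
  ultimately have "ground_energy \<le> (1 / p - 1 / q) * mass q u"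
    unfolding ground_energy_def by (rule mult_left_mono)
  also have "\<dots> = energy G \<nu> Q s p q u" by (simp add: energy_eq[OF u] eq algebra_simps)
  finally show "ground_energy \<le> energy G \<nu> Q s p q u" .
qed

lemma solution_in_nehari:
  assumes "u \<in> nonzero_solutions G \<nu> Q s p q"
  shows "u \<in> nehari_set G \<nu> Q s p q"
proof -
  have u: "u \<in> W0" "nonzero u" "energy_deriv G \<nu> Q s p q u u = 0"
    using assms by (auto simp: nonzero_solutions_def weak_solution_def)
  then show ?thesis
    by (simp add: nehari_set_def nehari_functional_eq energy_deriv_eq pairing_self pairing_q_self)
qed

lemma ground_state:
  obtains \<phi> where "\<phi> \<in> nonzero_solutions G \<nu> Q s p q" "energy G \<nu> Q s p q \<phi> = ground_energy"
proof -
  obtain u where u: "u \<in> sphere_q" "norm_pow u = best_quotient" using minimiser_exists by blast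
  have uW: "u \<in> W0" and uX: "mass q u = 1" using u(1) by (auto simp: sphere_q_def)
  let ?S = best_quotient
  define c where "c = ?S powr (1 / (q - p))"
  have c: "0 < c" using best_quotient_pos by (simp add: c_def)
  have cqp: "c powr (q - p) = ?S" using best_quotient_pos p_less_q by (simp add: c_def powr_powr)
  define \<phi> where "\<phi> = (\<lambda>x. c * u x)"
  have \<phi>: "\<phi> \<in> W0" unfolding \<phi>_def by (rule W0_cmult[OF uW])
  have inc: "incr \<phi> z = c * incr u z" for z by (simp add: \<phi>_def incr_def algebra_simps)
  have hom: "\<bar>c * t\<bar> powr (r - 2) * (c * t) * y = c powr (r - 1) * (\<bar>t\<bar> powr (r - 2) * t * y)" for r t y
  proof -
    have "c powr (r - 1) = c powr (r - 2) * c" using c powr_add[of c "r - 2" 1] by simp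
    then show ?thesis using c by (simp add: abs_mult powr_mult)
  qed
  have "pairing \<phi> \<psi> = c powr (p - 1) * pairing u \<psi>" for \<psi>
    unfolding pairing_def inc by (simp add: \<phi>_def hom distrib_left)
  moreover have "pairing_q \<phi> \<psi> = c powr (q - 1) * pairing_q u \<psi>" for \<psi>
    unfolding pairing_q_def by (simp add: \<phi>_def hom)
  moreover have "c powr (q - 1) = c powr (p - 1) * ?S"
    unfolding cqp[symmetric] using c by (simp flip: powr_add)
  ultimately have "energy_deriv G \<nu> Q s p q \<phi> \<psi> = 0" if "\<psi> \<in> W0" for \<psi>
    using euler_lagrange[OF u that] by (simp add: energy_deriv_eq[OF \<phi> that])
  moreover have X\<phi>: "mass q \<phi> = ?S powr (q / (q - p))"
    unfolding \<phi>_def mass_cmult using c uX by (simp add: c_def powr_powr)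
  moreover have "nonzero \<phi>"
    using X\<phi> best_quotient_pos W0_measurable[OF \<phi>] by (intro nonzero_of_mass[of _ q]) auto
  ultimately have sol: "\<phi> \<in> nonzero_solutions G \<nu> Q s p q"
    using \<phi> by (simp add: nonzero_solutions_def weak_solution_def)
  have "norm_pow \<phi> = mass q \<phi>"
    using solution_in_nehari[OF sol] by (simp add: nehari_set_def nehari_functional_eq[OF \<phi>])
  then have "energy G \<nu> Q s p q \<phi> = ground_energy"
    by (simp add: energy_eq[OF \<phi>] X\<phi> ground_energy_def algebra_simps)
  with sol show thesis by (rule that)
qed

lemma least_energy_solution_exists: "\<exists>\<phi>. least_energy_solution G \<nu> Q s p q \<phi>"
proof -
  obtain \<phi> where \<phi>: "\<phi> \<in> nonzero_solutions G \<nu> Q s p q" "energy G \<nu> Q s p q \<phi> = ground_energy"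
    using ground_state by blast
  then have "least_energy_solution G \<nu> Q s p q \<phi>"
    using nehari_energy(2)[OF solution_in_nehari] by (simp add: least_energy_solution_def)
  then show ?thesis by blast
qed

lemma least_energy_eq:
  assumes "least_energy_solution G \<nu> Q s p q \<phi>"
  shows "energy G \<nu> Q s p q \<phi> = ground_energy"
proof -
  obtain \<phi>0 where \<phi>0: "\<phi>0 \<in> nonzero_solutions G \<nu> Q s p q" "energy G \<nu> Q s p q \<phi>0 = ground_energy"
    using ground_state by blast
  have "energy G \<nu> Q s p q \<phi> \<le> ground_energy" using assms \<phi>0 by (auto simp: least_energy_solution_def)
  moreover have "ground_energy \<le> energy G \<nu> Q s p q \<phi>"
    using assms nehari_energy(2)[OF solution_in_nehari] by (simp add: least_energy_solution_def)
  ultimately show ?thesis by simp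
qed

lemma ground_energy_eq_INF: "ground_energy = (INF u\<in>nehari_set G \<nu> Q s p q. energy G \<nu> Q s p q u)"
proof -
  obtain \<phi> where \<phi>: "\<phi> \<in> nonzero_solutions G \<nu> Q s p q" "energy G \<nu> Q s p q \<phi> = ground_energy"
    using ground_state by blast
  show ?thesis
    by (rule cInf_eq_minimum[symmetric]) (use \<phi> solution_in_nehari nehari_energy(2) in \<open>force+\<close>)
qed

definition \<theta> :: real where "\<theta> = Q * (q - p) / (p * q * s)"

lemma \<theta>_pos: "0 < \<theta>" and \<theta>_less_1: "\<theta> < 1"
proof -
  show "0 < \<theta>" using Q_pos p_less_q p_pos q_pos s_gt_0 by (simp add: \<theta>_def)
  have "q * (Q - p * s) < Q * p" using q_subcritical Q_gt by (simp add: pos_less_divide_eq)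
  then show "\<theta> < 1" using p_pos q_pos s_gt_0 by (simp add: \<theta>_def algebra_simps)
qed

lemma \<theta>_exponents:
  "Q * (q - p) / (s * p\<^sup>2) = \<theta> * (q / p)"
  "(s * p * q - Q * (q - p)) / (s * p\<^sup>2) = (1 - \<theta>) * (q / p)"
  using p_pos q_pos s_gt_0 by (auto simp: \<theta>_def power2_eq_square field_simps)

definition gn_const :: real where
  "gn_const = (\<theta> powr (- \<theta>) * (1 - \<theta>) powr (- (1 - \<theta>)) / best_quotient) powr (q / p)"

lemma gn_const_pos: "0 < gn_const"
  using \<theta>_pos \<theta>_less_1 best_quotient_pos by (simp add: gn_const_def)

lemma mass_dilation:
  assumes l: "0 < l" and u: "u \<in> W0" and int: "integrable lborel (\<lambda>x. \<bar>u x\<bar> powr r)"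
  shows "mass r (\<lambda>x. u (dilation deg l x)) = l powr (- Q) * mass r u"
proof -
  note [measurable] = W0_measurable[OF u]
  have "(\<integral>\<^sup>+x. ennreal (\<bar>u (dilation deg l x)\<bar> powr r) \<partial>lborel) = ennreal (l powr (- Q)) * (\<integral>\<^sup>+x. ennreal (\<bar>u x\<bar> powr r) \<partial>lborel)"
    by (rule nn_integral_dilation_powr[OF l, of "\<lambda>x. ennreal (\<bar>u x\<bar> powr r)"]) simp
  also have "\<dots> = ennreal (l powr (- Q) * mass r u)"
    by (simp add: nn_integral_eq_mass[OF int] ennreal_mult mass_nonneg)
  finally have "(\<integral>\<^sup>+x. ennreal (\<bar>u (dilation deg l x)\<bar> powr r) \<partial>lborel) = ennreal (l powr (- Q) * mass r u)" .
  then show ?thesis unfolding mass_def[of r "\<lambda>x. u (dilation deg l x)"]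
    by (subst integral_eq_nn_integral) (auto simp: mass_nonneg)
qed

lemma seminorm_pow_dilation:
  assumes l: "0 < l" and u: "u \<in> W0"
  shows "seminorm_pow (\<lambda>x. u (dilation deg l x)) = l powr (p * s - Q) * seminorm_pow u"
proof -
  have "ennreal (seminorm_pow (\<lambda>x. u (dilation deg l x))) = ennreal (l powr (p * s - Q) * seminorm_pow u)"
    using gag_dilation[OF l W0_measurable[OF u]]
    by (simp add: gag_eq_seminorm_pow u W0_dilation[OF u l] ennreal_mult seminorm_pow_nonneg)
  then show ?thesis by (simp add: seminorm_pow_nonneg)
qed

lemma scaled_sobolev:
  assumes u: "u \<in> W0" and l: "0 < l"
  shows "best_quotient * mass q u powr (p / q)
    \<le> l powr ((1 - \<theta>) * (p * s)) * seminorm_pow u + l powr (- (\<theta> * (p * s))) * mass p u"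
proof -
  have e: "Q * (p / q) + (p * s - Q) = (1 - \<theta>) * (p * s)" "Q * (p / q) + (- Q) = - (\<theta> * (p * s))"
    using p_pos q_pos s_gt_0 by (auto simp: \<theta>_def field_simps)
  have "best_quotient * (l powr (- Q) * mass q u) powr (p / q)
      \<le> l powr (p * s - Q) * seminorm_pow u + l powr (- Q) * mass p u"
    using sobolev_inequality[OF W0_dilation[OF u l]]
    by (simp add: norm_pow_def seminorm_pow_dilation[OF l u] mass_dilation[OF l u] W0_integrable(1)[OF u] W0_integrable_q[OF u])
  then have "l powr (Q * (p / q)) * (best_quotient * (l powr (- Q) * mass q u) powr (p / q))
      \<le> l powr (Q * (p / q)) * (l powr (p * s - Q) * seminorm_pow u + l powr (- Q) * mass p u)"
    by (rule mult_left_mono) simp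
  moreover have "l powr (Q * (p / q)) * (best_quotient * (l powr (- Q) * mass q u) powr (p / q))
      = best_quotient * mass q u powr (p / q)"
  proof -
    have "l powr (Q * (p / q)) * l powr (- Q * (p / q)) = 1" using l by (simp flip: powr_add)
    moreover have "a * (S * (b * y)) = (a * b) * (S * y)" for a b S y :: real by simp
    ultimately show ?thesis by (simp only: powr_mult powr_powr mult_1)
  qed
  moreover have "l powr (Q * (p / q)) * (l powr (p * s - Q) * seminorm_pow u + l powr (- Q) * mass p u)
      = l powr (Q * (p / q) + (p * s - Q)) * seminorm_pow u + l powr (Q * (p / q) + (- Q)) * mass p u"
    by (simp only: powr_add distrib_left mult.assoc)
  ultimately show ?thesis by (simp only: e)
qed

lemma optimal_dilation:
  fixes A B :: real
  assumes A: "0 < A" and B: "0 < B"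
  obtains l where "0 < l" "l powr ((1 - \<theta>) * (p * s)) * A + l powr (- (\<theta> * (p * s))) * B
    = \<theta> powr (- \<theta>) * (1 - \<theta>) powr (- (1 - \<theta>)) * (A powr \<theta> * B powr (1 - \<theta>))"
proof -
  define \<rho> where "\<rho> = \<theta> * B / ((1 - \<theta>) * A)"
  have \<rho>: "0 < \<rho>" using A B \<theta>_pos \<theta>_less_1 by (simp add: \<rho>_def)
  define l where "l = \<rho> powr (1 / (p * s))"
  have l: "0 < l" using \<rho> by (simp add: l_def)
  have l1: "l powr (x * (p * s)) = \<rho> powr x" for x
  proof -
    have "1 / (p * s) * (x * (p * s)) = x" using p_pos s_gt_0 by simp
    then show ?thesis by (simp only: l_def powr_powr)
  qed
  have "\<rho> powr (1 - \<theta>) * A = \<theta> * (\<theta> powr (- \<theta>) * (1 - \<theta>) powr (- (1 - \<theta>)) * (A powr \<theta> * B powr (1 - \<theta>)))"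
  proof -
    have "\<rho> powr (1 - \<theta>) * A = (\<theta> powr (1 - \<theta>) * B powr (1 - \<theta>)) / ((1 - \<theta>) powr (1 - \<theta>) * A powr (1 - \<theta>)) * A"
      using A B \<theta>_pos \<theta>_less_1 by (simp add: \<rho>_def powr_divide powr_mult)
    also have "A powr (1 - \<theta>) = A / A powr \<theta>" using A by (simp add: powr_diff)
    also have "\<theta> powr (1 - \<theta>) = \<theta> * \<theta> powr (- \<theta>)" using \<theta>_pos by (simp add: powr_diff powr_minus field_simps)
    finally show ?thesis using A by (simp only: powr_minus) (simp add: field_simps)
  qed
  moreover have "\<rho> powr (- \<theta>) * B = (1 - \<theta>) * (\<theta> powr (- \<theta>) * (1 - \<theta>) powr (- (1 - \<theta>)) * (A powr \<theta> * B powr (1 - \<theta>)))"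
  proof -
    have "\<rho> powr (- \<theta>) * B = ((1 - \<theta>) powr \<theta> * A powr \<theta>) / (\<theta> powr \<theta> * B powr \<theta>) * B"
      using A B \<theta>_pos \<theta>_less_1 by (simp add: \<rho>_def powr_minus powr_divide powr_mult)
    moreover have "B powr (1 - \<theta>) = B / B powr \<theta>" using B by (simp add: powr_diff)
    moreover have "(1 - \<theta>) powr (- (1 - \<theta>)) = (1 - \<theta>) powr \<theta> / (1 - \<theta>)"
      using \<theta>_less_1 powr_diff[of "1 - \<theta>" \<theta> 1] by simp
    moreover have "\<theta> powr (- \<theta>) = 1 / \<theta> powr \<theta>" by (rule powr_minus_divide)
    ultimately show ?thesis using B \<theta>_less_1 by simp
  qed
  ultimately have "l powr ((1 - \<theta>) * (p * s)) * A + l powr (- \<theta> * (p * s)) * B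
    = (\<theta> + (1 - \<theta>)) * (\<theta> powr (- \<theta>) * (1 - \<theta>) powr (- (1 - \<theta>)) * (A powr \<theta> * B powr (1 - \<theta>)))"
    unfolding l1 distrib_right by simp
  then show thesis using l by (intro that[of l]) auto
qed

lemma gagliardo_nirenberg_real:
  assumes u: "u \<in> W0" and nz: "nonzero u"
  shows "0 < seminorm_pow u"
    "mass q u \<le> gn_const * seminorm_pow u powr (\<theta> * (q / p)) * mass p u powr ((1 - \<theta>) * (q / p))"
proof -
  let ?A = "seminorm_pow u" and ?B = "mass p u" and ?X = "mass q u" and ?S = best_quotient
  let ?\<kappa> = "\<theta> powr (- \<theta>) * (1 - \<theta>) powr (- (1 - \<theta>))"
  have B: "0 < ?B" by (rule nonzero_mass_pos[OF W0_integrable(1)[OF u] nz])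
  have X: "0 < ?X" by (rule nonzero_mass_pos[OF W0_integrable_q[OF u] nz])
  show A: "0 < ?A"
  proof (rule ccontr)
    assume "\<not> 0 < ?A"
    then have A0: "?A = 0" using seminorm_pow_nonneg[of u] by simp
    define c where "c = ?S * ?X powr (p / q)"
    have c: "0 < c" using best_quotient_pos X by (simp add: c_def)
    define l where "l = (c / (2 * ?B)) powr (- 1 / (\<theta> * (p * s)))"
    have l: "0 < l" using c B by (simp add: l_def)
    have e: "- 1 / (\<theta> * (p * s)) * (- (\<theta> * (p * s))) = 1" using \<theta>_pos p_pos s_gt_0 by simp
    have "l powr (- (\<theta> * (p * s))) = c / (2 * ?B)" unfolding l_def powr_powr e using c B by simp
    then have "c \<le> c / (2 * ?B) * ?B" using scaled_sobolev[OF u l] by (simp only: c_def A0)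
    then have "c \<le> c / 2" using B by simp
    with c show False by simp
  qed
  obtain l where "0 < l" "l powr ((1 - \<theta>) * (p * s)) * ?A + l powr (- (\<theta> * (p * s))) * ?B
    = ?\<kappa> * (?A powr \<theta> * ?B powr (1 - \<theta>))" using optimal_dilation[OF A B] by blast
  with scaled_sobolev[OF u] have "?S * ?X powr (p / q) \<le> ?\<kappa> * (?A powr \<theta> * ?B powr (1 - \<theta>))" by metis
  then have "?X powr (p / q) \<le> (?\<kappa> / ?S) * (?A powr \<theta> * ?B powr (1 - \<theta>))"
    using best_quotient_pos by (simp add: field_simps)
  then have "(?X powr (p / q)) powr (q / p) \<le> ((?\<kappa> / ?S) * (?A powr \<theta> * ?B powr (1 - \<theta>))) powr (q / p)"
    using p_pos q_pos by (intro powr_mono2) auto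
  also have "(?X powr (p / q)) powr (q / p) = ?X" using X p_pos q_pos by (simp add: powr_powr)
  also have "((?\<kappa> / ?S) * (?A powr \<theta> * ?B powr (1 - \<theta>))) powr (q / p)
      = gn_const * ?A powr (\<theta> * (q / p)) * ?B powr ((1 - \<theta>) * (q / p))"
    unfolding gn_const_def using best_quotient_pos \<theta>_pos \<theta>_less_1
    by (simp only: powr_mult powr_powr mult.assoc)
  finally show "?X \<le> gn_const * ?A powr (\<theta> * (q / p)) * ?B powr ((1 - \<theta>) * (q / p))" .
qed

lemma gagliardo_nirenberg_iff:
  "gagliardo_nirenberg G \<nu> Q s p q C \<longleftrightarrow> (\<forall>u\<in>W0. ennreal (mass q u)
     \<le> ennreal (C * seminorm_pow u powr (\<theta> * (q / p)) * mass p u powr ((1 - \<theta>) * (q / p))))"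
  unfolding gagliardo_nirenberg_def \<theta>_exponents gagliardo_pow_eq
  by (intro ball_cong refl) (simp add: nn_integral_eq_mass W0_integrable_q gag_eq_seminorm_pow seminorm_pow_nonneg flip: mass_def)

lemma best_gn_constant: "best_gn_constant G \<nu> Q s p q gn_const"
  unfolding best_gn_constant_def
proof (intro conjI allI impI)
  show "gagliardo_nirenberg G \<nu> Q s p q gn_const"
    unfolding gagliardo_nirenberg_iff
  proof
    fix u assume u: "u \<in> W0"
    show "ennreal (mass q u) \<le> ennreal (gn_const * seminorm_pow u powr (\<theta> * (q / p)) * mass p u powr ((1 - \<theta>) * (q / p)))"
    proof (cases "nonzero u")
      case True
      show ?thesis by (intro ennreal_leI gagliardo_nirenberg_real(2) u True)
    next
      case False
      then have "mass q u = 0" using nonzero_of_mass[OF W0_measurable[OF u], of q] by blast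
      then show ?thesis by simp
    qed
  qed
next
  fix C' assume C': "gagliardo_nirenberg G \<nu> Q s p q C'"
  obtain u where u: "u \<in> sphere_q" "norm_pow u = best_quotient" using minimiser_exists by blast
  have uW: "u \<in> W0" and uX: "mass q u = 1" using u(1) by (auto simp: sphere_q_def)
  have nz: "nonzero u" using uX W0_measurable[OF uW] by (intro nonzero_of_mass[of _ q]) auto
  let ?A = "seminorm_pow u" and ?B = "mass p u" and ?S = best_quotient
  let ?\<kappa> = "\<theta> powr (- \<theta>) * (1 - \<theta>) powr (- (1 - \<theta>))"
  have A: "0 < ?A" by (rule gagliardo_nirenberg_real(1)[OF uW nz])
  have B: "0 < ?B" by (rule nonzero_mass_pos[OF W0_integrable(1)[OF uW] nz])
  let ?T = "?A powr (\<theta> * (q / p)) * ?B powr ((1 - \<theta>) * (q / p))"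
  have T: "0 < ?T" using A B by simp
  have "(?A / \<theta>) powr \<theta> * (?B / (1 - \<theta>)) powr (1 - \<theta>) \<le> \<theta> * (?A / \<theta>) + (1 - \<theta>) * (?B / (1 - \<theta>))"
    using \<theta>_pos \<theta>_less_1 A B by (intro Youngs_inequality_0) auto
  also have "\<dots> = ?S" using \<theta>_pos \<theta>_less_1 u(2) by (simp add: norm_pow_def)
  also have "(?A / \<theta>) powr \<theta> * (?B / (1 - \<theta>)) powr (1 - \<theta>) = ?\<kappa> * (?A powr \<theta> * ?B powr (1 - \<theta>))"
    using \<theta>_pos \<theta>_less_1 A B by (simp only: powr_divide powr_minus_divide) simp
  finally have "(?\<kappa> / ?S) * (?A powr \<theta> * ?B powr (1 - \<theta>)) \<le> 1"
    using best_quotient_pos by (simp add: field_simps)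
  then have "((?\<kappa> / ?S) * (?A powr \<theta> * ?B powr (1 - \<theta>))) powr (q / p) \<le> 1 powr (q / p)"
    using best_quotient_pos p_pos q_pos by (intro powr_mono2) auto
  then have 1: "gn_const * ?T \<le> 1"
    unfolding gn_const_def using best_quotient_pos \<theta>_pos \<theta>_less_1
    by (simp only: powr_mult powr_powr powr_one_eq_one)
  have "ennreal 1 \<le> ennreal (C' * ?A powr (\<theta> * (q / p)) * ?B powr ((1 - \<theta>) * (q / p)))"
    using C' uW uX unfolding gagliardo_nirenberg_iff by metis
  then have "1 \<le> C' * ?T" by (subst (asm) ennreal_le_iff2) (auto simp: mult.assoc)
  with 1 have "gn_const * ?T \<le> C' * ?T" by simp
  then show "gn_const \<le> C'" using T by (rule mult_right_le_imp_le)
qed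

lemma gn_const_eq:
  "gn_const = p * q * s / (p * q * s - Q * (q - p))
     * (Q * (q - p) / (p * q * s - Q * (q - p))) powr (Q * (p - q) / (s * p\<^sup>2))
     * ((p * q * s - Q * (q - p)) / ((q - p) * s) * ground_energy) powr ((p - q) / p)"
proof -
  let ?S = best_quotient and ?c = "1 - \<theta>"
  have c: "0 < ?c" using \<theta>_less_1 by simp
  have Qq: "Q * (q - p) = p * q * s * \<theta>" using p_pos q_pos s_gt_0 by (simp add: \<theta>_def)
  have D: "p * q * s - Q * (q - p) = p * q * s * ?c" unfolding Qq by (simp add: algebra_simps)
  have 1: "p * q * s / (p * q * s - Q * (q - p)) = 1 / ?c" unfolding D using p_pos q_pos s_gt_0 by simp
  have 2: "Q * (q - p) / (p * q * s - Q * (q - p)) = \<theta> / ?c" unfolding D unfolding Qq using p_pos q_pos s_gt_0 by simp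
  have 3: "Q * (p - q) / (s * p\<^sup>2) = - (\<theta> * (q / p))"
    using \<theta>_exponents(1) by (simp add: minus_divide_left[symmetric] right_diff_distrib diff_divide_distrib)
  have "(p * q * s - Q * (q - p)) / ((q - p) * s) * ground_energy
      = (p * q / (q - p)) * (1 / p - 1 / q) * (?c * ?S powr (q / (q - p)))"
    unfolding D ground_energy_def using s_gt_0 by simp
  also have "(p * q / (q - p)) * (1 / p - 1 / q) = 1" using p_pos q_pos p_less_q by (simp add: field_simps)
  finally have 4: "(p * q * s - Q * (q - p)) / ((q - p) * s) * ground_energy = ?c * ?S powr (q / (q - p))" by simp
  have e1: "q / (q - p) * ((p - q) / p) = - (q / p)" using p_less_q p_pos by (simp add: field_simps)
  have "1 / ?c * (\<theta> / ?c) powr (- (\<theta> * (q / p))) * (?c * ?S powr (q / (q - p))) powr ((p - q) / p)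
      = (?c powr (- 1) * ?c powr (\<theta> * (q / p)) * ?c powr ((p - q) / p)) * \<theta> powr (- (\<theta> * (q / p))) * ?S powr (- (q / p))"
  proof -
    have a1: "(x / y) powr (- e) = x powr (- e) * y powr e" if "0 < x" "0 < y" for x y e :: real
      using that by (simp add: powr_divide powr_minus_divide)
    have a2: "1 / ?c = ?c powr (- 1)" using c by (simp add: powr_minus_divide)
    show ?thesis
      unfolding a1[OF \<theta>_pos c] a2 powr_mult powr_powr e1 by (simp only: mult_ac)
  qed
  also have "?c powr (- 1) * ?c powr (\<theta> * (q / p)) * ?c powr ((p - q) / p) = ?c powr (- (?c * (q / p)))"
  proof -
    have "- 1 + \<theta> * (q / p) + (p - q) / p = - (?c * (q / p))" using p_pos by (simp add: field_simps)
    then show ?thesis by (simp only: powr_add[symmetric])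
  qed
  also have "?c powr (- (?c * (q / p))) * \<theta> powr (- (\<theta> * (q / p))) * ?S powr (- (q / p)) = gn_const"
  proof -
    have a3: "(x * y / S) powr r = y powr r * x powr r * S powr (- r)" if "0 < x" "0 < y" "0 < S" for x y S r :: real
      using that by (simp add: powr_divide powr_mult powr_minus_divide)
    have "0 < \<theta> powr (- \<theta>)" "0 < ?c powr (- ?c)" using \<theta>_pos c by simp_all
    from a3[OF this best_quotient_pos, of "q / p"] show ?thesis
      by (simp only: gn_const_def powr_powr mult_minus_left)
  qed
  finally show ?thesis unfolding 1 2 3 4 by simp
qed

text \<open>For any \<open>c > 0\<close> one has \<open>ln y \<le> y / c - 1 + ln c\<close>. With \<open>y = w\<^sup>a\<close> and \<open>c\<close> the integral of
  \<open>w\<^bsup>1 + a\<^esup>\<close> this yields Jensen's inequality for the probability density \<open>w\<close>.\<close>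

lemma log_inequality:
  assumes u: "u \<in> W0" and nz: "nonzero u"
  shows "lp_entropy p u \<le> ereal (Q / s * ln (gn_const powr (p * s / (Q * (q - p)))
           * (enn2real (gagliardo_pow G \<nu> Q s p u) powr (1 / p) / lp_norm p u)))"
proof -
  note [measurable] = W0_measurable[OF u]
  let ?A = "seminorm_pow u" and ?B = "mass p u" and ?X = "mass q u"
  have A: "0 < ?A" by (rule gagliardo_nirenberg_real(1)[OF u nz])
  have B: "0 < ?B" by (rule nonzero_mass_pos[OF W0_integrable(1)[OF u] nz])
  have X: "0 < ?X" by (rule nonzero_mass_pos[OF W0_integrable_q[OF u] nz])
  have lp: "lp_norm p u = ?B powr (1 / p)" by (simp add: lp_norm_def mass_def)
  then have lpp: "lp_norm p u powr p = ?B" using B p_pos by (simp add: powr_powr)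
  define a where "a = (q - p) / p"
  have a: "0 < a" using p_less_q p_pos by (simp add: a_def)
  define Y where "Y = ?X / ?B powr (q / p)"
  have Y: "0 < Y" using X B by (simp add: Y_def)
  define w where "w x = \<bar>u x\<bar> powr p / ?B" for x
  have w_nn: "0 \<le> w x" for x using B by (simp add: w_def)
  have wa: "w x powr (1 + a) = \<bar>u x\<bar> powr q / ?B powr (q / p)" for x
  proof -
    have "p * (1 + a) = q" "1 + a = q / p" using p_pos by (auto simp: a_def field_simps)
    then show ?thesis using B by (simp add: w_def powr_divide powr_powr)
  qed
  define h where "h x = 1 / a * (w x powr (1 + a) / Y - w x + w x * ln Y)" for x
  have wi: "integrable lborel w" "(\<integral>x. w x \<partial>lborel) = 1"
    using W0_integrable(1)[OF u] B unfolding w_def by (auto simp: mass_def)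
  have wai: "integrable lborel (\<lambda>x. w x powr (1 + a))" "(\<integral>x. w x powr (1 + a) \<partial>lborel) = Y"
    unfolding wa using W0_integrable_q[OF u] by (auto simp: Y_def mass_def)
  have hi: "integrable lborel h" unfolding h_def using wi(1) wai(1) by auto
  have "(\<integral>x. h x \<partial>lborel) = 1 / a * ((\<integral>x. w x powr (1 + a) \<partial>lborel) / Y - (\<integral>x. w x \<partial>lborel) + (\<integral>x. w x \<partial>lborel) * ln Y)"
    unfolding h_def using wi(1) wai(1) by simp
  then have hint: "(\<integral>x. h x \<partial>lborel) = 1 / a * ln Y" using Y by (simp add: wi(2) wai(2))
  have le: "w x * ln (w x) \<le> h x" for x
  proof (cases "w x = 0")
    case False
    then have wp: "0 < w x" using w_nn[of x] by simp
    have "ln (w x powr a / Y) \<le> w x powr a / Y - 1" using wp Y by (intro ln_le_minus_one) simp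
    then have "a * ln (w x) \<le> w x powr a / Y - 1 + ln Y" using wp Y by (simp add: ln_div ln_powr)
    then have "w x * (a * ln (w x)) \<le> w x * (w x powr a / Y - 1 + ln Y)"
      using wp by (intro mult_left_mono) auto
    also have "\<dots> = w x powr (1 + a) / Y - w x + w x * ln Y"
      using wp by (simp add: powr_add algebra_simps)
    finally show ?thesis using a by (simp add: h_def field_simps)
  qed (simp add: h_def)
  have "lp_entropy p u = extended_integral (\<lambda>x. w x * ln (w x))"
    unfolding lp_entropy_def lpp w_def ..
  also have "\<dots> \<le> ereal (\<integral>x. h x \<partial>lborel)"
    by (rule extended_integral_le[OF _ hi le]) (unfold w_def, measurable)
  also have "(\<integral>x. h x \<partial>lborel) = 1 / a * ln Y" by (rule hint)
  also have "ereal (1 / a * ln Y) \<le> ereal (Q / s * ln (gn_const powr (p * s / (Q * (q - p)))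
           * (enn2real (gagliardo_pow G \<nu> Q s p u) powr (1 / p) / lp_norm p u)))"
  proof -
    have "?X \<le> gn_const * ?A powr (\<theta> * (q / p)) * ?B powr ((1 - \<theta>) * (q / p))"
      by (rule gagliardo_nirenberg_real(2)[OF u nz])
    then have "ln ?X \<le> ln (gn_const * ?A powr (\<theta> * (q / p)) * ?B powr ((1 - \<theta>) * (q / p)))"
      using X gn_const_pos A B by (subst ln_le_cancel_iff) auto
    also have "\<dots> = ln gn_const + \<theta> * (q / p) * ln ?A + (1 - \<theta>) * (q / p) * ln ?B"
      using gn_const_pos A B by (simp add: ln_mult ln_powr)
    finally have "ln Y \<le> ln gn_const + \<theta> * (q / p) * (ln ?A - ln ?B)"
      using X B by (simp add: Y_def ln_div ln_powr algebra_simps)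
    then have "1 / a * ln Y \<le> 1 / a * (ln gn_const + \<theta> * (q / p) * (ln ?A - ln ?B))"
      using a by (intro mult_left_mono) auto
    also have "\<dots> = p / (q - p) * ln gn_const + Q / (s * p) * (ln ?A - ln ?B)"
    proof -
      have "1 / a = p / (q - p)" by (simp add: a_def)
      moreover have "p / (q - p) * (\<theta> * (q / p)) = Q / (s * p)"
        using p_less_q p_pos q_pos s_gt_0 by (simp add: \<theta>_def field_simps)
      ultimately show ?thesis by (simp only: distrib_left mult.assoc[symmetric])
    qed
    also have "\<dots> = Q / s * ln (gn_const powr (p * s / (Q * (q - p))) * (?A powr (1 / p) / ?B powr (1 / p)))"
    proof -
      have eq: "ln (gn_const powr (p * s / (Q * (q - p))) * (?A powr (1 / p) / ?B powr (1 / p)))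
          = p * s / (Q * (q - p)) * ln gn_const + (1 / p * ln ?A - 1 / p * ln ?B)"
        using gn_const_pos A B by (simp add: ln_mult ln_div ln_powr)
      have "Q / s * (p * s / (Q * (q - p)) * x + (1 / p * y - 1 / p * z)) = p / (q - p) * x + Q / (s * p) * (y - z)"
        for x y z
      proof -
        have 1: "Q / s * (p * s / (Q * (q - p))) = p / (q - p)" using s_gt_0 Q_pos by simp
        have 2: "Q / s * (1 / p * y - 1 / p * z) = Q / (s * p) * (y - z)" by (simp add: right_diff_distrib)
        have "Q / s * (p * s / (Q * (q - p)) * x + (1 / p * y - 1 / p * z))
            = Q / s * (p * s / (Q * (q - p))) * x + Q / s * (1 / p * y - 1 / p * z)"
          by (simp only: distrib_left mult.assoc)
        then show ?thesis by (simp only: 1 2)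
      qed
      then show ?thesis unfolding eq by simp
    qed
    finally show ?thesis
      using seminorm_pow_nonneg[of u] by (simp add: gagliardo_pow_eq gag_eq_seminorm_pow[OF u] lp)
  qed
  finally show ?thesis .
qed

end

theorem theorem1p8:
  fixes G :: "(real^'n) monoid" and k :: nat and deg :: "'n \<Rightarrow> nat"
    and \<nu> :: "real^'n \<Rightarrow> real" and Q s p q :: real
  assumes "stratified_lie_group G k deg"
    and "homogeneous_quasi_norm G deg \<nu>"
    and "Q = real (homogeneous_dim k deg)"
    and "0 < s" and "s < 1" and "1 < p" and "p * s < Q"
    and "p < q" and "q < Q * p / (Q - p * s)"
  shows "\<exists>C. best_gn_constant G \<nu> Q s p q C \<and>
    (\<forall>u\<in>sobolev_space0 G \<nu> Q s p. nonzero u \<longrightarrow>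
       lp_entropy p u
       \<le> ereal (Q / s * ln (C powr (p * s / (Q * (q - p)))
           * (enn2real (gagliardo_pow G \<nu> Q s p u) powr (1 / p) / lp_norm p u)))) \<and>
    (\<exists>\<phi>. least_energy_solution G \<nu> Q s p q \<phi>) \<and>
    (\<forall>\<phi> d. least_energy_solution G \<nu> Q s p q \<phi> \<and> d = energy G \<nu> Q s p q \<phi> \<longrightarrow>
       d = (INF u\<in>nehari_set G \<nu> Q s p q. energy G \<nu> Q s p q u) \<and>
       C = p * q * s / (p * q * s - Q * (q - p))
           * (Q * (q - p) / (p * q * s - Q * (q - p))) powr (Q * (p - q) / (s * p\<^sup>2))
           * ((p * q * s - Q * (q - p)) / ((q - p) * s) * d) powr ((p - q) / p))"
proof -
  interpret stratified_lie_group G k deg by fact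
  interpret subcritical G k deg \<nu> Q s p q
    by unfold_locales (use assms in auto)
  have "d = (INF u\<in>nehari_set G \<nu> Q s p q. energy G \<nu> Q s p q u) \<and>
       gn_const = p * q * s / (p * q * s - Q * (q - p))
           * (Q * (q - p) / (p * q * s - Q * (q - p))) powr (Q * (p - q) / (s * p\<^sup>2))
           * ((p * q * s - Q * (q - p)) / ((q - p) * s) * d) powr ((p - q) / p)"
    if "least_energy_solution G \<nu> Q s p q \<phi> \<and> d = energy G \<nu> Q s p q \<phi>" for \<phi> d
  proof -
    have "d = ground_energy" using that least_energy_eq by blast
    with ground_energy_eq_INF gn_const_eq show ?thesis by simp
  qed
  then show ?thesis
    using best_gn_constant log_inequality least_energy_solution_exists
    by (intro exI[of _ gn_const] conjI ballI allI impI) blast+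
qed

end
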